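(* The space $X_{M(1),u}$ is arbitrarily distortable.
   Context: $\mathbb N=\{1,2,\dots\}$; $c_{00}$ is the space of finitely supported real sequences with standard basis $(e_i)$. For finite $E,F\subset\mathbb N$, $E<F$ means $\max E<\min F$ or one of them is empty; $n\le E$ means $n\le\min E$. Schreier families: $\mathcal F_0=\{\emptyset\}\cup\{\{n\}:n\in\mathbb N\}$, $\mathcal F_{n+1}=\{\emptyset\}\cup\{\bigcup_{i=1}^kA_i: k\in\mathbb N,\ A_i\in\mathcal F_n,\ k\le A_1<\dots<A_k\}$. A finite sequence $(E_i)_{i=1}^d$ of nonempty finite subsets of $\mathbb N$ with $\{\min E_1,\dots,\min E_d\}\in\mathcal M$ is $\mathcal M$-admissible if $E_1<\dots<E_d$, and $\mathcal M$-allowable if the $E_i$ are pairwise disjoint; functionals are admissible/allowable if their supports are. Fix integers $(m_j)_{j\ge1}$ with $m_1=2$ and $m_j>m_{j-1}^{m_{j-1}}$ for $j\ge2$. Set $k_1=1$ and, for $n\ge2$, choose a positive integer $t_n$ with $2^{t_n}\ge m_n^2$ and set $k_n=t_n(k_{n-1}+1)+1$. Let $\mathcal M_j=\mathcal F_{k_j}$. The space $X_{M(1),u}=T_{M(1)}[(\mathcal M_j,\frac1{m_j})_{j=1}^\infty]$ is the completion of $c_{00}$ under $\|x\|=\sup_{f\in K}f(x)$, where $K$ is the smallest set of finitely supported functionals containing $\pm e_n$ for all $n$, containing $\frac12(f_1+\dots+f_d)$ whenever $f_i\in K$ and $(f_i)_{i=1}^d$ is $\mathcal M_1$-allowable, and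 containing $\frac1{m_j}(f_1+\dots+f_d)$ whenever $j\ge2$, $f_i\in K$ and $(f_i)_{i=1}^d$ is $\mathcal M_j$-admissible. For $\lambda>1$ a Banach space $X$ is $\lambda$-distortable if there is an equivalent norm $|\cdot|$ on $X$ such that for every infinite dimensional subspace $Y$ of $X$, $\sup\{|y|/|z|:y,z\in Y,\ \|y\|=\|z\|=1\}\ge\lambda$. $X$ is arbitrarily distortable if it is $\lambda$-distortable for every $\lambda>1$. *)

theory Defs
  imports "HOL-Analysis.Analysis" "HOL-Analysis.Finite_Function_Topology" "HOL-Probability.Discrete_Topology"
begin

text \<open>The positive integers are the set \<open>{1..}\<close> of type \<^typ>\<open>nat\<close>:
  coordinates of sequences are numbered from 1, and so are \<open>m\<close> and \<open>k\<close>.\<close>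

definition before :: "nat set \<Rightarrow> nat set \<Rightarrow> bool" where
  "before E F \<longleftrightarrow> E = {} \<or> F = {} \<or> Max E < Min F"

text \<open>Since \<open>before\<close> holds trivially as soon as one side is empty, it is not transitive.
  Hence a chain \<open>k \<le> A\<^sub>1 < \<dots> < A\<^sub>k\<close> is read pairwise, and \<open>k \<le> A\<^sub>i\<close>
  is demanded for all \<open>i\<close>, with no demand on empty \<open>A\<^sub>i\<close>.\<close>

primrec schreier :: "nat \<Rightarrow> nat set set" where
  "schreier 0 = {{}} \<union> {{n} | n. 1 \<le> n}"
| "schreier (Suc n) = {{}} \<union> {\<Union>(set As) | As. As \<noteq> [] \<and> set As \<subseteq> schreier n \<and>
     (\<forall>A\<in>set As. \<forall>a\<in>A. length As \<le> a) \<and> sorted_wrt before As}"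

definition admissible :: "nat set set \<Rightarrow> nat set list \<Rightarrow> bool" where
  "admissible M Es \<longleftrightarrow> Es \<noteq> [] \<and> (\<forall>E\<in>set Es. finite E \<and> E \<noteq> {}) \<and>
     Min ` set Es \<in> M \<and> sorted_wrt before Es"

definition allowable :: "nat set set \<Rightarrow> nat set list \<Rightarrow> bool" where
  "allowable M Es \<longleftrightarrow> Es \<noteq> [] \<and> (\<forall>E\<in>set Es. finite E \<and> E \<noteq> {}) \<and>
     Min ` set Es \<in> M \<and> sorted_wrt disjnt Es"

definition c00 :: "(nat \<Rightarrow>\<^sub>0 real) set" where
  "c00 = {x. Poly_Mapping.keys x \<subseteq> {1..}}"

text \<open>Finitely supported functionals are identified with their coefficient sequences.\<close>

definition pairing :: "(nat \<Rightarrow>\<^sub>0 real) \<Rightarrow> (nat \<Rightarrow>\<^sub>0 real) \<Rightarrow> real" where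
  "pairing f x = (\<Sum>i\<in>Poly_Mapping.keys f. Poly_Mapping.lookup f i * Poly_Mapping.lookup x i)"

text \<open>The norming set of \<open>T\<^bsub>M(1)\<^esub>[(\<F>\<^bsub>k j\<^esub>, 1/m j)\<^sub>j]\<close>.\<close>

inductive_set norming_set :: "(nat \<Rightarrow> nat) \<Rightarrow> (nat \<Rightarrow> nat) \<Rightarrow> (nat \<Rightarrow>\<^sub>0 real) set"
  for m k :: "nat \<Rightarrow> nat" where
  pos: "1 \<le> n \<Longrightarrow> Poly_Mapping.single n 1 \<in> norming_set m k"
| neg: "1 \<le> n \<Longrightarrow> - Poly_Mapping.single n 1 \<in> norming_set m k"
| allowable: "\<lbrakk>\<forall>f\<in>set fs. f \<in> norming_set m k;
     allowable (schreier (k 1)) (map Poly_Mapping.keys fs)\<rbrakk>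
     \<Longrightarrow> (1/2) *\<^sub>R sum_list fs \<in> norming_set m k"
| admissible: "\<lbrakk>2 \<le> j; \<forall>f\<in>set fs. f \<in> norming_set m k;
     admissible (schreier (k j)) (map Poly_Mapping.keys fs)\<rbrakk>
     \<Longrightarrow> (1 / real (m j)) *\<^sub>R sum_list fs \<in> norming_set m k"

text \<open>The norm of the space on \<open>c00\<close>; it is unrelated to the \<open>\<ell>\<^sub>1\<close>-type norm that the
  library installs on the type of finitely supported functions.\<close>

definition mixed_norm :: "(nat \<Rightarrow> nat) \<Rightarrow> (nat \<Rightarrow> nat) \<Rightarrow> (nat \<Rightarrow>\<^sub>0 real) \<Rightarrow> real" where
  "mixed_norm m k x = (SUP f\<in>norming_set m k. pairing f x)"

text \<open>A type cannot depend on \<open>m\<close> and \<open>k\<close>, so a completion of \<open>c00\<close> under a norm \<open>N\<close> is a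
  subset \<open>X\<close> of an ambient Banach space: the closure of a linear isometric copy of
  \<open>c00\<close>. The case \<open>X = UNIV\<close> covers completions that are types of their own.\<close>

definition is_completion ::
    "((nat \<Rightarrow>\<^sub>0 real) \<Rightarrow> real) \<Rightarrow> ((nat \<Rightarrow>\<^sub>0 real) \<Rightarrow> 'a::banach) \<Rightarrow> 'a set \<Rightarrow> bool" where
  "is_completion N J X \<longleftrightarrow>
     (\<forall>x\<in>c00. \<forall>y\<in>c00. J (x + y) = J x + J y) \<and>
     (\<forall>c. \<forall>x\<in>c00. J (c *\<^sub>R x) = c *\<^sub>R J x) \<and>
     (\<forall>x\<in>c00. norm (J x) = N x) \<and>
     X = closure (J ` c00)"

definition equivalent_norm_on :: "'a::real_normed_vector set \<Rightarrow> ('a \<Rightarrow> real) \<Rightarrow> bool" where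
  "equivalent_norm_on X p \<longleftrightarrow>
     (\<forall>x\<in>X. p x = 0 \<longleftrightarrow> x = 0) \<and>
     (\<forall>c. \<forall>x\<in>X. p (c *\<^sub>R x) = \<bar>c\<bar> * p x) \<and>
     (\<forall>x\<in>X. \<forall>y\<in>X. p (x + y) \<le> p x + p y) \<and>
     (\<exists>c>0. \<exists>C>0. \<forall>x\<in>X. c * norm x \<le> p x \<and> p x \<le> C * norm x)"

definition infinite_dimensional :: "'a::real_vector set \<Rightarrow> bool" where
  "infinite_dimensional Y \<longleftrightarrow> \<not> (\<exists>B. finite B \<and> Y \<subseteq> span B)"

text \<open>\<open>X\<close> is a linear subspace of the ambient space, with the norm inherited from it.\<close>

definition distortable :: "real \<Rightarrow> 'a::real_normed_vector set \<Rightarrow> bool" where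
  "distortable lam X \<longleftrightarrow> (\<exists>p. equivalent_norm_on X p \<and>
     (\<forall>Y. subspace Y \<and> Y \<subseteq> X \<and> infinite_dimensional Y \<longrightarrow>
        Sup {p y / p z | y z. y \<in> Y \<and> z \<in> Y \<and> norm y = 1 \<and> norm z = 1} \<ge> lam))"

definition arbitrarily_distortable :: "'a::real_normed_vector set \<Rightarrow> bool" where
  "arbitrarily_distortable X \<longleftrightarrow> (\<forall>lam>1. distortable lam X)"

text \<open>Completions exist: let \<open>c00\<close> act as bounded functions on the norming set.\<close>

lemma lookup_scaleR_pm [simp]:
  "Poly_Mapping.lookup (c *\<^sub>R (x :: nat \<Rightarrow>\<^sub>0 real)) i = c * Poly_Mapping.lookup x i"
proof -
  have "finite {i. c *\<^sub>R Poly_Mapping.lookup x i \<noteq> 0}"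
    by (rule finite_subset[OF _ finite_keys[of x]]) (auto simp: in_keys_iff)
  then show ?thesis
    by (simp add: scaleR_poly_mapping_def Abs_poly_mapping_inverse)
qed

lemma lookup_sum_list_pm:
  "Poly_Mapping.lookup (sum_list fs) i = (\<Sum>f\<leftarrow>fs. Poly_Mapping.lookup (f :: nat \<Rightarrow>\<^sub>0 real) i)"
  by (induction fs) (simp_all add: lookup_add)

lemma lookup_sum_list_disjnt:
  assumes "sorted_wrt disjnt (map Poly_Mapping.keys fs)"
    and "\<forall>f\<in>set fs. \<bar>Poly_Mapping.lookup (f :: nat \<Rightarrow>\<^sub>0 real) i\<bar> \<le> 1"
  shows "\<bar>Poly_Mapping.lookup (sum_list fs) i\<bar> \<le> 1"
  using assms
proof (induction fs)
  case (Cons f fs)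
  show ?case
  proof (cases "Poly_Mapping.lookup f i = 0")
    case True
    with Cons show ?thesis by (simp add: lookup_add)
  next
    case False
    have "\<forall>g\<in>set fs. Poly_Mapping.lookup g i = 0"
      using False Cons.prems(1) by (auto simp: disjnt_iff in_keys_iff)
    then have "Poly_Mapping.lookup (sum_list fs) i = 0"
      by (simp add: lookup_sum_list_pm sum_list_0 cong: map_cong)
    with Cons.prems show ?thesis by (simp add: lookup_add)
  qed
qed simp

lemma admissible_imp_disjnt:
  assumes "admissible M Es"
  shows "sorted_wrt disjnt Es"
proof (rule sorted_wrt_mono_rel)
  show "sorted_wrt before Es" using assms by (simp add: admissible_def)
next
  fix E F assume "E \<in> set Es" "F \<in> set Es" "before E F"
  then have "finite E" "finite F" "E \<noteq> {}" "F \<noteq> {}" "Max E < Min F"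
    using assms by (auto simp: admissible_def before_def)
  then show "disjnt E F"
    by (auto simp: disjnt_iff)
qed

lemma norming_set_bound:
  assumes "f \<in> norming_set m k"
  shows "\<bar>Poly_Mapping.lookup f i\<bar> \<le> 1"
  using assms
proof induction
  case (allowable fs)
  then have "\<bar>Poly_Mapping.lookup (sum_list fs) i\<bar> \<le> 1"
    by (intro lookup_sum_list_disjnt) (auto simp: allowable_def)
  then show ?case by (simp add: abs_mult)
next
  case (admissible j fs)
  then have *: "\<bar>Poly_Mapping.lookup (sum_list fs) i\<bar> \<le> 1"
    by (intro lookup_sum_list_disjnt admissible_imp_disjnt) auto
  have "1 / real (m j) \<le> 1" by (cases "m j = 0") auto
  with mult_le_one[OF this abs_ge_zero *] show ?case by (simp add: abs_mult)
qed (auto simp: lookup_single when_def)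

lemma uminus_norming_set:
  assumes "f \<in> norming_set m k"
  shows "- f \<in> norming_set m k"
proof -
  have neg_list: "- sum_list fs = sum_list (map uminus fs)"
    and keys_list: "map (Poly_Mapping.keys \<circ> uminus) fs = map Poly_Mapping.keys fs"
    for fs :: "(nat \<Rightarrow>\<^sub>0 real) list"
    by (induction fs) simp_all
  show ?thesis using assms
  proof induction
    case (pos n)
    then show ?case by (rule norming_set.neg)
  next
    case (neg n)
    then show ?case by (simp add: norming_set.pos)
  next
    case (allowable fs)
    then have "(1/2) *\<^sub>R sum_list (map uminus fs) \<in> norming_set m k"
      by (intro norming_set.allowable) (auto simp: keys_list)
    then show ?case by (simp only: scaleR_minus_right[symmetric] neg_list)
  next
    case (admissible j fs)
    then have "(1 / real (m j)) *\<^sub>R sum_list (map uminus fs) \<in> norming_set m k"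
      by (intro norming_set.admissible) (auto simp: keys_list)
    then show ?case by (simp only: scaleR_minus_right[symmetric] neg_list)
  qed
qed

lemma pairing_eq:
  assumes "finite A" "Poly_Mapping.keys x \<subseteq> A"
  shows "pairing f x = (\<Sum>i\<in>A. Poly_Mapping.lookup f i * Poly_Mapping.lookup x i)"
proof -
  have "pairing f x = (\<Sum>i\<in>A \<union> Poly_Mapping.keys f. Poly_Mapping.lookup f i * Poly_Mapping.lookup x i)"
    unfolding pairing_def using assms
    by (intro sum.mono_neutral_left) (auto simp: in_keys_iff)
  also have "\<dots> = (\<Sum>i\<in>A. Poly_Mapping.lookup f i * Poly_Mapping.lookup x i)"
    using assms by (intro sum.mono_neutral_right) (auto simp: in_keys_iff)
  finally show ?thesis .
qed

lemma pairing_bound: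
  assumes "f \<in> norming_set m k"
  shows "\<bar>pairing f x\<bar> \<le> (\<Sum>i\<in>Poly_Mapping.keys x. \<bar>Poly_Mapping.lookup x i\<bar>)"
proof -
  have "\<bar>pairing f x\<bar> \<le> (\<Sum>i\<in>Poly_Mapping.keys x. \<bar>Poly_Mapping.lookup f i * Poly_Mapping.lookup x i\<bar>)"
    by (subst pairing_eq[of "Poly_Mapping.keys x"]) auto
  also have "\<dots> \<le> (\<Sum>i\<in>Poly_Mapping.keys x. \<bar>Poly_Mapping.lookup x i\<bar>)"
    using norming_set_bound[OF assms] by (intro sum_mono) (simp add: abs_mult mult_left_le_one_le)
  finally show ?thesis .
qed

lemma pairing_add: "pairing f (x + y) = pairing f x + pairing f y"
  and pairing_scaleR: "pairing f (c *\<^sub>R x) = c * pairing f x"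
  and pairing_uminus: "pairing (- f) x = - pairing f x"
  by (simp_all add: pairing_def lookup_add algebra_simps sum.distrib sum_distrib_left sum_negf)

instance bcontfun :: (metric_space, banach) banach ..

lemma completion_exists:
  "\<exists>(J :: (nat \<Rightarrow>\<^sub>0 real) \<Rightarrow> (nat \<Rightarrow>\<^sub>0 real) discrete \<Rightarrow>\<^sub>C real) X.
     is_completion (mixed_norm m k) J X"
proof -
  define K where "K = norming_set m k"
  define g where "g x f = (if of_discrete f \<in> K then pairing (of_discrete f) x else 0)" for x f
  define J where "J x = Bcontfun (g x)" for x
  define S where "S x = (\<Sum>i\<in>Poly_Mapping.keys x. \<bar>Poly_Mapping.lookup x i\<bar>)"
    for x :: "(nat \<Rightarrow>\<^sub>0 real)"
  have bound: "\<bar>pairing f x\<bar> \<le> S x" if "f \<in> K" for f x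
    using pairing_bound that by (simp add: K_def S_def)
  have S0: "0 \<le> S x" for x by (simp add: S_def sum_nonneg)
  have "g x \<in> bcontfun" for x
  proof (rule bcontfun_normI)
    show "continuous_on UNIV (g x)"
      by (simp add: continuous_on_open_vimage open_discrete)
    show "norm (g x f) \<le> S x" for f
      using bound S0 by (auto simp: g_def)
  qed
  then have apply_J: "apply_bcontfun (J x) = g x" for x
    by (simp add: J_def Bcontfun_inverse)
  have bdd: "bdd_above ((\<lambda>f. pairing f x) ` K)" for x
    using bound by (intro bdd_aboveI2[of _ _ "S x"]) (auto dest: abs_le_D1)
  have le: "\<bar>pairing f x\<bar> \<le> mixed_norm m k x" if "f \<in> K" for f x
  proof -
    have "- f \<in> K" using that uminus_norming_set by (simp add: K_def)
    then have "pairing f x \<le> mixed_norm m k x" "- pairing f x \<le> mixed_norm m k x"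
      using cSUP_upper[OF that bdd, of x] cSUP_upper[OF _ bdd, of "- f" x]
      by (simp_all add: mixed_norm_def K_def pairing_uminus)
    then show ?thesis by simp
  qed
  have K1: "Poly_Mapping.single 1 1 \<in> K" by (simp add: K_def norming_set.pos)
  have "norm (J x) = mixed_norm m k x" for x
  proof (rule antisym)
    show "norm (J x) \<le> mixed_norm m k x"
      using le le[OF K1, of x] by (intro norm_bound) (auto simp: apply_J g_def)
    have "pairing f x \<le> norm (J x)" if "f \<in> K" for f
      using norm_bounded[of "J x" "discrete f"] that
      by (simp add: apply_J g_def discrete_inverse)
    then show "mixed_norm m k x \<le> norm (J x)"
      unfolding mixed_norm_def K_def[symmetric] using K1 by (intro cSUP_least) auto
  qed
  moreover have "J (x + y) = J x + J y" "J (c *\<^sub>R x) = c *\<^sub>R J x" for x y c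
    by (rule bcontfun_eqI; simp add: apply_J g_def pairing_add pairing_scaleR)+
  ultimately have "is_completion (mixed_norm m k) J (closure (J ` c00))"
    by (simp add: is_completion_def)
  then show ?thesis by blast
qed

end

theory Submission
  imports Defs
begin

text \<open>The distorting norms are \<open>p j x = m j * sup {g x}\<close>, the supremum over the norming
  functionals \<open>g\<close> of weight \<open>m j\<close>. By James' argument every block subspace contains averages
  of arbitrarily high Schreier order of blocks in the unit ball, with norm at least \<open>1/2\<close>. On an
  average of order above \<open>k j\<close> only a small mass is split by the pieces of an \<open>\<M> j\<close>-admissible
  functional, so \<open>p j\<close> is bounded by 3 there. On the other hand, average in turn a rapidly
  increasing sequence \<open>x l\<close> of such vectors. Outside a loosely Schreier set of indices \<open>l\<close>, no node
  of the tree of a norming functional up to depth \<open>s\<close> starts near \<open>x l\<close>. The nodes that reach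
  \<open>x l\<close> then started before \<open>x l\<close>, hence are fewer than \<open>min supp (x l)\<close>, and by
  allowability the sum of all their values on \<open>x l\<close> is at most 2, before the factor \<open>(1/2)^s\<close>;
  the nodes of large weight are small on \<open>x l\<close>. So these averages have small norm, whereas \<open>p j\<close>
  is at least \<open>1/4\<close> on them for \<open>j\<close> large.\<close>

abbreviation supp :: "(nat \<Rightarrow>\<^sub>0 real) \<Rightarrow> nat set" where "supp \<equiv> Poly_Mapping.keys"

section \<open>Restriction and pairing\<close>

definition restr :: "nat set \<Rightarrow> (nat \<Rightarrow>\<^sub>0 real) \<Rightarrow> (nat \<Rightarrow>\<^sub>0 real)" where
  "restr E f = (\<Sum>i\<in>supp f \<inter> E. Poly_Mapping.single i (Poly_Mapping.lookup f i))"

lemma lookup_restr: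
  "Poly_Mapping.lookup (restr E f) i = (if i \<in> E then Poly_Mapping.lookup f i else 0)"
  by (simp add: restr_def lookup_sum lookup_single when_def sum.delta in_keys_iff)

lemma supp_restr [simp]: "supp (restr E f) = supp f \<inter> E"
  by (auto simp: in_keys_iff lookup_restr split: if_splits)

lemma restr_scaleR: "restr E (c *\<^sub>R f) = c *\<^sub>R restr E f"
  by (rule poly_mapping_eqI) (simp add: lookup_restr)

lemma restr_sum: "restr E (\<Sum>i\<in>I. f i) = (\<Sum>i\<in>I. restr E (f i))"
  by (rule poly_mapping_eqI) (simp add: lookup_restr lookup_sum)

lemma restr_eq_0_iff: "restr E f = 0 \<longleftrightarrow> supp f \<inter> E = {}"
  by (metis supp_restr keys_eq_empty)

lemma supp_scaleR: "supp (c *\<^sub>R f) = (if c = 0 then {} else supp f)"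
  by (auto simp: in_keys_iff)

lemma supp_sum_disjoint:
  assumes "finite \<F>" and "\<And>f g. f \<in> \<F> \<Longrightarrow> g \<in> \<F> \<Longrightarrow> f \<noteq> g \<Longrightarrow> supp f \<inter> supp g = {}"
  shows "supp (\<Sum>\<F>) = (\<Union>f\<in>\<F>. supp f)"
proof
  show "supp (\<Sum>\<F>) \<subseteq> (\<Union>f\<in>\<F>. supp f)"
    using keys_sum[of "\<lambda>f. f" \<F>] by simp
next
  show "(\<Union>f\<in>\<F>. supp f) \<subseteq> supp (\<Sum>\<F>)"
  proof
    fix i assume "i \<in> (\<Union>f\<in>\<F>. supp f)"
    then obtain f where f: "f \<in> \<F>" "i \<in> supp f" by blast
    have "Poly_Mapping.lookup (\<Sum>\<F>) i = (\<Sum>g\<in>\<F>. Poly_Mapping.lookup g i)"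
      by (simp add: lookup_sum)
    also have "\<dots> = (\<Sum>g\<in>\<F>. if g = f then Poly_Mapping.lookup f i else 0)"
    proof (rule sum.cong)
      fix g assume "g \<in> \<F>"
      then show "Poly_Mapping.lookup g i = (if g = f then Poly_Mapping.lookup f i else 0)"
        using assms(2)[OF _ f(1), of g] f(2) not_in_keys_iff_lookup_eq_zero by fastforce
    qed simp
    also have "\<dots> = Poly_Mapping.lookup f i" using f assms(1) by simp
    finally show "i \<in> supp (\<Sum>\<F>)" using f(2) by (simp add: in_keys_iff)
  qed
qed

lemma pairing_sum_left: "pairing (\<Sum>i\<in>I. f i) x = (\<Sum>i\<in>I. pairing (f i) x)"
  by (simp add: pairing_eq[OF finite_keys order_refl] lookup_sum sum_distrib_right sum.swap[of _ "supp x"])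

lemma pairing_scaleR_left: "pairing (c *\<^sub>R f) x = c * pairing f x"
  by (simp add: pairing_eq[OF finite_keys order_refl] sum_distrib_left mult.assoc)

lemma pairing_sum_right: "pairing f (\<Sum>i\<in>I. x i) = (\<Sum>i\<in>I. pairing f (x i))"
  by (simp add: pairing_def lookup_sum sum_distrib_left sum.swap[of _ "supp f"])

lemma pairing_restr: "supp x \<subseteq> E \<Longrightarrow> pairing (restr E f) x = pairing f x"
  by (auto simp: pairing_eq[OF finite_keys order_refl] lookup_restr intro!: sum.cong)

lemma pairing_disjoint: "supp f \<inter> supp x = {} \<Longrightarrow> pairing f x = 0"
  unfolding pairing_def by (rule sum.neutral) (auto simp: in_keys_iff)

lemma subspace_c00: "subspace c00"
proof (rule subspaceI)
  fix x y assume "x \<in> c00" "y \<in> c00"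
  then show "x + y \<in> c00" using keys_add[of x y] unfolding c00_def by blast
qed (auto simp: c00_def supp_scaleR)

section \<open>Schreier families\<close>

lemma schreier_finite: "A \<in> schreier n \<Longrightarrow> finite A"
  by (induction n arbitrary: A) auto

lemma schreier_pos: "A \<in> schreier n \<Longrightarrow> A \<subseteq> {1..}"
proof (induction n arbitrary: A)
  case (Suc n)
  then show ?case by fastforce
qed auto

lemma schreier_empty: "{} \<in> schreier n"
  by (cases n) auto

lemma schreier_SucI:
  assumes "As \<noteq> []" "\<And>A. A \<in> set As \<Longrightarrow> A \<in> schreier n"
    and "\<And>A a. A \<in> set As \<Longrightarrow> a \<in> A \<Longrightarrow> length As \<le> a" and "sorted_wrt before As"
    and "B = \<Union>(set As)"
  shows "B \<in> schreier (Suc n)"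
  using assms by auto

lemma schreier_Suc_mono: "schreier n \<subseteq> schreier (Suc n)"
proof
  fix A assume "A \<in> schreier n"
  then show "A \<in> schreier (Suc n)"
    using schreier_pos[of A n] by (auto intro!: exI[of _ "[A]"])
qed

lemma schreier_mono: "n \<le> n' \<Longrightarrow> schreier n \<subseteq> schreier n'"
  by (rule lift_Suc_mono_le[of schreier]) (rule schreier_Suc_mono)

lemma schreier_singleton: "1 \<le> n \<Longrightarrow> {n} \<in> schreier j"
  using schreier_mono[of 0 j] by auto

lemma schreier_SucE:
  assumes "A \<in> schreier (Suc n)"
  obtains As where "A = \<Union>(set As)" "As \<noteq> []" "set As \<subseteq> schreier n"
    "\<And>B a. B \<in> set As \<Longrightarrow> a \<in> B \<Longrightarrow> length As \<le> a" "sorted_wrt before As"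
proof (cases "A = {}")
  case True
  show ?thesis by (rule that[of "[{}]"]) (use True schreier_empty in auto)
next
  case False
  with assms that show ?thesis by auto
qed

lemma before_iff: "finite A \<Longrightarrow> finite B \<Longrightarrow> before A B \<longleftrightarrow> (\<forall>a\<in>A. \<forall>b\<in>B. a < b)"
  by (cases "A = {} \<or> B = {}") (auto simp: before_def)

text \<open>Hereditariness and spreading at once: \<open>B\<close> is a spread of the subset \<open>g ` B\<close> of \<open>A\<close>.\<close>

lemma schreier_spread:
  assumes "A \<in> schreier n" "g ` B \<subseteq> A" "\<And>b c. b \<in> B \<Longrightarrow> c \<in> B \<Longrightarrow> b < c \<Longrightarrow> g b < g c"
    "\<And>b. b \<in> B \<Longrightarrow> g b \<le> b"
  shows "B \<in> schreier n"
  using assms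
proof (induction n arbitrary: A B)
  case 0
  show ?case
  proof (cases "B = {}")
    case False
    then obtain b where b: "b \<in> B" by blast
    have "A = {g b}" "1 \<le> g b" using 0(1,2) b by auto
    have eq: "c = b" if "c \<in> B" for c
    proof -
      have "g c = g b" using \<open>A = {g b}\<close> 0(2) that by auto
      then show ?thesis using 0(3)[of c b] 0(3)[of b c] b that by (metis less_irrefl linorder_neqE)
    qed
    have "B = {b}" using b eq by blast
    moreover have "1 \<le> b" using \<open>1 \<le> g b\<close> 0(4)[OF b] by linarith
    ultimately show ?thesis by simp
  qed simp
next
  case (Suc n)
  have inj: "inj_on g B"
    by (rule inj_onI) (metis Suc.prems(3) less_irrefl linorder_neqE)
  have finB: "finite B"
    using finite_imageD[OF _ inj] finite_subset[OF Suc.prems(2) schreier_finite[OF Suc.prems(1)]] by blast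
  obtain As where As: "A = \<Union>(set As)" "As \<noteq> []" "set As \<subseteq> schreier n"
    "\<And>C a. C \<in> set As \<Longrightarrow> a \<in> C \<Longrightarrow> length As \<le> a" "sorted_wrt before As"
    using schreier_SucE[OF Suc.prems(1)] by metis
  define h where "h C = {b \<in> B. g b \<in> C}" for C
  have fin: "finite C" if "C \<in> set As" for C
    using that As(3) schreier_finite by blast
  show ?case
  proof (rule schreier_SucI[of "map h As"])
    show "C \<in> schreier n" if C: "C \<in> set (map h As)" for C
    proof -
      obtain D where D: "D \<in> set As" "C = h D" using C by auto
      have "D \<in> schreier n" using D(1) As(3) by blast
      then show ?thesis
        unfolding D(2) by (rule Suc.IH) (use Suc.prems(3,4) in \<open>simp_all add: h_def image_subset_iff\<close>)
    qed
    show "length (map h As) \<le> a" if C: "C \<in> set (map h As)" "a \<in> C" for C a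
    proof -
      obtain D where D: "D \<in> set As" "a \<in> B" "g a \<in> D" using C by (auto simp: h_def)
      show ?thesis using As(4)[OF D(1,3)] Suc.prems(4)[OF D(2)] by simp
    qed
    have "sorted_wrt (\<lambda>C D. before (h C) (h D)) As"
    proof (rule sorted_wrt_mono_rel[OF _ As(5)])
      fix C D assume CD: "C \<in> set As" "D \<in> set As" "before C D"
      then have lt: "\<forall>a\<in>C. \<forall>b\<in>D. a < b" using fin by (simp add: before_iff)
      have "b < c" if "b \<in> h C" "c \<in> h D" for b c
      proof -
        have "g b < g c" "b \<in> B" "c \<in> B" using lt that by (auto simp: h_def)
        then show ?thesis using Suc.prems(3)[of c b] by (metis less_asym less_irrefl linorder_neqE)
      qed
      then show "before (h C) (h D)"
        using finB by (subst before_iff) (auto simp: h_def)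
    qed
    then show "sorted_wrt before (map h As)" by (simp add: sorted_wrt_map)
    show "B = \<Union>(set (map h As))" using Suc.prems(2) As(1) by (auto simp: h_def)
  qed (use As in auto)
qed

lemma schreier_subset: "A \<in> schreier n \<Longrightarrow> B \<subseteq> A \<Longrightarrow> B \<in> schreier n"
  by (rule schreier_spread[of A n "\<lambda>b. b"]) auto

lemma schreier_1_iff: "A \<in> schreier (Suc 0) \<longleftrightarrow> finite A \<and> (\<forall>a\<in>A. card A \<le> a)"
proof
  assume "A \<in> schreier (Suc 0)"
  then obtain As where As: "A = \<Union>(set As)" "set As \<subseteq> schreier 0"
    "\<And>B a. B \<in> set As \<Longrightarrow> a \<in> B \<Longrightarrow> length As \<le> a"
    using schreier_SucE[of A 0] by metis
  have "card A \<le> (\<Sum>B\<in>set As. card B)"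
    unfolding As(1) by (rule card_Union_le_sum_card)
  also have "\<dots> \<le> (\<Sum>B\<in>set As. 1)" using As(2) by (intro sum_mono) auto
  also have "\<dots> \<le> length As" using card_length[of As] by simp
  finally show "finite A \<and> (\<forall>a\<in>A. card A \<le> a)"
    using As(1,3) schreier_finite[OF \<open>A \<in> schreier (Suc 0)\<close>] by force
next
  assume A: "finite A \<and> (\<forall>a\<in>A. card A \<le> a)"
  show "A \<in> schreier (Suc 0)"
  proof (cases "A = {}")
    case False
    have pos: "1 \<le> a" if "a \<in> A" for a
    proof -
      have "0 < card A" using A False by (simp add: card_gt_0_iff)
      also have "card A \<le> a" using A that by blast
      finally show ?thesis by simp
    qed
    show ?thesis
    proof (rule schreier_SucI[of "map (\<lambda>a. {a}) (sorted_list_of_set A)"])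
      have "sorted_wrt (<) (sorted_list_of_set A)" by simp
      then show "sorted_wrt before (map (\<lambda>a. {a}) (sorted_list_of_set A))"
        by (simp add: sorted_wrt_map before_def)
    qed (use A False pos in auto)
  qed simp
qed

lemma schreier_compose:
  assumes "p ` F \<in> schreier a" "finite F"
    and "\<And>l l'. l \<in> F \<Longrightarrow> l' \<in> F \<Longrightarrow> p l < p l' \<Longrightarrow> (\<forall>x\<in>B l. \<forall>y\<in>B l'. x < y)"
    and "inj_on p F"
    and "\<And>l. l \<in> F \<Longrightarrow> B l \<in> schreier b" "\<And>l x. l \<in> F \<Longrightarrow> x \<in> B l \<Longrightarrow> p l \<le> x"
  shows "(\<Union>l\<in>F. B l) \<in> schreier (a + b)"
  using assms
proof (induction a arbitrary: F)
  case 0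
  show ?case
  proof (cases "F = {}")
    case False
    then obtain l where l: "l \<in> F" by blast
    obtain n where "p ` F = {n}" using 0(1) l by auto
    then have "p x = n" if "x \<in> F" for x using that by blast
    then have "F = {l}" using 0(4) l unfolding inj_on_def by blast
    then show ?thesis using 0(5) by simp
  qed (simp add: schreier_empty)
next
  case (Suc a)
  obtain As where As: "p ` F = \<Union>(set As)" "As \<noteq> []" "set As \<subseteq> schreier a"
    "\<And>C a. C \<in> set As \<Longrightarrow> a \<in> C \<Longrightarrow> length As \<le> a" "sorted_wrt before As"
    using schreier_SucE[OF Suc.prems(1)] by metis
  define h where "h C = (\<Union>l\<in>{l\<in>F. p l \<in> C}. B l)" for C
  have fin: "finite C" if "C \<in> set As" for C
    using that As(3) schreier_finite by blast
  have fin2: "finite (h C)" for C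
    using Suc.prems(2,5) schreier_finite by (auto simp: h_def)
  have "(\<Union>l\<in>F. B l) \<in> schreier (Suc (a + b))"
  proof (rule schreier_SucI[of "map h As"])
    show "C \<in> schreier (a + b)" if C: "C \<in> set (map h As)" for C
    proof -
      obtain D where D: "D \<in> set As" "C = h D" using C by auto
      have "p ` {l\<in>F. p l \<in> D} = D" using As(1) D(1) by auto
      moreover have "inj_on p {l\<in>F. p l \<in> D}" using Suc.prems(4) by (rule inj_on_subset) auto
      moreover have "D \<in> schreier a" using D(1) As(3) by blast
      ultimately show ?thesis
        unfolding D(2) h_def using Suc.prems(2)
        by (intro Suc.IH) (simp_all, blast dest: Suc.prems(3), simp_all add: Suc.prems(5,6))
    qed
    show "length (map h As) \<le> x" if C: "C \<in> set (map h As)" "x \<in> C" for C x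
    proof -
      obtain D l where D: "D \<in> set As" "l \<in> F" "p l \<in> D" "x \<in> B l"
        using C by (auto simp: h_def)
      then show ?thesis using As(4)[OF D(1,3)] Suc.prems(6)[OF D(2,4)] by simp
    qed
    have "sorted_wrt (\<lambda>C D. before (h C) (h D)) As"
    proof (rule sorted_wrt_mono_rel[OF _ As(5)])
      fix C D assume CD: "C \<in> set As" "D \<in> set As" "before C D"
      then have lt: "\<forall>a\<in>C. \<forall>b\<in>D. a < b" using fin by (simp add: before_iff)
      have "x < y" if xy: "x \<in> h C" "y \<in> h D" for x y
      proof -
        obtain l l' where l: "l \<in> F" "p l \<in> C" "x \<in> B l" "l' \<in> F" "p l' \<in> D" "y \<in> B l'"
          using xy by (auto simp: h_def)
        then have "p l < p l'" using lt by blast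
        with l Suc.prems(3)[of l l'] show ?thesis by blast
      qed
      then show "before (h C) (h D)"
        using before_iff[OF fin2 fin2] by blast
    qed
    then show "sorted_wrt before (map h As)" by (simp add: sorted_wrt_map)
    show "(\<Union>l\<in>F. B l) = \<Union>(set (map h As))" using As(1) by (auto simp: h_def)
  qed (use As in auto)
  then show ?case by simp
qed

text \<open>The Schreier families without the order requirement. They absorb the supports of
  allowable families, which need not be successive. Pairs are admitted at level 0 so that a
  functional may occupy one further position besides its minimum.\<close>

primrec loose :: "nat \<Rightarrow> nat set set" where
  "loose 0 = {A. finite A \<and> card A \<le> 2 \<and> A \<subseteq> {1..}}"
| "loose (Suc n) = {\<Union>(set As) | As. set As \<subseteq> loose n \<and> (\<forall>A\<in>set As. \<forall>a\<in>A. length As \<le> a)}"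

lemma loose_SucI:
  assumes "\<And>A. A \<in> set As \<Longrightarrow> A \<in> loose n"
    and "\<And>A a. A \<in> set As \<Longrightarrow> a \<in> A \<Longrightarrow> length As \<le> a"
    and "B = \<Union>(set As)"
  shows "B \<in> loose (Suc n)"
proof -
  have "set As \<subseteq> loose n \<and> (\<forall>A\<in>set As. \<forall>a\<in>A. length As \<le> a)" using assms by blast
  then show ?thesis unfolding assms(3) by (simp del: Union_iff) blast
qed

lemma loose_pos: "A \<in> loose n \<Longrightarrow> A \<subseteq> {1..}"
proof (induction n arbitrary: A)
  case (Suc n)
  then obtain As where "A = \<Union>(set As)" "set As \<subseteq> loose n" by auto
  then show ?case using Suc.IH by blast
qed auto

lemma loose_mono: "n \<le> n' \<Longrightarrow> loose n \<subseteq> loose n'"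
proof (rule lift_Suc_mono_le[of loose])
  show "loose n \<subseteq> loose (Suc n)" for n
  proof
    fix A assume "A \<in> loose n"
    then show "A \<in> loose (Suc n)"
      using loose_pos[of A n] by (intro loose_SucI[of "[A]"]) auto
  qed
qed

lemma schreier_subset_loose: "schreier n \<subseteq> loose n"
proof (induction n)
  case (Suc n)
  show ?case
  proof
    fix A assume "A \<in> schreier (Suc n)"
    then obtain As where As: "A = \<Union>(set As)" "set As \<subseteq> schreier n"
      "\<And>C a. C \<in> set As \<Longrightarrow> a \<in> C \<Longrightarrow> length As \<le> a"
      using schreier_SucE[of A n] by metis
    then show "A \<in> loose (Suc n)"
      using Suc by (intro loose_SucI[of As]) auto
  qed
qed auto

lemma loose_Union:
  assumes "finite I" "\<And>i. i \<in> I \<Longrightarrow> B i \<in> loose n" "\<And>i a. i \<in> I \<Longrightarrow> a \<in> B i \<Longrightarrow> card I \<le> a"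
  shows "(\<Union>i\<in>I. B i) \<in> loose (Suc n)"
proof -
  obtain xs where xs: "set xs = I" "length xs = card I"
    using finite_distinct_list[OF assms(1)] distinct_card by metis
  then show ?thesis using assms(2,3)
    by (intro loose_SucI[of "map B xs"]) auto
qed

lemma loose_compose:
  assumes "p ` F \<in> schreier a" "inj_on p F"
    and "\<And>l. l \<in> F \<Longrightarrow> B l \<in> loose b" "\<And>l x. l \<in> F \<Longrightarrow> x \<in> B l \<Longrightarrow> p l \<le> x"
  shows "(\<Union>l\<in>F. B l) \<in> loose (a + b)"
  using assms
proof (induction a arbitrary: F)
  case 0
  show ?case
  proof (cases "F = {}")
    case True
    then show ?thesis using loose_mono[of 0 b] by auto
  next
    case False
    then obtain l where l: "l \<in> F" by blast
    obtain n where "p ` F = {n}" using 0(1) l by auto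
    then have "p x = n" if "x \<in> F" for x using that by blast
    then have "F = {l}" using 0(2) l unfolding inj_on_def by blast
    then show ?thesis using 0(3) by simp
  qed
next
  case (Suc a)
  obtain As where As: "p ` F = \<Union>(set As)" "As \<noteq> []" "set As \<subseteq> schreier a"
    "\<And>C a. C \<in> set As \<Longrightarrow> a \<in> C \<Longrightarrow> length As \<le> a" "sorted_wrt before As"
    using schreier_SucE[OF Suc.prems(1)] by metis
  define h where "h C = (\<Union>l\<in>{l\<in>F. p l \<in> C}. B l)" for C
  have IH: "h D \<in> loose (a + b)" if D: "D \<in> set As" for D
  proof -
    have "p ` {l\<in>F. p l \<in> D} = D" using As(1) D by auto
    moreover have "inj_on p {l\<in>F. p l \<in> D}" using Suc.prems(2) by (rule inj_on_subset) auto
    moreover have "D \<in> schreier a" using D As(3) by blast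
    ultimately show ?thesis
      unfolding h_def by (intro Suc.IH) (simp_all add: Suc.prems(3,4))
  qed
  have len: "length As \<le> x" if C: "D \<in> set As" "x \<in> h D" for D x
  proof -
    obtain l where l: "l \<in> F" "p l \<in> D" "x \<in> B l"
      using C(2) by (auto simp: h_def)
    have "length As \<le> p l" using As(4)[OF C(1) l(2)] .
    also have "p l \<le> x" using Suc.prems(4)[OF l(1,3)] .
    finally show ?thesis .
  qed
  have U: "(\<Union>l\<in>F. B l) = \<Union>(set (map h As))" using As(1) by (auto simp: h_def)
  have "(\<Union>l\<in>F. B l) \<in> loose (Suc (a + b))"
  proof (rule loose_SucI[OF _ _ U])
    show "C \<in> loose (a + b)" if "C \<in> set (map h As)" for C
      using that IH by auto
    show "length (map h As) \<le> x" if "C \<in> set (map h As)" "x \<in> C" for C x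
      using that len by auto
  qed
  then show ?case by simp
qed

declare schreier.simps(2) [simp del] loose.simps(2) [simp del]

section \<open>Averages that are small on Schreier sets\<close>

definition zone :: "(nat \<Rightarrow> nat) \<Rightarrow> nat \<Rightarrow> nat set" where
  "zone P l = {P l<..P (Suc l)}"

lemma zone_less:
  assumes "strict_mono P" "x \<in> zone P l" "y \<in> zone P l'" "l < l'"
  shows "x < y"
proof -
  have "x \<le> P (Suc l)" using assms(2) by (simp add: zone_def)
  also have "\<dots> \<le> P l'" using strict_mono_less_eq[OF assms(1)] assms(4) by simp
  also have "\<dots> < y" using assms(3) by (simp add: zone_def)
  finally show ?thesis .
qed

lemma zone_inj:
  assumes "strict_mono P" "x \<in> zone P l" "x \<in> zone P l'"
  shows "l = l'"
  using zone_less[OF assms(1,2,3)] zone_less[OF assms(1,3,2)] by (metis less_irrefl linorder_neqE)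

definition hit_mass :: "(nat \<Rightarrow> nat) \<Rightarrow> nat set \<Rightarrow> (nat \<Rightarrow> real) \<Rightarrow> nat set \<Rightarrow> real" where
  "hit_mass P F a G = (\<Sum>l\<in>{l \<in> F. zone P l \<inter> G \<noteq> {}}. a l)"

definition convex_on_set :: "nat set \<Rightarrow> (nat \<Rightarrow> real) \<Rightarrow> bool" where
  "convex_on_set F a \<longleftrightarrow> finite F \<and> (\<forall>l. 0 \<le> a l) \<and> (\<forall>l. l \<notin> F \<longrightarrow> a l = 0) \<and> sum a F = 1"

definition selects :: "(nat \<Rightarrow> nat) \<Rightarrow> nat \<Rightarrow> nat set \<Rightarrow> bool" where
  "selects P n F \<longleftrightarrow> (\<forall>p. (\<forall>l\<in>F. p l \<in> zone P l) \<longrightarrow> p ` F \<in> schreier n)"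

definition average :: "(nat \<Rightarrow> nat) \<Rightarrow> nat \<Rightarrow> real \<Rightarrow> nat set \<Rightarrow> (nat \<Rightarrow> real) \<Rightarrow> bool" where
  "average P n \<epsilon> F a \<longleftrightarrow> convex_on_set F a \<and> selects P (Suc n) F \<and>
     (\<forall>G\<in>loose n. hit_mass P F a G \<le> \<epsilon>)"

lemma hit_mass_nonneg: "convex_on_set F a \<Longrightarrow> 0 \<le> hit_mass P F a G"
  unfolding hit_mass_def convex_on_set_def by (blast intro: sum_nonneg)

lemma hit_mass_le_1: 
  assumes "convex_on_set F a"
  shows "hit_mass P F a G \<le> 1"
proof -
  have "hit_mass P F a G \<le> sum a F"
    unfolding hit_mass_def using assms
    by (intro sum_mono2) (auto simp: convex_on_set_def)
  then show ?thesis using assms by (simp add: convex_on_set_def)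
qed

lemma hit_mass_0: "(\<And>l. l \<in> F \<Longrightarrow> zone P l \<inter> G = {}) \<Longrightarrow> hit_mass P F a G = 0"
  unfolding hit_mass_def by (rule sum.neutral) blast

lemma hit_mass_Union:
  assumes "convex_on_set F a" "finite I"
  shows "hit_mass P F a (\<Union>i\<in>I. G i) \<le> (\<Sum>i\<in>I. hit_mass P F a (G i))"
proof -
  have fin: "finite F" and pos: "\<And>l. 0 \<le> a l" using assms(1) by (auto simp: convex_on_set_def)
  have "hit_mass P F a (\<Union>i\<in>I. G i) = (\<Sum>l\<in>F. if zone P l \<inter> (\<Union>i\<in>I. G i) \<noteq> {} then a l else 0)"
    unfolding hit_mass_def using fin by (simp only: sum.inter_filter)
  also have "\<dots> \<le> (\<Sum>l\<in>F. \<Sum>i\<in>I. if zone P l \<inter> G i \<noteq> {} then a l else 0)"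
  proof (rule sum_mono)
    fix l assume "l \<in> F"
    show "(if zone P l \<inter> (\<Union>i\<in>I. G i) \<noteq> {} then a l else 0) \<le> (\<Sum>i\<in>I. if zone P l \<inter> G i \<noteq> {} then a l else 0)"
    proof (cases "zone P l \<inter> (\<Union>i\<in>I. G i) \<noteq> {}")
      case True
      then obtain i where i: "i \<in> I" "zone P l \<inter> G i \<noteq> {}" by blast
      have "a l = (if zone P l \<inter> G i \<noteq> {} then a l else 0)" using i by simp
      also have "\<dots> \<le> (\<Sum>i\<in>I. if zone P l \<inter> G i \<noteq> {} then a l else 0)"
        by (rule member_le_sum) (use i pos assms(2) in auto)
      finally show ?thesis using True by simp
    next
      case False
      then show ?thesis using pos by (simp add: sum_nonneg)
    qed
  qed
  also have "\<dots> = (\<Sum>i\<in>I. hit_mass P F a (G i))"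
    unfolding hit_mass_def using fin
    by (subst sum.swap) (simp only: sum.inter_filter)
  finally show ?thesis .
qed

context
  fixes P :: "nat \<Rightarrow> nat" and F :: "nat \<Rightarrow> nat set" and a :: "nat \<Rightarrow> nat \<Rightarrow> real" and K n :: nat
  assumes P: "strict_mono P" and K: "0 < K"
    and conv: "\<And>i. convex_on_set (F i) (a i)"
    and succ: "\<And>i j l l'. i < j \<Longrightarrow> l \<in> F i \<Longrightarrow> l' \<in> F j \<Longrightarrow> l < l'"
begin

lemma blocks_disjoint: "l \<in> F i \<Longrightarrow> l \<in> F j \<Longrightarrow> i = j"
  using succ[of i j l l] succ[of j i l l] by (metis less_irrefl linorder_neqE)

lemma blocks_sum:
  assumes "i < K"
  shows "(\<Sum>l\<in>{l\<in>\<Union>i<K. F i. Q l}. a i l) = (\<Sum>l\<in>{l\<in>F i. Q l}. a i l)"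
  using conv assms by (intro sum.mono_neutral_right) (auto simp: convex_on_set_def)

lemma blocks_hit_mass:
  "hit_mass P (\<Union>i<K. F i) (\<lambda>l. (\<Sum>i<K. a i l) / K) G = (\<Sum>i<K. hit_mass P (F i) (a i) G) / K"
proof -
  let ?S = "{l \<in> \<Union>i<K. F i. zone P l \<inter> G \<noteq> {}}"
  have "hit_mass P (\<Union>i<K. F i) (\<lambda>l. (\<Sum>i<K. a i l) / K) G = (\<Sum>i<K. \<Sum>l\<in>?S. a i l) / K"
    unfolding hit_mass_def sum_divide_distrib[symmetric] by (subst sum.swap) (rule refl)
  also have "(\<Sum>i<K. \<Sum>l\<in>?S. a i l) = (\<Sum>i<K. hit_mass P (F i) (a i) G)"
    unfolding hit_mass_def by (intro sum.cong refl blocks_sum) simp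
  finally show ?thesis .
qed

lemma blocks_convex: "convex_on_set (\<Union>i<K. F i) (\<lambda>l. (\<Sum>i<K. a i l) / K)"
proof -
  have "(\<Sum>l\<in>(\<Union>i<K. F i). (\<Sum>i<K. a i l) / K) = (\<Sum>i<K. \<Sum>l\<in>(\<Union>i<K. F i). a i l) / K"
    unfolding sum_divide_distrib[symmetric] by (subst sum.swap) (rule refl)
  also have "(\<Sum>i<K. \<Sum>l\<in>(\<Union>i<K. F i). a i l) = (\<Sum>i<K. sum (a i) (F i))"
  proof (rule sum.cong)
    fix i assume "i \<in> {..<K}"
    then show "sum (a i) (\<Union>i<K. F i) = sum (a i) (F i)"
      using blocks_sum[of i "\<lambda>_. True"] by (simp only: simp_thms Collect_mem_eq lessThan_iff)
  qed simp
  also have "\<dots> / K = 1" using conv K by (simp add: convex_on_set_def)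
  finally show ?thesis
    using conv by (auto simp: convex_on_set_def intro!: sum_nonneg divide_nonneg_nonneg)
qed

lemma blocks_selects:
  assumes "\<And>i l. l \<in> F i \<Longrightarrow> K \<le> l" "\<And>i. selects P n (F i)"
  shows "selects P (Suc n) (\<Union>i<K. F i)"
  unfolding selects_def
proof (intro allI impI)
  fix p assume p: "\<forall>l\<in>\<Union>i<K. F i. p l \<in> zone P l"
  have fin: "finite (p ` F i)" for i using conv by (simp add: convex_on_set_def)
  show "p ` (\<Union>i<K. F i) \<in> schreier (Suc n)"
  proof (rule schreier_SucI[of "map (\<lambda>i. p ` F i) [0..<K]"])
    show "C \<in> schreier n" if C: "C \<in> set (map (\<lambda>i. p ` F i) [0..<K])" for C
    proof -
      obtain i where "i < K" "C = p ` F i" using C by auto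
      then show ?thesis using assms(2)[of i] p unfolding selects_def by blast
    qed
    show "length (map (\<lambda>i. p ` F i) [0..<K]) \<le> x"
      if C: "C \<in> set (map (\<lambda>i. p ` F i) [0..<K])" "x \<in> C" for C x
    proof -
      obtain i l where l: "i < K" "l \<in> F i" "x = p l" using C by auto
      have "K \<le> l" using assms(1) l by blast
      also have "l \<le> P l" using P by (simp add: strict_mono_imp_increasing)
      also have "P l < p l" using p l by (auto simp: zone_def)
      finally show ?thesis using l by simp
    qed
    have "before (p ` F i) (p ` F j)" if "i < j" "j < K" for i j
    proof -
      have "p l < p l'" if l: "l \<in> F i" "l' \<in> F j" for l l'
      proof (rule zone_less[OF P])
        show "p l \<in> zone P l" using p l \<open>i < j\<close> \<open>j < K\<close> less_trans by blast
        show "p l' \<in> zone P l'" using p l \<open>j < K\<close> by blast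
        show "l < l'" using succ l \<open>i < j\<close> by blast
      qed
      then show ?thesis using before_iff[OF fin fin] by blast
    qed
    then show "sorted_wrt before (map (\<lambda>i. p ` F i) [0..<K])"
      by (simp add: sorted_wrt_map sorted_wrt_iff_nth_less)
    show "p ` (\<Union>i<K. F i) = \<Union>(set (map (\<lambda>i. p ` F i) [0..<K]))"
      unfolding image_UN by (simp add: atLeast0LessThan)
  qed (use K in auto)
qed

lemma blocks_hit_card:
  assumes "finite G" "card G \<le> 2"
  shows "(\<Sum>i<K. hit_mass P (F i) (a i) G) \<le> 2"
proof -
  define I where "I = {i \<in> {..<K}. \<exists>l\<in>F i. zone P l \<inter> G \<noteq> {}}"
  have "\<forall>i\<in>I. \<exists>x. x \<in> G \<and> (\<exists>l\<in>F i. x \<in> zone P l)" by (auto simp: I_def)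
  then obtain g where g: "\<And>i. i \<in> I \<Longrightarrow> g i \<in> G \<and> (\<exists>l\<in>F i. g i \<in> zone P l)"
    by metis
  have "inj_on g I"
  proof (rule inj_onI)
    fix i j assume "i \<in> I" "j \<in> I" "g i = g j"
    then obtain l l' where "l \<in> F i" "l' \<in> F j" "g i \<in> zone P l" "g i \<in> zone P l'"
      using g by metis
    then show "i = j" using zone_inj[OF P] blocks_disjoint by metis
  qed
  then have cardI: "card I \<le> 2" using card_inj_on_le[of g I G] g assms by force
  have "(\<Sum>i<K. hit_mass P (F i) (a i) G) = (\<Sum>i\<in>I. hit_mass P (F i) (a i) G)"
    by (rule sum.mono_neutral_right) (auto simp: I_def intro!: hit_mass_0)
  also have "\<dots> \<le> (\<Sum>i\<in>I. 1)" by (intro sum_mono hit_mass_le_1 conv)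
  finally show ?thesis using cardI by simp
qed

text \<open>Once \<open>G\<close> has met a block, the number of its pieces is bounded by the end of that
  block, so the much smaller \<open>\<delta>\<close> of the later blocks compensates for it.\<close>

lemma blocks_hit_small:
  fixes \<epsilon> :: real
  assumes "G \<in> loose (Suc n)" "0 \<le> \<epsilon>"
    and small: "\<And>i j l G. i < j \<Longrightarrow> l \<in> F i \<Longrightarrow> G \<in> loose n \<Longrightarrow> P (Suc l) * hit_mass P (F j) (a j) G \<le> \<epsilon>"
  shows "(\<Sum>i<K. hit_mass P (F i) (a i) G) \<le> 1 + K * \<epsilon>"
proof (cases "\<exists>i. \<exists>l\<in>F i. zone P l \<inter> G \<noteq> {}")
  case False
  then have "(\<Sum>i<K. hit_mass P (F i) (a i) G) = 0"
    by (intro sum.neutral ballI hit_mass_0) blast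
  then show ?thesis using assms(2) by simp
next
  case True
  define i where "i = (LEAST i. \<exists>l\<in>F i. zone P l \<inter> G \<noteq> {})"
  obtain l x where l: "l \<in> F i" "x \<in> zone P l" "x \<in> G"
    using LeastI_ex[OF True] by (auto simp: i_def)
  have before_i: "hit_mass P (F j) (a j) G = 0" if "j < i" for j
    using not_less_Least[of j] that by (intro hit_mass_0) (auto simp: i_def)
  obtain As where As: "G = \<Union>(set As)" "set As \<subseteq> loose n" "\<forall>A\<in>set As. \<forall>a\<in>A. length As \<le> a"
    using assms(1) unfolding loose.simps(2) by auto
  have "length As \<le> x" using l As by blast
  also have "x \<le> P (Suc l)" using l by (simp add: zone_def)
  finally have len: "card (set As) \<le> P (Suc l)" using card_length[of As] by linarith
  have after_i: "hit_mass P (F j) (a j) G \<le> \<epsilon>" if "i < j" for j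
  proof -
    define M where "M = Max (insert 0 (hit_mass P (F j) (a j) ` set As))"
    have M0: "0 \<le> M" and M: "\<And>A. A \<in> set As \<Longrightarrow> hit_mass P (F j) (a j) A \<le> M"
      by (auto simp: M_def)
    have "M \<in> insert 0 (hit_mass P (F j) (a j) ` set As)" unfolding M_def by (rule Max_in) auto
    then have Me: "P (Suc l) * M \<le> \<epsilon>"
      using small[OF that l(1)] As(2) assms(2) by auto
    have "hit_mass P (F j) (a j) G \<le> (\<Sum>A\<in>set As. hit_mass P (F j) (a j) A)"
      using hit_mass_Union[OF conv, of "set As" P j "\<lambda>A. A"] As(1) by simp
    also have "\<dots> \<le> (\<Sum>A\<in>set As. M)" by (rule sum_mono) (rule M)
    also have "\<dots> = card (set As) * M" by simp
    also have "\<dots> \<le> P (Suc l) * M" using len M0 by (intro mult_right_mono) auto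
    finally show ?thesis using Me by linarith
  qed
  have bound: "hit_mass P (F j) (a j) G \<le> (if j = i then 1 else 0) + \<epsilon>" for j
  proof -
    consider "j < i" | "j = i" | "i < j" by linarith
    then show ?thesis
    proof cases
      case 1
      then show ?thesis using before_i[OF 1] assms(2) by simp
    next
      case 2
      then show ?thesis using hit_mass_le_1[OF conv, of P j G] assms(2) by simp
    next
      case 3
      then show ?thesis using after_i[OF 3] by simp
    qed
  qed
  have "(\<Sum>j<K. hit_mass P (F j) (a j) G) \<le> (\<Sum>j<K. (if j = i then 1 else 0) + \<epsilon>)"
    by (rule sum_mono) (rule bound)
  also have "\<dots> = (\<Sum>j<K. if j = i then 1 else 0::real) + K * \<epsilon>" by (simp add: sum.distrib)
  also have "(\<Sum>j<K. if j = i then 1 else 0::real) \<le> 1" by (simp add: sum.delta)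
  finally show ?thesis by simp
qed

end

lemma average_exists_aux:
  assumes P: "strict_mono P"
  shows "0 < \<epsilon> \<Longrightarrow> \<exists>F a. F \<subseteq> {L..} \<and> convex_on_set F a \<and> selects P n F \<and>
    (\<forall>n' G. n = Suc n' \<longrightarrow> G \<in> loose n' \<longrightarrow> hit_mass P F a G \<le> \<epsilon>)"
proof (induction n arbitrary: \<epsilon> L)
  case 0
  have "convex_on_set {L} (\<lambda>l. if l = L then 1 else 0)" by (simp add: convex_on_set_def)
  moreover have "selects P 0 {L}" by (auto simp: selects_def zone_def)
  ultimately show ?case by (intro exI[of _ "{L}"] exI[of _ "\<lambda>l. if l = L then 1 else 0"]) simp
next
  case (Suc n)
  define K where "K = nat \<lceil>4 / \<epsilon>\<rceil> + 1"
  have K: "0 < K" "4 / \<epsilon> \<le> K" unfolding K_def by (simp, linarith)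
  define good where "good s \<longleftrightarrow> fst s \<subseteq> {max L K..} \<and> convex_on_set (fst s) (snd s) \<and> selects P n (fst s)"
    for s :: "nat set \<times> (nat \<Rightarrow> real)"
  define rel where "rel s s' \<longleftrightarrow> (\<forall>l\<in>fst s. \<forall>l'\<in>fst s'. l < l') \<and>
      (\<forall>n' G. n = Suc n' \<longrightarrow> G \<in> loose n' \<longrightarrow>
        P (Suc (Max (fst s))) * hit_mass P (fst s') (snd s') G \<le> \<epsilon> / 2)"
    for s s' :: "nat set \<times> (nat \<Rightarrow> real)"
  have "\<exists>f. \<forall>i. good (f i) \<and> rel (f i) (f (Suc i))"
  proof (rule dependent_nat_choice)
    show "\<exists>s. good s" using Suc.IH[OF zero_less_one, of "max L K"] by (auto simp: good_def)
    fix s i assume s: "good s"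
    define c where "c = real (P (Suc (Max (fst s))))"
    define d where "d = \<epsilon> / 2 / (c + 1)"
    have c: "0 < c + 1" by (simp add: c_def add_nonneg_pos)
    then have "0 < d" using Suc.prems by (simp add: d_def)
    from Suc.IH[OF this, of "max (max L K) (Suc (Max (fst s)))"] obtain F' a' where
      F': "F' \<subseteq> {max (max L K) (Suc (Max (fst s)))..}" "convex_on_set F' a'" "selects P n F'"
        "\<forall>n' G. n = Suc n' \<longrightarrow> G \<in> loose n' \<longrightarrow> hit_mass P F' a' G \<le> d"
      by metis
    have "l < l'" if "l \<in> fst s" "l' \<in> F'" for l l'
    proof -
      have "l \<le> Max (fst s)" using that s by (auto simp: good_def convex_on_set_def)
      then show ?thesis using that F'(1) by fastforce
    qed
    moreover have "P (Suc (Max (fst s))) * hit_mass P F' a' G \<le> \<epsilon> / 2"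
      if "n = Suc n'" "G \<in> loose n'" for n' G
    proof -
      have "P (Suc (Max (fst s))) * hit_mass P F' a' G \<le> P (Suc (Max (fst s))) * d"
        using F'(4) that by (intro mult_left_mono) auto
      also have "\<dots> \<le> (c + 1) * d" using \<open>0 < d\<close> by (simp add: c_def)
      also have "\<dots> = \<epsilon> / 2" using c unfolding d_def by (subst nonzero_mult_div_cancel_left[symmetric, of "c + 1" "\<epsilon> / 2"]) auto
      finally show ?thesis .
    qed
    moreover have "good (F', a')" using F' by (auto simp: good_def)
    ultimately show "\<exists>s'. good s' \<and> rel s s'" by (intro exI[of _ "(F', a')"]) (auto simp: rel_def)
  qed
  then obtain f where f: "\<And>i. good (f i)" "\<And>i. rel (f i) (f (Suc i))" by metis
  define F where "F i = fst (f i)" for i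
  define a where "a i = snd (f i)" for i
  have conv: "convex_on_set (F i) (a i)" and sub: "F i \<subseteq> {max L K..}" and sel: "selects P n (F i)" for i
    using f(1)[of i] by (auto simp: good_def F_def a_def)
  have ne: "F i \<noteq> {}" and fin: "finite (F i)" for i
    using conv[of i] by (auto simp: convex_on_set_def)
  have succ: "l < l'" if "i < j" "l \<in> F i" "l' \<in> F j" for i j l l'
    using that
  proof (induction j arbitrary: l')
    case (Suc j)
    show ?case
    proof (cases "i = j")
      case True
      then show ?thesis using f(2)[of j] Suc.prems by (auto simp: rel_def F_def)
    next
      case False
      obtain l2 where l2: "l2 \<in> F j" using ne by blast
      have "l < l2" using Suc.IH[of l2] Suc.prems False l2 by simp
      also have "l2 < l'" using f(2)[of j] Suc.prems l2 by (auto simp: rel_def F_def)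
      finally show ?thesis .
    qed
  qed simp
  have small: "P (Suc l) * hit_mass P (F j) (a j) G \<le> \<epsilon> / 2"
    if "n = Suc n'" "i < j" "l \<in> F i" "G \<in> loose n'" for n' i j l G
  proof -
    obtain j' where j: "j = Suc j'" using \<open>i < j\<close> by (cases j) auto
    have "l \<le> Max (F j')"
    proof (cases "i = j'")
      case True
      then show ?thesis using that(3) Max_ge[OF fin] by simp
    next
      case False
      then have "i < j'" using that(2) j by simp
      then have "l < Max (F j')" using that(3) Max_in[OF fin ne] by (rule succ)
      then show ?thesis by simp
    qed
    then have "P (Suc l) \<le> P (Suc (Max (F j')))" using strict_mono_less_eq[OF P] by simp
    then have "P (Suc l) * hit_mass P (F j) (a j) G \<le> P (Suc (Max (F j'))) * hit_mass P (F j) (a j) G"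
      using hit_mass_nonneg[OF conv] by (intro mult_right_mono) auto
    also have "\<dots> \<le> \<epsilon> / 2"
      using f(2)[of j'] that j by (auto simp: rel_def F_def a_def)
    finally show ?thesis .
  qed
  define FF where "FF = (\<Union>i<K. F i)"
  define aa where "aa l = (\<Sum>i<K. a i l) / K" for l
  have "(\<Sum>i<K. hit_mass P (F i) (a i) G) \<le> 2 + K * (\<epsilon> / 2)" if G: "G \<in> loose n" for G
  proof (cases n)
    case 0
    have "(\<Sum>i<K. hit_mass P (F i) (a i) G) \<le> 2"
      by (rule blocks_hit_card[OF P K(1) conv succ]) (use 0 G in auto)
    moreover have "0 \<le> K * (\<epsilon> / 2)" using Suc.prems by simp
    ultimately show ?thesis by linarith
  next
    case (Suc n')
    have "(\<Sum>i<K. hit_mass P (F i) (a i) G) \<le> 1 + K * (\<epsilon> / 2)"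
      by (rule blocks_hit_small[OF P K(1) conv succ, where G = G and n = n'])
        (use Suc G Suc.prems small[OF Suc] in auto)
    then show ?thesis by simp
  qed
  note total = this
  have "hit_mass P FF aa G \<le> \<epsilon>" if "G \<in> loose n" for G
  proof -
    have "hit_mass P FF aa G = (\<Sum>i<K. hit_mass P (F i) (a i) G) / K"
      unfolding FF_def aa_def by (rule blocks_hit_mass[OF P K(1) conv succ])
    also have "\<dots> \<le> (2 + K * (\<epsilon> / 2)) / K"
      using total[OF that] by (intro divide_right_mono) auto
    also have "\<dots> = 2 / K + \<epsilon> / 2" using K(1) by (simp add: field_simps)
    also have "2 / K \<le> \<epsilon> / 2" using K Suc.prems by (simp add: field_simps)
    finally show ?thesis by simp
  qed
  moreover have "convex_on_set FF aa"
    unfolding FF_def aa_def by (rule blocks_convex[OF P K(1) conv succ])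
  moreover have lower: "L \<le> l" "K \<le> l" if "l \<in> F i" for i l
    using subsetD[OF sub that] by simp_all
  have "selects P (Suc n) FF"
    unfolding FF_def by (rule blocks_selects[OF P K(1) conv succ lower(2) sel])
  moreover have "FF \<subseteq> {L..}" unfolding FF_def using lower(1) by blast
  ultimately show ?case by blast
qed

lemma average_exists:
  assumes "strict_mono P" "0 < \<epsilon>"
  obtains F a where "average P n \<epsilon> F a"
  using average_exists_aux[OF assms, of 0 "Suc n"] unfolding average_def by blast

section \<open>The norming set\<close>

lemma sorted_wrt_pairD:
  "sorted_wrt R xs \<Longrightarrow> x \<in> set xs \<Longrightarrow> y \<in> set xs \<Longrightarrow> x \<noteq> y \<Longrightarrow> R x y \<or> R y x"
  by (induction xs) auto

lemma sorted_wrt_distinctI: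
  "distinct xs \<Longrightarrow> (\<And>x y. x \<in> set xs \<Longrightarrow> y \<in> set xs \<Longrightarrow> x \<noteq> y \<Longrightarrow> R x y) \<Longrightarrow> sorted_wrt R xs"
  by (induction xs) auto

lemma sorted_wrt_disjntD:
  assumes "sorted_wrt disjnt (map h xs)" "x \<in> set xs" "y \<in> set xs" "x \<noteq> y"
  shows "h x \<inter> h y = {}"
  using sorted_wrt_pairD[OF assms(1)[unfolded sorted_wrt_map] assms(2-4)] by (auto simp: disjnt_def)

lemma distinct_if_disjnt:
  "sorted_wrt disjnt (map h xs) \<Longrightarrow> (\<And>x. x \<in> set xs \<Longrightarrow> h x \<noteq> {}) \<Longrightarrow> distinct xs"
  by (induction xs) (auto simp: disjnt_def)

lemma Min_inj_on_disjoint: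
  assumes "\<And>f. f \<in> \<F> \<Longrightarrow> supp f \<noteq> {}"
    and "\<And>f g. f \<in> \<F> \<Longrightarrow> g \<in> \<F> \<Longrightarrow> f \<noteq> g \<Longrightarrow> supp f \<inter> supp g = {}"
  shows "inj_on (\<lambda>f. Min (supp f)) \<F>"
proof (rule inj_onI, rule ccontr)
  fix f g assume fg: "f \<in> \<F>" "g \<in> \<F>" "Min (supp f) = Min (supp g)" "f \<noteq> g"
  have "Min (supp f) \<in> supp f" "Min (supp g) \<in> supp g"
    using assms(1)[OF fg(1)] assms(1)[OF fg(2)] Min_in finite_keys by blast+
  then show False using assms(2)[OF fg(1,2,4)] fg(3) by auto
qed

lemma sort_by_Min:
  assumes "finite \<F>" "inj_on (\<lambda>f. Min (supp f)) \<F>"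
  obtains fs where "set fs = \<F>" "distinct fs" "sorted_wrt (\<lambda>f g. Min (supp f) < Min (supp g)) fs"
proof -
  define M where "M f = Min (supp f)" for f
  define xs where "xs = sorted_list_of_set (M ` \<F>)"
  have xs: "set xs = M ` \<F>" "sorted_wrt (<) xs" using assms(1) by (simp_all add: xs_def)
  have inj: "inj_on M \<F>" using assms(2) by (simp add: M_def[abs_def])
  define fs where "fs = map (the_inv_into \<F> M) xs"
  have "set fs = \<F>"
    using the_inv_into_onto[OF inj] by (simp add: fs_def xs(1))
  moreover have "sorted_wrt (\<lambda>f g. M f < M g) fs"
    unfolding fs_def sorted_wrt_map
    by (rule sorted_wrt_mono_rel[OF _ xs(2)]) (auto simp: xs(1) the_inv_into_f_f[OF inj])
  moreover have "distinct fs"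
    unfolding fs_def distinct_map xs(1)
    using xs(2) inj_on_the_inv_into[OF inj] strict_sorted_iff by blast
  ultimately show ?thesis using that by (simp add: M_def)
qed

locale mixed_tsirelson =
  fixes m t k :: "nat \<Rightarrow> nat"
  assumes m1: "m 1 = 2"
    and m_growth: "\<And>j. 2 \<le> j \<Longrightarrow> m j > m (j - 1) ^ m (j - 1)"
    and k1: "k 1 = 1"
    and t_growth: "\<And>n. 2 \<le> n \<Longrightarrow> 0 < t n \<and> 2 ^ t n \<ge> (m n)\<^sup>2"
    and k_rec: "\<And>n. 2 \<le> n \<Longrightarrow> k n = t n * (k (n - 1) + 1) + 1"
begin

lemma m_Suc: "1 \<le> j \<Longrightarrow> j < m j \<and> m j < m (Suc j)"
proof (induction j rule: nat_induct_at_least)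
  case base
  then show ?case using m1 m_growth[of 2] by (simp add: numeral_2_eq_2)
next
  case (Suc j)
  have "m (Suc j) \<le> m (Suc j) ^ m (Suc j)"
    using Suc by (intro self_le_power) auto
  also have "\<dots> < m (Suc (Suc j))" using m_growth[of "Suc (Suc j)"] by simp
  finally show ?case using Suc by simp
qed

lemma m_mono: "1 \<le> i \<Longrightarrow> i \<le> j \<Longrightarrow> m i \<le> m j"
proof (rotate_tac, induction j rule: dec_induct)
  case (step j)
  then show ?case using m_Suc[of j] by simp
qed simp

lemma m_ge_2: "1 \<le> j \<Longrightarrow> 2 \<le> m j"
  using m_mono[of 1 j] m1 by simp

lemma m_gt: "1 \<le> j \<Longrightarrow> j < m j"
  using m_Suc by blast

lemma k_Suc: "1 \<le> j \<Longrightarrow> k j + 2 \<le> k (Suc j)"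
proof -
  assume j: "1 \<le> j"
  have "1 * (k j + 1) \<le> t (Suc j) * (k j + 1)"
    using t_growth[of "Suc j"] j by (intro mult_right_mono) auto
  then show ?thesis using k_rec[of "Suc j"] j by simp
qed

lemma k_mono: "1 \<le> i \<Longrightarrow> i \<le> j \<Longrightarrow> k i \<le> k j"
proof (rotate_tac, induction j rule: dec_induct)
  case (step j)
  then show ?case using k_Suc[of j] by simp
qed simp

lemma k_ge: "1 \<le> j \<Longrightarrow> j \<le> k j"
proof (induction j rule: nat_induct_at_least)
  case (Suc j)
  then show ?case using k_Suc[of j] by simp
qed (use k1 in simp)

abbreviation K :: "(nat \<Rightarrow>\<^sub>0 real) set" where "K \<equiv> norming_set m k"

abbreviation nrm :: "(nat \<Rightarrow>\<^sub>0 real) \<Rightarrow> real" where "nrm \<equiv> mixed_norm m k"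

definition disjoint_family :: "(nat \<Rightarrow>\<^sub>0 real) set \<Rightarrow> bool" where
  "disjoint_family \<F> \<longleftrightarrow> finite \<F> \<and> \<F> \<subseteq> K \<and>
     (\<forall>f\<in>\<F>. \<forall>g\<in>\<F>. f \<noteq> g \<longrightarrow> supp f \<inter> supp g = {})"

definition successive_family :: "nat \<Rightarrow> (nat \<Rightarrow>\<^sub>0 real) set \<Rightarrow> bool" where
  "successive_family n \<F> \<longleftrightarrow> finite \<F> \<and> \<F> \<noteq> {} \<and> \<F> \<subseteq> K \<and>
     (\<lambda>f. Min (supp f)) ` \<F> \<in> schreier n \<and>
     (\<forall>f\<in>\<F>. \<forall>g\<in>\<F>. f \<noteq> g \<longrightarrow> before (supp f) (supp g) \<or> before (supp g) (supp f))"

definition weighted :: "nat \<Rightarrow> (nat \<Rightarrow>\<^sub>0 real) set" where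
  "weighted j = {(1 / real (m j)) *\<^sub>R (\<Sum>\<F>) | \<F>. successive_family (k j) \<F>}"

lemma supp_scaled_sum_list:
  assumes "fs \<noteq> []" "\<And>f. f \<in> set fs \<Longrightarrow> supp f \<noteq> {} \<and> supp f \<subseteq> {1..}"
    and "sorted_wrt disjnt (map supp fs)" "c \<noteq> 0"
  shows "supp (c *\<^sub>R sum_list fs) \<noteq> {} \<and> supp (c *\<^sub>R sum_list fs) \<subseteq> {1..}"
proof -
  have "supp (\<Sum>(set fs)) = (\<Union>f\<in>set fs. supp f)"
    by (rule supp_sum_disjoint[OF finite_set sorted_wrt_disjntD[OF assms(3)]])
  then have U: "supp (c *\<^sub>R sum_list fs) = (\<Union>f\<in>set fs. supp f)"
    using distinct_if_disjnt[OF assms(3)] assms(2,4)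
    by (simp add: supp_scaleR sum_list_distinct_conv_sum_set[of fs "\<lambda>x. x", simplified])
  obtain f where "f \<in> set fs" using assms(1) by (cases fs) auto
  then show ?thesis unfolding U using assms(2) by blast
qed

lemma K_supp: "f \<in> K \<Longrightarrow> supp f \<noteq> {} \<and> supp f \<subseteq> {1..}"
proof (induction rule: norming_set.induct)
  case (allowable fs)
  then show ?case by (intro supp_scaled_sum_list) (auto simp: allowable_def)
next
  case (admissible j fs)
  have "m j \<noteq> 0" using m_ge_2[of j] admissible.hyps(1) by simp
  moreover have "fs \<noteq> []" "sorted_wrt disjnt (map supp fs)"
    using admissible.hyps(2) by (simp add: admissible_def, rule admissible_imp_disjnt)
  ultimately show ?case using admissible.IH by (intro supp_scaled_sum_list) auto
qed auto

lemma Min_supp_in: "f \<in> K \<Longrightarrow> Min (supp f) \<in> supp f"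
  using K_supp by (auto intro: Min_in)

lemma Min_supp_le: "a \<in> supp f \<Longrightarrow> Min (supp f) \<le> a"
  by simp

lemma disjoint_familyD:
  assumes "disjoint_family \<F>"
  shows "finite \<F>" "\<And>f. f \<in> \<F> \<Longrightarrow> f \<in> K"
    "\<And>f g. f \<in> \<F> \<Longrightarrow> g \<in> \<F> \<Longrightarrow> f \<noteq> g \<Longrightarrow> supp f \<inter> supp g = {}"
  using assms by (auto simp: disjoint_family_def)

lemma disjoint_family_Min_inj: "disjoint_family \<F> \<Longrightarrow> inj_on (\<lambda>f. Min (supp f)) \<F>"
  using K_supp by (intro Min_inj_on_disjoint) (auto dest: disjoint_familyD)

lemma successive_familyD:
  assumes "successive_family n \<F>"
  shows "finite \<F>" "\<F> \<noteq> {}" "\<And>f. f \<in> \<F> \<Longrightarrow> f \<in> K"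
    "(\<lambda>f. Min (supp f)) ` \<F> \<in> schreier n"
    "\<And>f g a b. f \<in> \<F> \<Longrightarrow> g \<in> \<F> \<Longrightarrow> Min (supp f) < Min (supp g) \<Longrightarrow> a \<in> supp f \<Longrightarrow> b \<in> supp g \<Longrightarrow> a < b"
proof -
  show "finite \<F>" "\<F> \<noteq> {}" and K: "\<And>f. f \<in> \<F> \<Longrightarrow> f \<in> K" "(\<lambda>f. Min (supp f)) ` \<F> \<in> schreier n"
    using assms by (auto simp: successive_family_def)
  fix f g a b assume *: "f \<in> \<F>" "g \<in> \<F>" "Min (supp f) < Min (supp g)" "a \<in> supp f" "b \<in> supp g"
  have in_supp: "Min (supp f) \<in> supp f" "Min (supp g) \<in> supp g" using K * Min_supp_in by auto
  have "before (supp f) (supp g) \<or> before (supp g) (supp f)"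
    using assms * by (auto simp: successive_family_def)
  then consider "\<forall>a\<in>supp f. \<forall>b\<in>supp g. a < b" | "\<forall>a\<in>supp g. \<forall>b\<in>supp f. a < b"
    by (auto simp: before_iff)
  then show "a < b" using in_supp * by cases (blast, meson less_asym)
qed

lemma successive_family_disjoint:
  assumes "successive_family n \<F>"
  shows "disjoint_family \<F>"
proof -
  have "supp f \<inter> supp g = {}" if "f \<in> \<F>" "g \<in> \<F>" "f \<noteq> g" for f g
  proof -
    have "before (supp f) (supp g) \<or> before (supp g) (supp f)"
      using assms that by (simp add: successive_family_def)
    then show ?thesis by (auto simp: before_iff)
  qed
  then show ?thesis using successive_familyD(1,3)[OF assms] by (auto simp: disjoint_family_def)
qed

lemma K_allowable:
  assumes "disjoint_family \<F>" "\<F> \<noteq> {}" "\<And>f a. f \<in> \<F> \<Longrightarrow> a \<in> supp f \<Longrightarrow> card \<F> \<le> a"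
  shows "(1/2) *\<^sub>R (\<Sum>\<F>) \<in> K"
proof -
  note F = disjoint_familyD[OF assms(1)]
  obtain fs where fs: "set fs = \<F>" "distinct fs" using finite_distinct_list[OF F(1)] by blast
  have "sum_list fs = \<Sum>\<F>" using fs by (simp add: sum_list_distinct_conv_sum_set[of fs "\<lambda>x. x", simplified])
  moreover have "(1/2) *\<^sub>R sum_list fs \<in> K"
  proof (rule norming_set.allowable)
    have "finite ((\<lambda>f. Min (supp f)) ` \<F>)" using F(1) by simp
    moreover have "card ((\<lambda>f. Min (supp f)) ` \<F>) \<le> Min (supp f)" if "f \<in> \<F>" for f
      using card_image_le[OF F(1), of "\<lambda>f. Min (supp f)"] assms(3)[OF that Min_supp_in[OF F(2)[OF that]]]
      by linarith
    ultimately have "(\<lambda>f. Min (supp f)) ` \<F> \<in> schreier (k 1)"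
      using k1 by (simp add: schreier_1_iff)
    moreover have "sorted_wrt disjnt (map supp fs)"
      using fs F(3) by (auto simp: sorted_wrt_map disjnt_def intro!: sorted_wrt_distinctI)
    ultimately show "allowable (schreier (k 1)) (map supp fs)"
      using fs assms(2) K_supp F(2) by (auto simp: allowable_def image_image)
  qed (use fs F in auto)
  ultimately show ?thesis by simp
qed

lemma K_admissible:
  assumes "2 \<le> j" "successive_family (k j) \<F>"
  shows "(1 / real (m j)) *\<^sub>R (\<Sum>\<F>) \<in> K"
proof -
  note F = successive_familyD[OF assms(2)]
  obtain fs where fs: "set fs = \<F>" "distinct fs" "sorted_wrt (\<lambda>f g. Min (supp f) < Min (supp g)) fs"
    using sort_by_Min[OF F(1) disjoint_family_Min_inj[OF successive_family_disjoint[OF assms(2)]]] by metis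
  have "sum_list fs = \<Sum>\<F>" using fs by (simp add: sum_list_distinct_conv_sum_set[of fs "\<lambda>x. x", simplified])
  moreover have "(1 / real (m j)) *\<^sub>R sum_list fs \<in> K"
  proof (rule norming_set.admissible[OF assms(1)])
    have "sorted_wrt before (map supp fs)"
      unfolding sorted_wrt_map
    proof (rule sorted_wrt_mono_rel[OF _ fs(3)])
      fix f g assume "f \<in> set fs" "g \<in> set fs" "Min (supp f) < Min (supp g)"
      then have "\<forall>a\<in>supp f. \<forall>b\<in>supp g. a < b" using F(5)[of f g] fs(1) by blast
      then show "before (supp f) (supp g)" by (simp add: before_iff)
    qed
    moreover have "\<forall>f\<in>\<F>. supp f \<noteq> {}" using F(3) K_supp by blast
    moreover have "fs \<noteq> []" using F(2) fs(1) by auto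
    ultimately show "admissible (schreier (k j)) (map supp fs)"
      using fs(1) F(4) by (simp add: admissible_def image_image)
    show "\<forall>f\<in>set fs. f \<in> K" using fs(1) F(3) by blast
  qed
  ultimately show ?thesis by simp
qed

lemma weighted_subset: "2 \<le> j \<Longrightarrow> weighted j \<subseteq> K"
  using K_admissible by (auto simp: weighted_def)

lemma K_induct [consumes 1, case_names pos neg allowable admissible]:
  assumes "f \<in> K"
    and pos: "\<And>n. 1 \<le> n \<Longrightarrow> Q (Poly_Mapping.single n 1)"
    and neg: "\<And>n. 1 \<le> n \<Longrightarrow> Q (- Poly_Mapping.single n 1)"
    and allow: "\<And>\<F>. disjoint_family \<F> \<Longrightarrow> \<F> \<noteq> {} \<Longrightarrow>
      (\<And>f a. f \<in> \<F> \<Longrightarrow> a \<in> supp f \<Longrightarrow> card \<F> \<le> a) \<Longrightarrow>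
      (\<And>f. f \<in> \<F> \<Longrightarrow> Q f) \<Longrightarrow> Q ((1/2) *\<^sub>R (\<Sum>\<F>))"
    and adm: "\<And>j \<F>. 2 \<le> j \<Longrightarrow> successive_family (k j) \<F> \<Longrightarrow>
      (\<And>f. f \<in> \<F> \<Longrightarrow> Q f) \<Longrightarrow> Q ((1 / real (m j)) *\<^sub>R (\<Sum>\<F>))"
  shows "Q f"
  using assms(1)
proof (induction rule: norming_set.induct)
  case (allowable fs)
  then have ne: "\<And>f. f \<in> set fs \<Longrightarrow> supp f \<noteq> {}" and sd: "sorted_wrt disjnt (map supp fs)" and fs: "fs \<noteq> []"
    and fK: "set fs \<subseteq> K"
    by (auto simp: allowable_def)
  have dist: "distinct fs" using distinct_if_disjnt[OF sd ne] .
  have fam: "disjoint_family (set fs)"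
    using fK sorted_wrt_disjntD[OF sd] by (simp add: disjoint_family_def)
  have "Q ((1/2) *\<^sub>R (\<Sum>(set fs)))"
  proof (rule allow[OF fam])
    fix f a assume f: "f \<in> set fs" "a \<in> supp f"
    have "card (set fs) = card ((\<lambda>f. Min (supp f)) ` set fs)"
      by (rule card_image[symmetric]) (rule disjoint_family_Min_inj[OF fam])
    also have "\<dots> \<le> Min (supp f)"
      using allowable.hyps f k1 by (auto simp: allowable_def schreier_1_iff image_image)
    also have "\<dots> \<le> a" using f by simp
    finally show "card (set fs) \<le> a" .
  qed (use fs allowable.IH in auto)
  then show ?case
    using dist by (simp add: sum_list_distinct_conv_sum_set[of fs "\<lambda>x. x", simplified])
next
  case (admissible j fs)
  have ne: "\<And>f. f \<in> set fs \<Longrightarrow> supp f \<noteq> {}" and fs: "fs \<noteq> []" and fK: "set fs \<subseteq> K"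
    using admissible by (auto simp: admissible_def)
  have sd: "sorted_wrt disjnt (map supp fs)" using admissible.hyps(2) by (rule admissible_imp_disjnt)
  have dist: "distinct fs" using distinct_if_disjnt[OF sd ne] .
  have sb: "sorted_wrt (\<lambda>f g. before (supp f) (supp g)) fs"
    using admissible.hyps(2) by (simp add: admissible_def sorted_wrt_map)
  have "successive_family (k j) (set fs)"
    using fK fs admissible.hyps(2) sorted_wrt_pairD[OF sb]
    by (simp add: successive_family_def admissible_def image_image)
  then have "Q ((1 / real (m j)) *\<^sub>R (\<Sum>(set fs)))"
    by (rule adm[OF admissible.hyps(1)]) (use admissible.IH in auto)
  then show ?case
    using dist by (simp add: sum_list_distinct_conv_sum_set[of fs "\<lambda>x. x", simplified])
qed (use pos neg in auto)

lemma restr_inj_on: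
  assumes "disjoint_family \<F>" "\<And>f. f \<in> \<F> \<Longrightarrow> supp f \<inter> E \<noteq> {}"
  shows "inj_on (restr E) \<F>"
proof (rule inj_onI, rule ccontr)
  fix f g assume fg: "f \<in> \<F>" "g \<in> \<F>" "restr E f = restr E g" "f \<noteq> g"
  have "supp f \<inter> E = supp g \<inter> E" using fg(3) supp_restr by metis
  then show False using disjoint_familyD(3)[OF assms(1) fg(1,2,4)] assms(2)[OF fg(1)] by blast
qed

lemma restr_Sum:
  assumes "disjoint_family \<F>"
  shows "restr E (\<Sum>\<F>) = \<Sum>(restr E ` {f \<in> \<F>. supp f \<inter> E \<noteq> {}})"
proof -
  have "restr E (\<Sum>\<F>) = (\<Sum>f\<in>\<F>. restr E f)" by (rule restr_sum)
  also have "\<dots> = (\<Sum>f\<in>{f \<in> \<F>. supp f \<inter> E \<noteq> {}}. restr E f)"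
    using disjoint_familyD(1)[OF assms]
    by (intro sum.mono_neutral_right) (auto simp: restr_eq_0_iff)
  also have "\<dots> = \<Sum>(restr E ` {f \<in> \<F>. supp f \<inter> E \<noteq> {}})"
    using assms by (subst sum.reindex[OF restr_inj_on]) (auto simp: disjoint_family_def)
  finally show ?thesis .
qed

lemma supp_Sum:
  "disjoint_family \<F> \<Longrightarrow> supp (\<Sum>\<F>) = (\<Union>f\<in>\<F>. supp f)"
  by (rule supp_sum_disjoint) (auto dest: disjoint_familyD)

lemma disjoint_family_restr:
  assumes "disjoint_family \<F>" "\<And>f. f \<in> \<F> \<Longrightarrow> supp f \<inter> E \<noteq> {} \<Longrightarrow> restr E f \<in> K"
  shows "disjoint_family (restr E ` {f \<in> \<F>. supp f \<inter> E \<noteq> {}})"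
  unfolding disjoint_family_def
proof (intro conjI ballI impI)
  show "finite (restr E ` {f \<in> \<F>. supp f \<inter> E \<noteq> {}})" using disjoint_familyD(1)[OF assms(1)] by simp
  show "restr E ` {f \<in> \<F>. supp f \<inter> E \<noteq> {}} \<subseteq> K" using assms(2) by blast
  fix f g assume "f \<in> restr E ` {f \<in> \<F>. supp f \<inter> E \<noteq> {}}" "g \<in> restr E ` {f \<in> \<F>. supp f \<inter> E \<noteq> {}}" "f \<noteq> g"
  then obtain f' g' where "f' \<in> \<F>" "g' \<in> \<F>" "f = restr E f'" "g = restr E g'" "f' \<noteq> g'" by blast
  then show "supp f \<inter> supp g = {}" using disjoint_familyD(3)[OF assms(1), of f' g'] by auto
qed

lemma successive_family_restr:
  assumes "successive_family n \<F>" "\<And>f. f \<in> \<F> \<Longrightarrow> supp f \<inter> E \<noteq> {} \<Longrightarrow> restr E f \<in> K"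
    and ne: "\<exists>f\<in>\<F>. supp f \<inter> E \<noteq> {}"
  shows "successive_family n (restr E ` {f \<in> \<F>. supp f \<inter> E \<noteq> {}})"
proof -
  note F = successive_familyD[OF assms(1)]
  define \<G> where "\<G> = {f \<in> \<F>. supp f \<inter> E \<noteq> {}}"
  define B where "B = (\<lambda>f. Min (supp f \<inter> E)) ` \<G>"
  have Min_in_E: "Min (supp f \<inter> E) \<in> supp f \<inter> E" if "f \<in> \<G>" for f
    using that by (intro Min_in) (auto simp: \<G>_def)
  have "\<forall>b\<in>B. \<exists>f. f \<in> \<G> \<and> b = Min (supp f \<inter> E)" by (auto simp: B_def)
  then obtain h where h: "\<And>b. b \<in> B \<Longrightarrow> h b \<in> \<G> \<and> b = Min (supp (h b) \<inter> E)" by metis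
  then have hb: "h b \<in> \<F>" "b \<in> supp (h b)" if "b \<in> B" for b
    using that Min_in_E[of "h b"] by (auto simp: \<G>_def)
  have "B \<in> schreier n"
  proof (rule schreier_spread[OF F(4), of "\<lambda>b. Min (supp (h b))"])
    show "(\<lambda>b. Min (supp (h b))) ` B \<subseteq> (\<lambda>f. Min (supp f)) ` \<F>" using hb by blast
    show "Min (supp (h b)) \<le> b" if "b \<in> B" for b using hb(2)[OF that] by simp
    fix b c assume bc: "b \<in> B" "c \<in> B" "b < c"
    have "h b \<noteq> h c" using bc h by (metis less_irrefl)
    then have "Min (supp (h b)) \<noteq> Min (supp (h c))"
      using disjoint_family_Min_inj[OF successive_family_disjoint[OF assms(1)]] hb bc
      by (auto simp: inj_on_def)
    moreover have "\<not> Min (supp (h c)) < Min (supp (h b))"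
      using F(5)[OF hb(1)[OF bc(2)] hb(1)[OF bc(1)] _ hb(2)[OF bc(2)] hb(2)[OF bc(1)]] bc(3) by auto
    ultimately show "Min (supp (h b)) < Min (supp (h c))" by simp
  qed
  then have "(\<lambda>f. Min (supp f)) ` restr E ` \<G> \<in> schreier n"
    by (simp add: B_def image_image)
  moreover have "before (supp f) (supp g) \<or> before (supp g) (supp f)"
    if fg: "f \<in> restr E ` \<G>" "g \<in> restr E ` \<G>" "f \<noteq> g" for f g
  proof -
    obtain f' g' where "f' \<in> \<F>" "g' \<in> \<F>" "f = restr E f'" "g = restr E g'" "f' \<noteq> g'"
      using fg unfolding \<G>_def by blast
    moreover from this have "before (supp f') (supp g') \<or> before (supp g') (supp f')"
      using assms(1) by (auto simp: successive_family_def)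
    ultimately show ?thesis by (auto simp: before_iff)
  qed
  moreover have "finite (restr E ` \<G>)" using F(1) by (simp add: \<G>_def)
  moreover have "restr E ` \<G> \<subseteq> K"
  proof
    fix g assume "g \<in> restr E ` \<G>"
    then obtain f where "g = restr E f" "f \<in> \<F>" "supp f \<inter> E \<noteq> {}" by (auto simp: \<G>_def)
    then show "g \<in> K" using assms(2)[of f] by simp
  qed
  moreover have "restr E ` \<G> \<noteq> {}" using ne by (auto simp: \<G>_def)
  ultimately show ?thesis
    unfolding successive_family_def \<G>_def by blast
qed

lemma K_restr: "f \<in> K \<Longrightarrow> supp f \<inter> E \<noteq> {} \<Longrightarrow> restr E f \<in> K"
proof (induction rule: K_induct)
  case (pos n)
  then have "restr E (Poly_Mapping.single n 1) = Poly_Mapping.single n (1::real)"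
    by (intro poly_mapping_eqI) (auto simp: lookup_restr lookup_single when_def)
  then show ?case using norming_set.pos[OF pos.hyps] by simp
next
  case (neg n)
  then have "restr E (- Poly_Mapping.single n 1) = - Poly_Mapping.single n (1::real)"
    by (intro poly_mapping_eqI) (auto simp: lookup_restr lookup_single when_def)
  then show ?case using norming_set.neg[OF neg.hyps] by simp
next
  case (allowable \<F>)
  let ?G = "restr E ` {f \<in> \<F>. supp f \<inter> E \<noteq> {}}"
  have ne: "?G \<noteq> {}" using allowable.prems supp_Sum[OF allowable.hyps(1)] by (auto simp: supp_scaleR)
  have card: "card ?G \<le> card \<F>"
    by (rule surj_card_le[OF disjoint_familyD(1)[OF allowable.hyps(1)], of _ "restr E"]) blast
  have "(1/2) *\<^sub>R (\<Sum>?G) \<in> K"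
  proof (rule K_allowable[OF disjoint_family_restr[OF allowable.hyps(1) allowable.IH] ne])
    fix f a assume "f \<in> ?G" "a \<in> supp f"
    then have "card \<F> \<le> a" using allowable.hyps(3) by auto
    then show "card ?G \<le> a" using card by simp
  qed
  then show ?case by (simp add: restr_scaleR restr_Sum[OF allowable.hyps(1)])
next
  case (admissible j \<F>)
  have "\<exists>f\<in>\<F>. supp f \<inter> E \<noteq> {}"
    using admissible.prems supp_Sum[OF successive_family_disjoint[OF admissible.hyps(2)]]
    by (auto simp: supp_scaleR split: if_splits)
  then show ?case
    using K_admissible[OF admissible.hyps(1) successive_family_restr[OF admissible.hyps(2) admissible.IH]]
    by (simp add: restr_scaleR restr_Sum[OF successive_family_disjoint[OF admissible.hyps(2)]])
qed

section \<open>The norm\<close>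

lemma bdd_above_pairing: "A \<subseteq> K \<Longrightarrow> bdd_above ((\<lambda>f. pairing f x) ` A)"
  by (rule bdd_aboveI2[of _ _ "\<Sum>i\<in>supp x. \<bar>Poly_Mapping.lookup x i\<bar>"])
    (use abs_le_D1[OF pairing_bound] in blast)

lemma pairing_le_nrm: "f \<in> K \<Longrightarrow> pairing f x \<le> nrm x"
  unfolding mixed_norm_def by (rule cSUP_upper) (auto intro: bdd_above_pairing)

lemma abs_pairing_le_nrm: "f \<in> K \<Longrightarrow> \<bar>pairing f x\<bar> \<le> nrm x"
  using pairing_le_nrm[of f x] pairing_le_nrm[OF uminus_norming_set, of f x]
  by (simp add: pairing_uminus abs_le_iff)

lemma K_nonempty: "K \<noteq> {}"
  using norming_set.pos[of 1] by auto

lemma nrm_le: "(\<And>f. f \<in> K \<Longrightarrow> pairing f x \<le> c) \<Longrightarrow> nrm x \<le> c"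
  unfolding mixed_norm_def by (rule cSUP_least[OF K_nonempty])

lemma nrm_nonneg: "0 \<le> nrm x"
  using abs_pairing_le_nrm[OF norming_set.pos[of 1], of x] by simp

lemma nrm_triangle: "nrm (x + y) \<le> nrm x + nrm y"
  using pairing_le_nrm by (intro nrm_le) (auto simp: pairing_add intro: add_mono)

lemma nrm_scaleR_le: "nrm (c *\<^sub>R x) \<le> \<bar>c\<bar> * nrm x"
proof (rule nrm_le)
  fix f assume "f \<in> K"
  then have "\<bar>c\<bar> * \<bar>pairing f x\<bar> \<le> \<bar>c\<bar> * nrm x" using abs_pairing_le_nrm by (intro mult_left_mono) auto
  then show "pairing f (c *\<^sub>R x) \<le> \<bar>c\<bar> * nrm x" by (simp add: pairing_scaleR abs_mult[symmetric])
qed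

lemma nrm_scaleR: "nrm (c *\<^sub>R x) = \<bar>c\<bar> * nrm x"
proof (rule antisym[OF nrm_scaleR_le])
  show "\<bar>c\<bar> * nrm x \<le> nrm (c *\<^sub>R x)"
  proof (cases "c = 0")
    case True
    then show ?thesis using nrm_nonneg by simp
  next
    case False
    have "nrm x \<le> \<bar>inverse c\<bar> * nrm (c *\<^sub>R x)"
      using nrm_scaleR_le[of "inverse c" "c *\<^sub>R x"] False by simp
    then show ?thesis using False by (simp add: field_simps)
  qed
qed

lemma nrm_sum: "nrm (\<Sum>i\<in>I. x i) \<le> (\<Sum>i\<in>I. nrm (x i))"
proof (cases "finite I")
  case True
  then show ?thesis
  proof (induction I)
    case empty
    show ?case by (simp add: nrm_le pairing_def)
  next
    case (insert i I)
    then show ?case using nrm_triangle[of "x i" "\<Sum>i\<in>I. x i"] by simp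
  qed
qed (simp add: nrm_le pairing_def)

lemma pairing_single: "pairing (Poly_Mapping.single n 1) x = Poly_Mapping.lookup x n"
  by (simp add: pairing_def)

lemma lookup_le_nrm: "1 \<le> n \<Longrightarrow> \<bar>Poly_Mapping.lookup x n\<bar> \<le> nrm x"
  using abs_pairing_le_nrm[OF norming_set.pos, of n x] by (simp add: pairing_single)

lemma nrm_pos:
  assumes "x \<in> c00" "x \<noteq> 0"
  shows "0 < nrm x"
proof -
  obtain n where n: "n \<in> supp x" using assms(2) by (metis keys_eq_empty all_not_in_conv)
  then have "1 \<le> n" "Poly_Mapping.lookup x n \<noteq> 0" using assms(1) by (auto simp: c00_def in_keys_iff)
  then show ?thesis using lookup_le_nrm[of n x] by linarith
qed

lemma nrm_norming:
  assumes "c < nrm x"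
  obtains f where "f \<in> K" "c < pairing f x"
  using assms nrm_le[of x c] by (meson not_le)

lemma nrm_norming_restr:
  assumes "0 \<le> c" "c < nrm x"
  obtains f where "f \<in> K" "c < pairing f x" "supp f \<subseteq> supp x"
proof -
  obtain f where f: "f \<in> K" "c < pairing f x" using nrm_norming[OF assms(2)] .
  have "supp f \<inter> supp x \<noteq> {}" using f(2) assms(1) pairing_disjoint[of f x] by auto
  then have "restr (supp x) f \<in> K" using K_restr f(1) by blast
  then show ?thesis using f(2) by (intro that[of "restr (supp x) f"]) (simp_all add: pairing_restr)
qed

text \<open>After restriction to \<open>supp x\<close> and a choice of signs, half the sum of the family is an
  allowable functional.\<close>

lemma disjoint_family_sum_le:
  assumes "disjoint_family \<F>" "\<And>a. a \<in> supp x \<Longrightarrow> card \<F> \<le> a"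
  shows "(\<Sum>f\<in>\<F>. \<bar>pairing f x\<bar>) \<le> 2 * nrm x"
proof -
  note F = disjoint_familyD[OF assms(1)]
  define \<G> where "\<G> = {f \<in> \<F>. supp f \<inter> supp x \<noteq> {}}"
  define s where "s f = (if 0 \<le> pairing f x then restr (supp x) f else - restr (supp x) f)" for f
  have supp_s: "supp (s f) = supp f \<inter> supp x" for f by (simp add: s_def)
  have sK: "s f \<in> K" if "f \<in> \<G>" for f
    using that K_restr F(2) uminus_norming_set by (auto simp: s_def \<G>_def)
  have s_disj: "supp (s f) \<inter> supp (s g) = {}" if "f \<in> \<G>" "g \<in> \<G>" "f \<noteq> g" for f g
    using F(3)[of f g] that by (auto simp: supp_s \<G>_def)
  have finG: "finite \<G>" using F(1) by (simp add: \<G>_def)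
  have inj: "inj_on s \<G>"
  proof (rule inj_onI, rule ccontr)
    fix f g assume fg: "f \<in> \<G>" "g \<in> \<G>" "s f = s g" "f \<noteq> g"
    then have "supp (s f) = {}" using s_disj[of f g] by simp
    then show False using fg(1) by (simp add: supp_s \<G>_def)
  qed
  have pair_s: "pairing (s f) x = \<bar>pairing f x\<bar>" for f
    by (simp add: s_def pairing_uminus pairing_restr)
  have "(\<Sum>f\<in>\<F>. \<bar>pairing f x\<bar>) = (\<Sum>f\<in>\<G>. \<bar>pairing f x\<bar>)"
    using F(1) by (intro sum.mono_neutral_right) (auto simp: \<G>_def pairing_disjoint)
  also have "\<dots> = (\<Sum>g\<in>s ` \<G>. pairing g x)"
    by (simp add: sum.reindex[OF inj] pair_s)
  also have "\<dots> = 2 * pairing ((1/2) *\<^sub>R (\<Sum>(s ` \<G>))) x"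
    by (simp add: pairing_scaleR_left pairing_sum_left)
  also have "\<dots> \<le> 2 * nrm x"
  proof (cases "\<G> = {}")
    case True
    then show ?thesis using nrm_nonneg by (simp add: pairing_def)
  next
    case False
    have "(1/2) *\<^sub>R (\<Sum>(s ` \<G>)) \<in> K"
    proof (rule K_allowable)
      show "disjoint_family (s ` \<G>)"
        using sK s_disj finG unfolding disjoint_family_def by blast
      fix f a assume "f \<in> s ` \<G>" "a \<in> supp f"
      then have "card \<F> \<le> a" using assms(2) by (auto simp: supp_s)
      moreover have "card (s ` \<G>) \<le> card \<F>"
        using card_image_le[OF finG, of s] card_mono[OF F(1), of \<G>] by (auto simp: \<G>_def)
      ultimately show "card (s ` \<G>) \<le> a" by simp
    qed (use False in simp)
    then show ?thesis using pairing_le_nrm by simp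
  qed
  finally show ?thesis .
qed

section \<open>Averages of blocks\<close>

lemma successive_family_interval:
  assumes "successive_family n \<F>" "\<And>h. h \<in> \<F> \<Longrightarrow> Min (supp h) \<notin> {c<..d}"
  obtains h where "h \<in> \<F>" "\<And>h'. h' \<in> \<F> \<Longrightarrow> h' \<noteq> h \<Longrightarrow> supp h' \<inter> {c<..d} = {}"
proof -
  note F = successive_familyD[OF assms(1)]
  have unique: "h = h'" if "h \<in> \<F>" "h' \<in> \<F>" "a \<in> supp h \<inter> {c<..d}" "b \<in> supp h' \<inter> {c<..d}"
    and le: "Min (supp h) \<le> Min (supp h')" for h h' a b
  proof (rule ccontr)
    assume "h \<noteq> h'"
    then have "Min (supp h) < Min (supp h')"
      using le disjoint_family_Min_inj[OF successive_family_disjoint[OF assms(1)]] that(1,2)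
      by (metis inj_onD le_neq_implies_less)
    then have "a < Min (supp h')"
      using F(5)[OF that(1,2), of a] that Min_supp_in[OF F(3)[OF that(2)]] by blast
    moreover have "Min (supp h') \<le> b" using that(4) by simp
    ultimately have "c < Min (supp h')" "Min (supp h') \<le> d"
      using that(3,4) unfolding Int_iff greaterThanAtMost_iff by linarith+
    then have "Min (supp h') \<in> {c<..d}" by simp
    then show False using assms(2)[OF that(2)] by blast
  qed
  show ?thesis
  proof (cases "\<exists>h\<in>\<F>. supp h \<inter> {c<..d} \<noteq> {}")
    case True
    then obtain h where h: "h \<in> \<F>" "supp h \<inter> {c<..d} \<noteq> {}" by blast
    have "h' = h" if "h' \<in> \<F>" "supp h' \<inter> {c<..d} \<noteq> {}" for h'
      using unique[of h h'] unique[of h' h] h that by (metis all_not_in_conv nle_le)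
    then show ?thesis using that[OF h(1)] by blast
  next
    case False
    then show ?thesis using that F(2) by blast
  qed
qed

lemma pairing_weighted_interval:
  assumes "g \<in> weighted j" "g = (1 / real (m j)) *\<^sub>R (\<Sum>\<F>)" "successive_family (k j) \<F>"
    and "\<And>h. h \<in> \<F> \<Longrightarrow> Min (supp h) \<notin> {c<..d}"
  obtains h where "h \<in> \<F>" "\<And>x. supp x \<subseteq> {c<..d} \<Longrightarrow> pairing g x = pairing h x / m j"
proof -
  obtain h where h: "h \<in> \<F>" "\<And>h'. h' \<in> \<F> \<Longrightarrow> h' \<noteq> h \<Longrightarrow> supp h' \<inter> {c<..d} = {}"
    using successive_family_interval[OF assms(3,4)] by metis
  have "pairing g x = pairing h x / m j" if x: "supp x \<subseteq> {c<..d}" for x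
  proof -
    have "(\<Sum>h'\<in>\<F>. pairing h' x) = (\<Sum>h'\<in>{h}. pairing h' x)"
    proof (rule sum.mono_neutral_right)
      show "\<forall>h'\<in>\<F> - {h}. pairing h' x = 0"
        using h(2) x by (blast intro: pairing_disjoint)
    qed (use h(1) successive_familyD(1)[OF assms(3)] in auto)
    then show ?thesis by (simp add: assms(2) pairing_scaleR_left pairing_sum_left)
  qed
  then show ?thesis using that h(1) by blast
qed

lemma average_weighted_le:
  assumes P: "strict_mono P" and avg: "average P n \<epsilon> F a"
    and u: "\<And>l. supp (u l) \<subseteq> zone P l" "\<And>l. nrm (u l) \<le> 1"
    and fam: "disjoint_family \<B>" and card: "card \<B> \<le> P 0" and j: "2 \<le> j"
    and wt: "\<And>g. g \<in> \<B> \<Longrightarrow> \<exists>i\<ge>j. k i < n \<and> g \<in> weighted i"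
  shows "(\<Sum>g\<in>\<B>. \<bar>pairing g (\<Sum>l\<in>F. a l *\<^sub>R u l)\<bar>) \<le> 2 / m j + 2 * \<epsilon>"
proof -
  note B = disjoint_familyD[OF fam]
  have conv: "finite F" "\<And>l. 0 \<le> a l" "sum a F = 1"
    using avg by (auto simp: average_def convex_on_set_def)
  have "\<forall>g\<in>\<B>. \<exists>i \<F>. j \<le> i \<and> k i < n \<and> g \<in> weighted i \<and> successive_family (k i) \<F> \<and> g = (1 / real (m i)) *\<^sub>R (\<Sum>\<F>)"
  proof
    fix g assume "g \<in> \<B>"
    then obtain i where "j \<le> i" "k i < n" "g \<in> weighted i" using wt by blast
    then show "\<exists>i \<F>. j \<le> i \<and> k i < n \<and> g \<in> weighted i \<and> successive_family (k i) \<F> \<and> g = (1 / real (m i)) *\<^sub>R (\<Sum>\<F>)"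
      unfolding weighted_def by blast
  qed
  then obtain i \<F> where iF: "\<And>g. g \<in> \<B> \<Longrightarrow> j \<le> i g \<and> k (i g) < n \<and> g \<in> weighted (i g) \<and>
      successive_family (k (i g)) (\<F> g) \<and> g = (1 / real (m (i g))) *\<^sub>R (\<Sum>(\<F> g))"
    unfolding bchoice_iff by blast
  have i: "j \<le> i g" "k (i g) < n" and iw: "g \<in> weighted (i g)" and sF: "successive_family (k (i g)) (\<F> g)"
    if "g \<in> \<B>" for g
    using iF[OF that] by blast+
  define G where "G = (\<Union>g\<in>\<B>. (\<lambda>h. Min (supp h)) ` \<F> g \<inter> {P 0<..})"
  have P0: "P 0 < b" if "b \<in> zone P l" for b l
    using that strict_mono_less_eq[OF P, of 0 l] by (simp add: zone_def)
  have "G \<in> loose (Suc (n - 1))"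
    unfolding G_def
  proof (rule loose_Union[OF B(1)])
    fix g assume g: "g \<in> \<B>"
    have "(\<lambda>h. Min (supp h)) ` \<F> g \<inter> {P 0<..} \<in> schreier (k (i g))"
      by (rule schreier_subset[OF successive_familyD(4)[OF sF[OF g]]]) blast
    moreover have "k (i g) \<le> n - 1" using i(2)[OF g] by linarith
    ultimately show "(\<lambda>h. Min (supp h)) ` \<F> g \<inter> {P 0<..} \<in> loose (n - 1)"
      using schreier_mono schreier_subset_loose by blast
  next
    fix g b assume "b \<in> (\<lambda>h. Min (supp h)) ` \<F> g \<inter> {P 0<..}"
    then show "card \<B> \<le> b" using card by simp
  qed
  moreover have "n = Suc (n - 1)" if ne: "\<B> \<noteq> {}"
  proof -
    obtain g where "g \<in> \<B>" using ne by blast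
    then show ?thesis using i(2)[of g] by linarith
  qed
  ultimately have Gn: "G \<in> loose n" if "\<B> \<noteq> {}" using that by metis
  have total: "(\<Sum>g\<in>\<B>. \<bar>pairing g (u l)\<bar>) \<le> 2" for l
  proof -
    have "(\<Sum>g\<in>\<B>. \<bar>pairing g (u l)\<bar>) \<le> 2 * nrm (u l)"
    proof (rule disjoint_family_sum_le[OF fam])
      fix b assume "b \<in> supp (u l)"
      then have "P 0 < b" using u(1) P0 by blast
      then show "card \<B> \<le> b" using card by simp
    qed
    then show ?thesis using u(2)[of l] by linarith
  qed
  have good: "(\<Sum>g\<in>\<B>. \<bar>pairing g (u l)\<bar>) \<le> 2 / m j" if l: "zone P l \<inter> G = {}" for l
  proof -
    have "\<exists>h. h \<in> \<F> g \<and> pairing g (u l) = pairing h (u l) / m (i g)" if g: "g \<in> \<B>" for g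
    proof -
      have "Min (supp h) \<notin> {P l<..P (Suc l)}" if "h \<in> \<F> g" for h
      proof
        assume "Min (supp h) \<in> {P l<..P (Suc l)}"
        then have z: "Min (supp h) \<in> zone P l" by (simp add: zone_def)
        then have "Min (supp h) \<in> G" unfolding G_def using P0[OF z] g that by blast
        then show False using l z by blast
      qed
      then obtain h where "h \<in> \<F> g" "\<And>x. supp x \<subseteq> {P l<..P (Suc l)} \<Longrightarrow> pairing g x = pairing h x / m (i g)"
        using pairing_weighted_interval[OF iw[OF g] _ sF[OF g], of "P l" "P (Suc l)"] iF[OF g] by metis
      then show ?thesis using u(1)[of l] by (auto simp: zone_def)
    qed
    then obtain h where h: "\<And>g. g \<in> \<B> \<Longrightarrow> h g \<in> \<F> g \<and> pairing g (u l) = pairing (h g) (u l) / m (i g)"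
      by metis
    have hK: "h g \<in> K" if "g \<in> \<B>" for g
      using h[OF that] successive_familyD(3)[OF sF[OF that]] by blast
    have h_supp: "supp (h g) \<subseteq> supp g" if "g \<in> \<B>" for g
    proof -
      have "m (i g) \<noteq> 0" using m_ge_2[of "i g"] i(1)[OF that] j by linarith
      moreover have "g = (1 / real (m (i g))) *\<^sub>R (\<Sum>(\<F> g))" using iF[OF that] by blast
      ultimately have "supp g = supp (\<Sum>(\<F> g))" by (metis supp_scaleR divide_eq_0_iff of_nat_eq_0_iff zero_neq_one)
      then show ?thesis using h[OF that] supp_Sum[OF successive_family_disjoint[OF sF[OF that]]] by blast
    qed
    have disj: "supp (h f) \<inter> supp (h g) = {}" if "f \<in> \<B>" "g \<in> \<B>" "f \<noteq> g" for f g
      using h_supp[OF that(1)] h_supp[OF that(2)] B(3)[OF that] by blast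
    have inj: "inj_on h \<B>"
    proof (rule inj_onI, rule ccontr)
      fix f g assume fg: "f \<in> \<B>" "g \<in> \<B>" "h f = h g" "f \<noteq> g"
      show False using disj[OF fg(1,2,4)] fg(3) K_supp[OF hK[OF fg(1)]] by simp
    qed
    have famh: "disjoint_family (h ` \<B>)"
      unfolding disjoint_family_def
    proof (intro conjI ballI impI)
      show "finite (h ` \<B>)" using B(1) by simp
      show "h ` \<B> \<subseteq> K" using hK by blast
      show "supp f' \<inter> supp g' = {}" if "f' \<in> h ` \<B>" "g' \<in> h ` \<B>" "f' \<noteq> g'" for f' g'
        using that disj by blast
    qed
    have "(\<Sum>g\<in>\<B>. \<bar>pairing g (u l)\<bar>) \<le> (\<Sum>g\<in>\<B>. \<bar>pairing (h g) (u l)\<bar> / m j)"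
    proof (rule sum_mono)
      fix g assume g: "g \<in> \<B>"
      have "m j \<le> m (i g)" using m_mono[of j "i g"] i(1)[OF g] j by simp
      moreover have "2 \<le> m j" using m_ge_2 j by simp
      ultimately have "\<bar>pairing (h g) (u l)\<bar> / m (i g) \<le> \<bar>pairing (h g) (u l)\<bar> / m j"
        by (intro divide_left_mono) auto
      then show "\<bar>pairing g (u l)\<bar> \<le> \<bar>pairing (h g) (u l)\<bar> / m j" using h[OF g] by simp
    qed
    also have "\<dots> = (\<Sum>g\<in>h ` \<B>. \<bar>pairing g (u l)\<bar>) / m j"
      by (simp add: sum.reindex[OF inj] sum_divide_distrib)
    also have "\<dots> \<le> 2 / m j"
    proof (rule divide_right_mono)
      have "(\<Sum>g\<in>h ` \<B>. \<bar>pairing g (u l)\<bar>) \<le> 2 * nrm (u l)"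
      proof (rule disjoint_family_sum_le[OF famh])
        fix b assume "b \<in> supp (u l)"
        then have "P 0 < b" using u(1) P0 by blast
        then show "card (h ` \<B>) \<le> b" using card card_image_le[OF B(1), of h] by linarith
      qed
      then show "(\<Sum>g\<in>h ` \<B>. \<bar>pairing g (u l)\<bar>) \<le> 2" using u(2)[of l] by linarith
    qed simp
    finally show ?thesis .
  qed
  have bound: "a l * (\<Sum>g\<in>\<B>. \<bar>pairing g (u l)\<bar>) \<le> a l * (2 / m j) + 2 * (if zone P l \<inter> G \<noteq> {} then a l else 0)" for l
  proof (cases "zone P l \<inter> G = {}")
    case True
    then show ?thesis using mult_left_mono[OF good[OF True] conv(2)[of l]] by simp
  next
    case False
    have "0 \<le> a l * (2 / m j)" using conv(2)[of l] by simp
    then show ?thesis using mult_left_mono[OF total[of l] conv(2)[of l]] False by simp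
  qed
  have hit: "hit_mass P F a G \<le> \<epsilon>" if "\<B> \<noteq> {}" using avg Gn[OF that] by (simp add: average_def)
  have eps: "0 \<le> \<epsilon>"
  proof -
    have "{} \<in> loose n" using schreier_subset_loose schreier_empty by blast
    then have "hit_mass P F a {} \<le> \<epsilon>" using avg by (simp add: average_def)
    then show ?thesis by (simp add: hit_mass_0)
  qed
  have "(\<Sum>g\<in>\<B>. \<bar>pairing g (\<Sum>l\<in>F. a l *\<^sub>R u l)\<bar>) \<le> (\<Sum>g\<in>\<B>. \<Sum>l\<in>F. a l * \<bar>pairing g (u l)\<bar>)"
  proof (rule sum_mono)
    fix g
    have "\<bar>pairing g (\<Sum>l\<in>F. a l *\<^sub>R u l)\<bar> \<le> (\<Sum>l\<in>F. \<bar>a l * pairing g (u l)\<bar>)"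
      unfolding pairing_sum_right pairing_scaleR by (rule sum_abs)
    then show "\<bar>pairing g (\<Sum>l\<in>F. a l *\<^sub>R u l)\<bar> \<le> (\<Sum>l\<in>F. a l * \<bar>pairing g (u l)\<bar>)"
      using conv(2) by (simp add: abs_mult)
  qed
  also have "\<dots> = (\<Sum>l\<in>F. a l * (\<Sum>g\<in>\<B>. \<bar>pairing g (u l)\<bar>))"
    by (subst sum.swap) (simp add: sum_distrib_left)
  also have "\<dots> \<le> (\<Sum>l\<in>F. a l * (2 / m j) + 2 * (if zone P l \<inter> G \<noteq> {} then a l else 0))"
    by (rule sum_mono) (rule bound)
  also have "\<dots> = 2 / m j + 2 * hit_mass P F a G"
    unfolding sum.distrib sum_distrib_right[symmetric] sum_distrib_left[symmetric] conv(3) hit_mass_def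
      sum.inter_filter[OF conv(1)] by simp
  finally show ?thesis using hit eps by (cases "\<B> = {}") auto
qed

definition rich :: "(nat \<Rightarrow>\<^sub>0 real) set \<Rightarrow> bool" where
  "rich S \<longleftrightarrow> subspace S \<and> S \<subseteq> c00 \<and> (\<forall>N. \<exists>u\<in>S. u \<noteq> 0 \<and> supp u \<subseteq> {N<..})"

definition average_vector :: "(nat \<Rightarrow>\<^sub>0 real) set \<Rightarrow> nat \<Rightarrow> nat \<Rightarrow> real \<Rightarrow> (nat \<Rightarrow>\<^sub>0 real) \<Rightarrow> bool" where
  "average_vector S N n \<epsilon> x \<longleftrightarrow> (\<exists>P F a u. strict_mono P \<and> N \<le> P 0 \<and> average P n \<epsilon> F a \<and>
     (\<forall>l. supp (u l) \<subseteq> zone P l \<and> u l \<in> S \<and> nrm (u l) \<le> 1) \<and> x = (\<Sum>l\<in>F. a l *\<^sub>R u l))"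

lemma convex_combination_nrm_le:
  assumes "convex_on_set F a" "\<And>l. nrm (u l) \<le> 1"
  shows "nrm (\<Sum>l\<in>F. a l *\<^sub>R u l) \<le> 1"
proof -
  have "nrm (\<Sum>l\<in>F. a l *\<^sub>R u l) \<le> (\<Sum>l\<in>F. nrm (a l *\<^sub>R u l))" by (rule nrm_sum)
  also have "\<dots> \<le> (\<Sum>l\<in>F. a l)"
  proof (rule sum_mono)
    fix l
    have "0 \<le> a l" using assms(1) by (simp add: convex_on_set_def)
    then show "nrm (a l *\<^sub>R u l) \<le> a l" using assms(2)[of l] by (simp add: nrm_scaleR mult_left_le)
  qed
  finally show ?thesis using assms(1) by (simp add: convex_on_set_def)
qed

lemma supp_combination: "supp (\<Sum>l\<in>F. a l *\<^sub>R u l) \<subseteq> (\<Union>l\<in>F. supp (u l))"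
  using keys_sum[of "\<lambda>l. a l *\<^sub>R u l" F] by (fastforce simp: supp_scaleR split: if_splits)

lemma average_vectorD:
  assumes "average_vector S N n \<epsilon> x" "rich S"
  shows "x \<in> S" "nrm x \<le> 1" "supp x \<subseteq> {N<..}"
proof -
  obtain P F a u where A: "strict_mono P" "N \<le> P 0" "average P n \<epsilon> F a"
     "\<And>l. supp (u l) \<subseteq> zone P l" "\<And>l. u l \<in> S" "\<And>l. nrm (u l) \<le> 1" and x: "x = (\<Sum>l\<in>F. a l *\<^sub>R u l)"
    using assms(1) unfolding average_vector_def by blast
  show "x \<in> S" unfolding x using assms(2) A(5)
    by (intro subspace_sum subspace_scale) (auto simp: rich_def)
  show "nrm x \<le> 1" unfolding x
    by (rule convex_combination_nrm_le) (use A in \<open>auto simp: average_def\<close>)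
  show "supp x \<subseteq> {N<..}"
  proof
    fix b assume "b \<in> supp x"
    then obtain l where "b \<in> zone P l" using supp_combination[of a u F] A(4) unfolding x by blast
    then show "b \<in> {N<..}" using A(2) strict_mono_less_eq[OF A(1), of 0 l] by (simp add: zone_def)
  qed
qed

text \<open>James' argument: if every average of order \<open>n\<close> lost a factor 2, then \<open>t i\<close> iterations would
  produce a vector in the unit ball on which an admissible functional of weight \<open>m i\<close> is too large.\<close>

lemma average_vector_exists:
  assumes rich: "rich S" and \<epsilon>: "0 < \<epsilon>"
  obtains x where "average_vector S N n \<epsilon> x" "1 / 2 \<le> nrm x"
proof (rule ccontr)
  assume no_witness: "\<not> thesis"
  note witness = that
  have small: "nrm x < 1 / 2" if "average_vector S N n \<epsilon> x" for x
    using witness[OF that] no_witness by fastforce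
  have S: "subspace S" "S \<subseteq> c00" "\<And>N. \<exists>u\<in>S. u \<noteq> 0 \<and> supp u \<subseteq> {N<..}"
    using rich by (auto simp: rich_def)
  define Q where "Q s M u \<G> R \<longleftrightarrow> u \<in> S \<and> nrm u \<le> 1 \<and> supp u \<subseteq> {M<..R} \<and>
      successive_family (s * Suc n) \<G> \<and> (\<forall>g\<in>\<G>. supp g \<subseteq> {M<..R}) \<and> 2 ^ s / 2 \<le> (\<Sum>g\<in>\<G>. pairing g u)"
    for s M u \<G> R
  have "\<forall>M\<ge>N. \<exists>u \<G> R. Q s M u \<G> R" for s
  proof (induction s)
    case 0
    show ?case
    proof (intro allI impI)
      fix M
      obtain v where v: "v \<in> S" "v \<noteq> 0" "supp v \<subseteq> {M<..}" using S(3) by blast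
      have pos: "0 < nrm v" using nrm_pos v S(2) by blast
      define u where "u = (1 / nrm v) *\<^sub>R v"
      have u: "u \<in> S" "supp u = supp v" "nrm u = 1"
        using v pos S(1) by (auto simp: u_def subspace_scale supp_scaleR nrm_scaleR)
      obtain g where g: "g \<in> K" "1 / 2 < pairing g u" "supp g \<subseteq> supp u"
        using nrm_norming_restr[of "1 / 2" u] u(3) by auto
      have "successive_family (0 * Suc n) {g}"
        using g(1) Min_supp_in[OF g(1)] K_supp[OF g(1)] unfolding successive_family_def by auto
      moreover have "supp u \<subseteq> {M<..Max (supp u)}" using u(2) v(3) by auto
      ultimately have "Q 0 M u {g} (Max (supp u))" using u g unfolding Q_def by auto
      then show "\<exists>u \<G> R. Q 0 M u \<G> R" by blast
    qed
  next
    case (Suc s)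
    then obtain uu GG RR where Q: "\<And>M. N \<le> M \<Longrightarrow> Q s M (uu M) (GG M) (RR M)" by metis
    show ?case
    proof (intro allI impI)
      fix M assume M: "N \<le> M"
      have RR: "M' < RR M'" if "N \<le> M'" for M'
      proof -
        have "successive_family (s * Suc n) (GG M')" and zone: "\<forall>g\<in>GG M'. supp g \<subseteq> {M'<..RR M'}"
          using Q[OF that] by (simp_all add: Q_def)
        then obtain g where "g \<in> GG M'" "g \<in> K" using successive_familyD(2,3) by blast
        then have "supp g \<subseteq> {M'<..RR M'}" "Min (supp g) \<in> supp g" using zone Min_supp_in by auto
        then show ?thesis by (metis greaterThanAtMost_iff less_le_trans subsetD)
      qed
      define P where "P l = (RR ^^ l) M" for l
      have P0: "P 0 = M" and PSuc: "P (Suc l) = RR (P l)" for l by (simp_all add: P_def)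
      have PN: "N \<le> P l" for l
      proof (induction l)
        case (Suc l)
        then show ?case using RR[of "P l"] by (simp add: PSuc)
      qed (simp add: P0 M)
      have P: "strict_mono P" unfolding strict_mono_Suc_iff using RR PN by (simp add: PSuc)
      define u where "u l = uu (P l)" for l
      define \<G> where "\<G> l = GG (P l)" for l
      have u: "u l \<in> S" "nrm (u l) \<le> 1" "supp (u l) \<subseteq> zone P l"
        and G: "successive_family (s * Suc n) (\<G> l)" "\<And>g. g \<in> \<G> l \<Longrightarrow> supp g \<subseteq> zone P l"
          "2 ^ s / 2 \<le> (\<Sum>g\<in>\<G> l. pairing g (u l))" for l
        using Q[OF PN[of l]] by (auto simp: Q_def u_def \<G>_def zone_def PSuc)
      obtain F a where avg: "average P n \<epsilon> F a" using average_exists[OF P \<epsilon>] .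
      have conv: "finite F" "\<And>l. 0 \<le> a l" "sum a F = 1" and sel: "selects P (Suc n) F"
        using avg by (auto simp: average_def convex_on_set_def)
      define x where "x = (\<Sum>l\<in>F. a l *\<^sub>R u l)"
      have avgx: "average_vector S N n \<epsilon> x"
        unfolding average_vector_def x_def using P avg u PN[of 0] by blast
      have xS: "x \<in> S" by (rule average_vectorD(1)[OF avgx rich])
      define \<H> where "\<H> = (\<Union>l\<in>F. \<G> l)"
      have GK: "g \<in> K" if "g \<in> \<G> l" for g l using successive_familyD(3)[OF G(1)] that by blast
      have Min_zone: "Min (supp g) \<in> zone P l" if "g \<in> \<G> l" for g l
        using G(2)[OF that] Min_supp_in[OF GK[OF that]] by blast
      define p where "p l = Min ((\<lambda>g. Min (supp g)) ` \<G> l)" for l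
      have finG: "finite (\<G> l)" "\<G> l \<noteq> {}" for l using successive_familyD(1,2)[OF G(1)[of l]] by auto
      have p: "p l \<in> (\<lambda>g. Min (supp g)) ` \<G> l" for l
        unfolding p_def using finG by (intro Min_in) auto
      have p_zone: "p l \<in> zone P l" for l
      proof -
        obtain g where "p l = Min (supp g)" "g \<in> \<G> l" using p[of l] by (rule imageE)
        then show ?thesis using Min_zone by metis
      qed
      have "(\<Union>l\<in>F. (\<lambda>g. Min (supp g)) ` \<G> l) \<in> schreier (Suc n + s * Suc n)"
      proof (rule schreier_compose)
        show "p ` F \<in> schreier (Suc n)" using sel p_zone by (simp add: selects_def)
        show "finite F" by (rule conv(1))
        show "inj_on p F" using p_zone zone_inj[OF P] by (metis inj_onI)
        show "(\<lambda>g. Min (supp g)) ` \<G> l \<in> schreier (s * Suc n)" for l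
          by (rule successive_familyD(4)[OF G(1)])
        show "p l \<le> y" if "y \<in> (\<lambda>g. Min (supp g)) ` \<G> l" for l y
          unfolding p_def using that finG by (intro Min_le) auto
        fix l l' assume "p l < p l'"
        then have "l < l'" using zone_less[OF P p_zone p_zone] by (metis less_asym less_irrefl linorder_neqE)
        then show "\<forall>y\<in>(\<lambda>g. Min (supp g)) ` \<G> l. \<forall>z\<in>(\<lambda>g. Min (supp g)) ` \<G> l'. y < z"
          using zone_less[OF P] Min_zone by blast
      qed
      moreover have "(\<lambda>g. Min (supp g)) ` \<H> = (\<Union>l\<in>F. (\<lambda>g. Min (supp g)) ` \<G> l)" by (auto simp: \<H>_def)
      moreover have "before (supp f) (supp g) \<or> before (supp g) (supp f)"
        if fg: "f \<in> \<H>" "g \<in> \<H>" "f \<noteq> g" for f g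
      proof -
        obtain l l' where l: "f \<in> \<G> l" "g \<in> \<G> l'" using fg by (auto simp: \<H>_def)
        consider "l < l'" | "l' < l" | "l = l'" by linarith
        then show ?thesis
        proof cases
          case 1
          then have "before (supp f) (supp g)"
            using zone_less[OF P] G(2)[OF l(1)] G(2)[OF l(2)]
            unfolding before_iff[OF finite_keys finite_keys] by blast
          then show ?thesis ..
        next
          case 2
          then have "before (supp g) (supp f)"
            using zone_less[OF P] G(2)[OF l(1)] G(2)[OF l(2)]
            unfolding before_iff[OF finite_keys finite_keys] by blast
          then show ?thesis ..
        next
          case 3
          then show ?thesis using G(1)[of l] l fg(3) unfolding successive_family_def by blast
        qed
      qed
      moreover have "finite \<H>" "\<H> \<subseteq> K" using conv(1) finG GK by (auto simp: \<H>_def)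
      moreover have "F \<noteq> {}" using conv(3) by auto
      then have "\<H> \<noteq> {}" using finG by (auto simp: \<H>_def)
      ultimately have sH: "successive_family (Suc s * Suc n) \<H>"
        unfolding successive_family_def mult_Suc by metis
      have pair_l: "pairing g x = a l * pairing g (u l)" if "g \<in> \<G> l" "l \<in> F" for g l
      proof -
        have "(\<Sum>l'\<in>F. a l' * pairing g (u l')) = (\<Sum>l'\<in>{l}. a l' * pairing g (u l'))"
        proof (rule sum.mono_neutral_right)
          show "\<forall>l'\<in>F - {l}. a l' * pairing g (u l') = 0"
          proof
            fix l' assume "l' \<in> F - {l}"
            then have "supp g \<inter> supp (u l') = {}"
              using G(2)[OF that(1)] u(3)[of l'] zone_inj[OF P] by blast
            then show "a l' * pairing g (u l') = 0" by (simp add: pairing_disjoint)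
          qed
        qed (use conv that in auto)
        then show ?thesis by (simp add: x_def pairing_sum_right pairing_scaleR)
      qed
      have disjG: "\<G> l \<inter> \<G> l' = {}" if "l \<noteq> l'" for l l'
        using Min_zone zone_inj[OF P] that by blast
      have "2 ^ s / 2 = (\<Sum>l\<in>F. a l * (2 ^ s / 2))" 
        by (simp only: sum_distrib_right[symmetric] conv(3) mult_1_left)
      also have "\<dots> \<le> (\<Sum>l\<in>F. a l * (\<Sum>g\<in>\<G> l. pairing g (u l)))"
        by (intro sum_mono mult_left_mono G(3) conv(2))
      also have "\<dots> = (\<Sum>l\<in>F. \<Sum>g\<in>\<G> l. pairing g x)"
        by (intro sum.cong refl) (simp add: sum_distrib_left pair_l)
      also have "\<dots> = (\<Sum>g\<in>\<H>. pairing g x)"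
        unfolding \<H>_def using conv(1) finG disjG by (intro sum.UNION_disjoint[symmetric]) auto
      finally have lower: "2 ^ s / 2 \<le> (\<Sum>g\<in>\<H>. pairing g x)" .
      have "x \<noteq> 0"
      proof
        assume "x = 0"
        then have "(2::real) ^ s / 2 \<le> 0" using lower by (simp add: pairing_def)
        then show False using zero_less_power[of "2::real" s] by linarith
      qed
      then have pos: "0 < nrm x" using nrm_pos xS S(2) by blast
      define R where "R = Max (P ` Suc ` F)"
      have zone_R: "zone P l \<subseteq> {M<..R}" if "l \<in> F" for l
      proof
        fix b assume b: "b \<in> zone P l"
        have "P (Suc l) \<le> R" unfolding R_def using that conv(1) by (intro Max_ge) auto
        moreover have "M \<le> P l" using strict_mono_less_eq[OF P, of 0 l] P0 by simp
        ultimately show "b \<in> {M<..R}" using b by (simp add: zone_def)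
      qed
      have "Q (Suc s) M ((1 / nrm x) *\<^sub>R x) \<H> R"
        unfolding Q_def
      proof (intro conjI ballI)
        show "(1 / nrm x) *\<^sub>R x \<in> S" using xS S(1) by (simp add: subspace_scale)
        show "nrm ((1 / nrm x) *\<^sub>R x) \<le> 1" using pos by (simp add: nrm_scaleR)
        have "supp x \<subseteq> {M<..R}"
          unfolding x_def using supp_combination[of a u F] u(3) zone_R by blast
        then show "supp ((1 / nrm x) *\<^sub>R x) \<subseteq> {M<..R}" by (simp add: supp_scaleR)
        show "successive_family (Suc s * Suc n) \<H>" by (rule sH)
        show "supp g \<subseteq> {M<..R}" if "g \<in> \<H>" for g
          using that G(2) zone_R unfolding \<H>_def by blast
        have "2 ^ s * nrm x \<le> 2 ^ s / 2" using small[OF avgx] by simp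
        also note lower
        finally show "2 ^ Suc s / 2 \<le> (\<Sum>g\<in>\<H>. pairing g ((1 / nrm x) *\<^sub>R x))"
          using pos by (simp add: pairing_scaleR sum_divide_distrib[symmetric] field_simps)
      qed
      then show "\<exists>u \<G> R. Q (Suc s) M u \<G> R" by blast
    qed
  qed
  note claim = this
  define i where "i = Suc (Suc n)"
  obtain u \<G> R where Q: "Q (t i) N u \<G> R" using claim[of "t i"] by blast
  have "t i * Suc n \<le> k i"
    using k_rec[of i] k_ge[of "Suc n"] by (simp add: i_def add_mono le_SucI)
  then have "successive_family (k i) \<G>"
    using Q subsetD[OF schreier_mono] unfolding Q_def successive_family_def by metis
  then have "(1 / real (m i)) *\<^sub>R (\<Sum>\<G>) \<in> K" by (intro K_admissible) (simp_all add: i_def)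
  then have "pairing ((1 / real (m i)) *\<^sub>R (\<Sum>\<G>)) u \<le> 1"
    using pairing_le_nrm[of _ u] Q unfolding Q_def by fastforce
  moreover have mi: "2 < m i" using m_gt[of i] by (simp add: i_def)
  ultimately have "(\<Sum>g\<in>\<G>. pairing g u) \<le> m i"
    by (simp add: pairing_scaleR_left pairing_sum_left field_simps)
  then have "2 ^ t i / 2 \<le> real (m i)" using Q unfolding Q_def by linarith
  moreover have "real ((m i)\<^sup>2) \<le> real (2 ^ t i)" using t_growth[of i] by (simp only: of_nat_le_iff) (simp add: i_def)
  ultimately have "real (m i) * real (m i) \<le> 2 * real (m i)" by (simp add: power2_eq_square)
  then show False using mi by simp
qed

section \<open>Rapidly increasing sequences\<close>

lemma average_vector_weighted_le:
  assumes "average_vector S N n \<epsilon> x" "disjoint_family \<B>" "card \<B> \<le> N" "2 \<le> j"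
    and "\<And>g. g \<in> \<B> \<Longrightarrow> \<exists>i\<ge>j. k i < n \<and> g \<in> weighted i"
  shows "(\<Sum>g\<in>\<B>. \<bar>pairing g x\<bar>) \<le> 2 / m j + 2 * \<epsilon>"
proof -
  obtain P F a u where A: "strict_mono P" "N \<le> P 0" "average P n \<epsilon> F a"
     "\<And>l. supp (u l) \<subseteq> zone P l" "\<And>l. nrm (u l) \<le> 1" and x: "x = (\<Sum>l\<in>F. a l *\<^sub>R u l)"
    using assms(1) unfolding average_vector_def by blast
  have "card \<B> \<le> P 0" using assms(3) A(2) by linarith
  then show ?thesis
    unfolding x using average_weighted_le[OF A(1,3,4,5) assms(2) _ assms(4,5)] by blast
qed

lemma disjoint_family_lookup_le:
  assumes "disjoint_family \<F>" "0 \<le> c" "\<And>f. f \<in> \<F> \<Longrightarrow> \<bar>Poly_Mapping.lookup f b\<bar> \<le> c"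
  shows "(\<Sum>f\<in>\<F>. \<bar>Poly_Mapping.lookup f b\<bar>) \<le> c"
proof (cases "\<exists>f\<in>\<F>. b \<in> supp f")
  case True
  then obtain f where f: "f \<in> \<F>" "b \<in> supp f" by blast
  have "(\<Sum>f\<in>\<F>. \<bar>Poly_Mapping.lookup f b\<bar>) = (\<Sum>f\<in>{f}. \<bar>Poly_Mapping.lookup f b\<bar>)"
  proof (rule sum.mono_neutral_right)
    show "\<forall>g\<in>\<F> - {f}. \<bar>Poly_Mapping.lookup g b\<bar> = 0"
    proof
      fix g assume "g \<in> \<F> - {f}"
      then have "supp g \<inter> supp f = {}" using disjoint_familyD(3)[OF assms(1), of g f] f(1) by blast
      then have "b \<notin> supp g" using f(2) by blast
      then show "\<bar>Poly_Mapping.lookup g b\<bar> = 0" by (simp add: in_keys_iff)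
    qed
  qed (use f disjoint_familyD(1)[OF assms(1)] in auto)
  then show ?thesis using assms(3)[OF f(1)] by simp
next
  case False
  then have "(\<Sum>f\<in>\<F>. \<bar>Poly_Mapping.lookup f b\<bar>) = 0"
    by (intro sum.neutral) (auto simp: in_keys_iff)
  then show ?thesis using assms(2) by simp
qed

lemma weighted_lookup_le:
  assumes "g \<in> weighted j"
  shows "\<bar>Poly_Mapping.lookup g b\<bar> \<le> 1 / m j"
proof -
  obtain \<F> where F: "successive_family (k j) \<F>" "g = (1 / real (m j)) *\<^sub>R (\<Sum>\<F>)"
    using assms by (auto simp: weighted_def)
  have "\<bar>\<Sum>f\<in>\<F>. Poly_Mapping.lookup f b\<bar> \<le> (\<Sum>f\<in>\<F>. \<bar>Poly_Mapping.lookup f b\<bar>)" by (rule sum_abs)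
  also have "\<dots> \<le> 1"
    by (rule disjoint_family_lookup_le[OF successive_family_disjoint[OF F(1)] _
          norming_set_bound[OF successive_familyD(3)[OF F(1)]]]) simp_all
  finally have "\<bar>\<Sum>f\<in>\<F>. Poly_Mapping.lookup f b\<bar> / m j \<le> 1 / m j" by (rule divide_right_mono) simp
  then show ?thesis by (simp add: F(2) lookup_sum abs_mult)
qed

lemma weighted_sum_le:
  assumes "disjoint_family \<B>" "1 \<le> i" "\<And>g. g \<in> \<B> \<Longrightarrow> \<exists>i'\<ge>i. g \<in> weighted i'"
  shows "(\<Sum>g\<in>\<B>. \<bar>pairing g x\<bar>) \<le> (\<Sum>b\<in>supp x. \<bar>Poly_Mapping.lookup x b\<bar>) / m i"
proof -
  have m0: "2 \<le> m i" using m_ge_2[OF assms(2)] .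
  have lookup: "\<bar>Poly_Mapping.lookup g b\<bar> \<le> 1 / m i" if g: "g \<in> \<B>" for g b
  proof -
    obtain i' where i': "i \<le> i'" "g \<in> weighted i'" using assms(3)[OF g] by blast
    have "\<bar>Poly_Mapping.lookup g b\<bar> \<le> 1 / m i'" using weighted_lookup_le i'(2) .
    also have "\<dots> \<le> 1 / m i" using m0 m_mono[OF assms(2) i'(1)] by (intro divide_left_mono) auto
    finally show ?thesis .
  qed
  have "(\<Sum>g\<in>\<B>. \<bar>pairing g x\<bar>) \<le> (\<Sum>g\<in>\<B>. \<Sum>b\<in>supp x. \<bar>Poly_Mapping.lookup g b\<bar> * \<bar>Poly_Mapping.lookup x b\<bar>)"
    by (intro sum_mono) (simp add: pairing_eq[OF finite_keys order_refl] abs_mult[symmetric])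
  also have "\<dots> = (\<Sum>b\<in>supp x. (\<Sum>g\<in>\<B>. \<bar>Poly_Mapping.lookup g b\<bar>) * \<bar>Poly_Mapping.lookup x b\<bar>)"
    by (subst sum.swap) (simp add: sum_distrib_right)
  also have "\<dots> \<le> (\<Sum>b\<in>supp x. 1 / m i * \<bar>Poly_Mapping.lookup x b\<bar>)"
    by (intro sum_mono mult_right_mono disjoint_family_lookup_le[OF assms(1)] lookup) auto
  also have "\<dots> = (\<Sum>b\<in>supp x. \<bar>Poly_Mapping.lookup x b\<bar>) / m i"
    by (simp add: sum_divide_distrib)
  finally show ?thesis .
qed

definition ris_step :: "(nat \<Rightarrow>\<^sub>0 real) set \<Rightarrow> nat \<Rightarrow> nat \<Rightarrow> nat \<Rightarrow> nat \<Rightarrow> (nat \<Rightarrow>\<^sub>0 real) \<Rightarrow> nat \<Rightarrow> nat \<Rightarrow> bool" where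
  "ris_step S j s p i x p' i' \<longleftrightarrow> x \<in> S \<and> 1 / 2 \<le> nrm x \<and> nrm x \<le> 1 \<and> supp x \<subseteq> {p<..p'} \<and>
     (\<forall>b\<in>supp x. p ^ s \<le> b) \<and> p < p' \<and> i < i' \<and>
     (\<forall>\<B>. disjoint_family \<B> \<longrightarrow> card \<B> \<le> p ^ s \<longrightarrow> (\<forall>g\<in>\<B>. \<exists>i''. j \<le> i'' \<and> i'' < i \<and> g \<in> weighted i'') \<longrightarrow>
        (\<Sum>g\<in>\<B>. \<bar>pairing g x\<bar>) \<le> 4 / m j) \<and>
     (\<forall>\<B>. disjoint_family \<B> \<longrightarrow> (\<forall>g\<in>\<B>. \<exists>i''\<ge>i'. g \<in> weighted i'') \<longrightarrow>
        (\<Sum>g\<in>\<B>. \<bar>pairing g x\<bar>) \<le> 1 / m j)"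

lemma ris_step_exists:
  assumes rich: "rich S" and j: "2 \<le> j"
  shows "\<exists>x p' i'. ris_step S j s p i x p' i'"
proof -
  have m0: "2 \<le> m j" using m_ge_2 j by simp
  define N where "N = max p (p ^ s)"
  obtain x where avg: "average_vector S N (Suc (k i)) (1 / m j) x" and half: "1 / 2 \<le> nrm x"
    using average_vector_exists[OF rich, of "1 / m j"] m0 by auto
  note x = average_vectorD[OF avg rich]
  define L where "L = (\<Sum>b\<in>supp x. \<bar>Poly_Mapping.lookup x b\<bar>)"
  have L0: "0 \<le> L" by (simp add: L_def sum_nonneg)
  define i' where "i' = max (Suc i) (nat \<lceil>m j * L\<rceil> + 1)"
  have i': "1 \<le> i'" "i < i'" by (simp_all add: i'_def)
  have "m j * L \<le> i'" using L0 by (simp add: i'_def) linarith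
  also have "\<dots> \<le> m i'" using m_gt[OF i'(1)] by simp
  finally have Li: "m j * L \<le> m i'" .
  have "x \<noteq> 0" using half nrm_sum[of "\<lambda>_. x" "{}"] by auto
  then have max_in: "Max (supp x) \<in> supp x" by (intro Max_in) auto
  have "ris_step S j s p i x (Max (supp x)) i'"
    unfolding ris_step_def
  proof (intro conjI allI impI ballI)
    show "x \<in> S" "nrm x \<le> 1" "1 / 2 \<le> nrm x" "i < i'" using x half i' by auto
    show "supp x \<subseteq> {p<..Max (supp x)}" using x(3) by (auto simp: N_def)
    show "p < Max (supp x)" using x(3) max_in by (auto simp: N_def)
    show "p ^ s \<le> b" if "b \<in> supp x" for b using subsetD[OF x(3) that] by (simp add: N_def)
  next
    fix \<B> assume B: "disjoint_family \<B>" "card \<B> \<le> p ^ s" "\<forall>g\<in>\<B>. \<exists>i''. j \<le> i'' \<and> i'' < i \<and> g \<in> weighted i''"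
    have "(\<Sum>g\<in>\<B>. \<bar>pairing g x\<bar>) \<le> 2 / m j + 2 * (1 / m j)"
    proof (rule average_vector_weighted_le[OF avg B(1) _ j])
      show "card \<B> \<le> N" using B(2) by (simp add: N_def)
      fix g assume "g \<in> \<B>"
      then obtain i'' where i'': "j \<le> i''" "i'' < i" "g \<in> weighted i''" using B(3) by blast
      then have "k i'' < Suc (k i)" using k_mono[of i'' i] j by simp
      then show "\<exists>i''\<ge>j. k i'' < Suc (k i) \<and> g \<in> weighted i''" using i'' by blast
    qed
    then show "(\<Sum>g\<in>\<B>. \<bar>pairing g x\<bar>) \<le> 4 / m j" by simp
  next
    fix \<B> assume B: "disjoint_family \<B>" "\<forall>g\<in>\<B>. \<exists>i''\<ge>i'. g \<in> weighted i''"
    have "(\<Sum>g\<in>\<B>. \<bar>pairing g x\<bar>) \<le> L / m i'"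
      unfolding L_def using B(2) by (intro weighted_sum_le[OF B(1) i'(1)]) blast
    also have "L / m i' \<le> 1 / m j"
      using Li m0 m_ge_2[OF i'(1)] by (simp add: field_simps)
    finally show "(\<Sum>g\<in>\<B>. \<bar>pairing g x\<bar>) \<le> 1 / m j" .
  qed
  then show ?thesis by blast
qed

definition ris :: "(nat \<Rightarrow>\<^sub>0 real) set \<Rightarrow> nat \<Rightarrow> nat \<Rightarrow> (nat \<Rightarrow> nat) \<Rightarrow> (nat \<Rightarrow> nat) \<Rightarrow> (nat \<Rightarrow> nat \<Rightarrow>\<^sub>0 real) \<Rightarrow> bool" where
  "ris S j s P i x \<longleftrightarrow> 1 \<le> P 0 \<and> (\<forall>l. ris_step S j s (P l) (i l) (x l) (P (Suc l)) (i (Suc l)))"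

lemma ris_exists:
  assumes "rich S" "2 \<le> j"
  obtains P i x where "ris S j s P i x"
proof -
  obtain xx pp ii where step: "\<And>p i. ris_step S j s p i (xx p i) (pp p i) (ii p i)"
    using ris_step_exists[OF assms, of s] by metis
  define st where "st l = ((\<lambda>(p, i). (pp p i, ii p i)) ^^ l) (1::nat, 1::nat)" for l
  have "ris S j s (\<lambda>l. fst (st l)) (\<lambda>l. snd (st l)) (\<lambda>l. xx (fst (st l)) (snd (st l)))"
    unfolding ris_def using step by (simp add: st_def case_prod_unfold)
  then show ?thesis by (rule that)
qed

lemma K_cases:
  assumes "f \<in> K"
  obtains (single) n where "1 \<le> n" "supp f = {n}"
  | (combined) i \<F> where "1 \<le> i" "disjoint_family \<F>" "\<F> \<noteq> {}" "(\<lambda>f. Min (supp f)) ` \<F> \<in> schreier (k i)"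
      "f = (1 / real (m i)) *\<^sub>R (\<Sum>\<F>)" "2 \<le> i \<Longrightarrow> f \<in> weighted i"
proof -
  have "(\<exists>n\<ge>1. supp f = {n}) \<or> (\<exists>i \<F>. 1 \<le> i \<and> disjoint_family \<F> \<and> \<F> \<noteq> {} \<and>
      (\<lambda>f. Min (supp f)) ` \<F> \<in> schreier (k i) \<and> f = (1 / real (m i)) *\<^sub>R (\<Sum>\<F>) \<and> (2 \<le> i \<longrightarrow> f \<in> weighted i))"
    using assms
  proof (induction rule: K_induct)
    case (allowable \<F>)
    note F = disjoint_familyD[OF allowable.hyps(1)]
    have "card ((\<lambda>f. Min (supp f)) ` \<F>) \<le> Min (supp f)" if "f \<in> \<F>" for f
      using card_image_le[OF F(1), of "\<lambda>f. Min (supp f)"]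
        allowable.hyps(3)[OF that Min_supp_in[OF F(2)[OF that]]] by linarith
    then have "(\<lambda>f. Min (supp f)) ` \<F> \<in> schreier (k 1)"
      using F(1) k1 by (simp add: schreier_1_iff)
    moreover have "(1/2) *\<^sub>R (\<Sum>\<F>) = (1 / real (m 1)) *\<^sub>R (\<Sum>\<F>)" using m1 by simp
    ultimately show ?case using allowable.hyps(1,2)
      by (intro disjI2 exI[of _ "1::nat"] exI[of _ \<F>]) simp
  next
    case (admissible j \<F>)
    then show ?case
      using successive_familyD(2,4)[OF admissible.hyps(2)] successive_family_disjoint[OF admissible.hyps(2)]
      by (intro disjI2 exI[of _ j] exI[of _ \<F>]) (auto simp: weighted_def)
  qed auto
  then show ?thesis using single combined by blast
qed

lemma disjoint_family_subset: "disjoint_family \<F> \<Longrightarrow> \<G> \<subseteq> \<F> \<Longrightarrow> disjoint_family \<G>"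
  unfolding disjoint_family_def by (meson finite_subset subset_iff)

lemma disjoint_family_UN:
  assumes I: "disjoint_family I" and A: "\<And>h. h \<in> I \<Longrightarrow> disjoint_family (A h)"
    and sub: "\<And>h g. h \<in> I \<Longrightarrow> g \<in> A h \<Longrightarrow> supp g \<subseteq> supp h"
  shows "disjoint_family (\<Union>h\<in>I. A h)" "(\<Sum>g\<in>(\<Union>h\<in>I. A h). \<phi> g) = (\<Sum>h\<in>I. \<Sum>g\<in>A h. \<phi> g)"
proof -
  have disj: "supp g \<inter> supp g' = {}" if "h \<in> I" "h' \<in> I" "h \<noteq> h'" "g \<in> A h" "g' \<in> A h'" for h h' g g'
    using sub[OF that(1,4)] sub[OF that(2,5)] disjoint_familyD(3)[OF I that(1,2,3)] by blast
  show "disjoint_family (\<Union>h\<in>I. A h)"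
    unfolding disjoint_family_def
  proof (intro conjI ballI impI)
    show "finite (\<Union>h\<in>I. A h)" using disjoint_familyD(1) I A by blast
    show "(\<Union>h\<in>I. A h) \<subseteq> K" using disjoint_familyD(2)[OF A] by blast
    fix g g' assume "g \<in> (\<Union>h\<in>I. A h)" "g' \<in> (\<Union>h\<in>I. A h)" "g \<noteq> g'"
    then obtain h h' where "h \<in> I" "g \<in> A h" "h' \<in> I" "g' \<in> A h'" by blast
    then show "supp g \<inter> supp g' = {}"
      using disj[of h h' g g'] disjoint_familyD(3)[OF A, of h g g'] \<open>g \<noteq> g'\<close> by (cases "h = h'") auto
  qed
  have "A h \<inter> A h' = {}" if "h \<in> I" "h' \<in> I" "h \<noteq> h'" for h h'
  proof (rule ccontr)
    assume "A h \<inter> A h' \<noteq> {}"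
    then obtain g where g: "g \<in> A h" "g \<in> A h'" by blast
    then have "supp g = {}" using disj[OF that g] by simp
    then show False using K_supp[OF disjoint_familyD(2)[OF A[OF that(1)] g(1)]] by simp
  qed
  then show "(\<Sum>g\<in>(\<Union>h\<in>I. A h). \<phi> g) = (\<Sum>h\<in>I. \<Sum>g\<in>A h. \<phi> g)"
    using disjoint_familyD(1)[OF I] disjoint_familyD(1)[OF A] by (intro sum.UNION_disjoint) auto
qed

text \<open>\<open>controlled\<close> describes the part of the tree of \<open>f\<close> that acts on \<open>y\<close>, cut at depth \<open>r\<close> and
  at the nodes of weight \<open>m n\<close> with \<open>n > j\<close>: \<open>\<A>\<close> are the nodes reached at depth \<open>r\<close>, \<open>\<B>\<close> the heavy ones.
  The indices \<open>n\<close> in \<open>{i..<i'}\<close> are those for which no estimate on \<open>y\<close> is available.\<close>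

definition controlled :: "nat \<Rightarrow> nat \<Rightarrow> nat \<Rightarrow> nat \<Rightarrow> nat \<Rightarrow> (nat \<Rightarrow>\<^sub>0 real) \<Rightarrow> (nat \<Rightarrow>\<^sub>0 real) \<Rightarrow> bool" where
  "controlled j p r i i' y f \<longleftrightarrow> (\<exists>\<A> \<B>. disjoint_family \<A> \<and> disjoint_family \<B> \<and>
     card \<A> \<le> p ^ r \<and> card \<B> \<le> p ^ r \<and> (\<forall>g\<in>\<A>. supp g \<subseteq> supp f) \<and> (\<forall>g\<in>\<B>. supp g \<subseteq> supp f) \<and>
     (\<forall>g\<in>\<B>. \<exists>n. g \<in> weighted n \<and> (j \<le> n \<and> n < i \<or> i' \<le> n)) \<and>
     \<bar>pairing f y\<bar> \<le> (1/2) ^ r * (\<Sum>g\<in>\<A>. \<bar>pairing g y\<bar>) + (\<Sum>g\<in>\<B>. \<bar>pairing g y\<bar>))"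

lemma controlled_zero: "pairing f y = 0 \<Longrightarrow> controlled j p r i i' y f"
  unfolding controlled_def by (rule exI[of _ "{}"], rule exI[of _ "{}"]) (simp add: disjoint_family_def)

lemma controlled_combine:
  assumes fam: "disjoint_family \<F>" and c: "0 \<le> c" "c \<le> 1/2" and f: "f = c *\<^sub>R (\<Sum>\<F>)"
    and ctrl: "\<And>h. h \<in> \<F> \<Longrightarrow> controlled j p r i i' y h"
    and far: "\<And>h. h \<in> \<F> \<Longrightarrow> p < Min (supp h) \<Longrightarrow> pairing h y = 0"
    and supp_f: "\<And>h. h \<in> \<F> \<Longrightarrow> supp h \<subseteq> supp f"
  shows "controlled j p (Suc r) i i' y f"
proof -
  define I where "I = {h \<in> \<F>. Min (supp h) \<le> p}"
  have I: "disjoint_family I" "I \<subseteq> \<F>" using disjoint_family_subset[OF fam, of I] by (auto simp: I_def)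
  have inj: "inj_on (\<lambda>h. Min (supp h)) I" using disjoint_family_Min_inj[OF I(1)] .
  have "(\<lambda>h. Min (supp h)) ` I \<subseteq> {1..p}"
  proof
    fix b assume "b \<in> (\<lambda>h. Min (supp h)) ` I"
    then obtain h where h: "b = Min (supp h)" "h \<in> I" by blast
    have "h \<in> K" using disjoint_familyD(2)[OF I(1) h(2)] .
    then have "1 \<le> b" using subsetD[OF conjunct2[OF K_supp] Min_supp_in] h(1) by simp
    then show "b \<in> {1..p}" using h by (simp add: I_def)
  qed
  then have cardI: "card I \<le> p" using card_inj_on_le[OF inj, of "{1..p}"] by simp
  obtain A B where AB: "\<And>h. h \<in> \<F> \<Longrightarrow> disjoint_family (A h) \<and> disjoint_family (B h) \<and>
     card (A h) \<le> p ^ r \<and> card (B h) \<le> p ^ r \<and> (\<forall>g\<in>A h. supp g \<subseteq> supp h) \<and> (\<forall>g\<in>B h. supp g \<subseteq> supp h) \<and>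
     (\<forall>g\<in>B h. \<exists>n. g \<in> weighted n \<and> (j \<le> n \<and> n < i \<or> i' \<le> n)) \<and>
     \<bar>pairing h y\<bar> \<le> (1/2) ^ r * (\<Sum>g\<in>A h. \<bar>pairing g y\<bar>) + (\<Sum>g\<in>B h. \<bar>pairing g y\<bar>)"
    using ctrl unfolding controlled_def by metis
  have A: "disjoint_family (A h)" "card (A h) \<le> p ^ r" "g \<in> A h \<Longrightarrow> supp g \<subseteq> supp h"
    and B: "disjoint_family (B h)" "card (B h) \<le> p ^ r" "g \<in> B h \<Longrightarrow> supp g \<subseteq> supp h"
    and Bw: "\<forall>g\<in>B h. \<exists>n. g \<in> weighted n \<and> (j \<le> n \<and> n < i \<or> i' \<le> n)"
    and bound: "\<bar>pairing h y\<bar> \<le> (1/2) ^ r * (\<Sum>g\<in>A h. \<bar>pairing g y\<bar>) + (\<Sum>g\<in>B h. \<bar>pairing g y\<bar>)"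
    if "h \<in> I" for h g
    using AB[OF subsetD[OF I(2) that]] by blast+
  have card_UN: "card (\<Union>h\<in>I. C h) \<le> p ^ Suc r" if "\<And>h. h \<in> I \<Longrightarrow> card (C h) \<le> p ^ r"
    for C :: "_ \<Rightarrow> (nat \<Rightarrow>\<^sub>0 real) set"
  proof -
    have "card (\<Union>h\<in>I. C h) \<le> (\<Sum>h\<in>I. card (C h))" by (rule card_UN_le[OF disjoint_familyD(1)[OF I(1)]])
    also have "\<dots> \<le> (\<Sum>h\<in>I. p ^ r)" by (intro sum_mono that)
    also have "\<dots> \<le> p * p ^ r" using cardI by simp
    finally show ?thesis by simp
  qed
  have "\<bar>pairing f y\<bar> = c * \<bar>\<Sum>h\<in>\<F>. pairing h y\<bar>"
    using c(1) by (simp add: f pairing_scaleR_left pairing_sum_left abs_mult)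
  also have "(\<Sum>h\<in>\<F>. pairing h y) = (\<Sum>h\<in>I. pairing h y)"
  proof (rule sum.mono_neutral_right[OF disjoint_familyD(1)[OF fam] I(2)])
    show "\<forall>h\<in>\<F> - I. pairing h y = 0" using far by (auto simp: I_def not_le)
  qed
  also have "c * \<bar>\<Sum>h\<in>I. pairing h y\<bar> \<le> (1/2) * (\<Sum>h\<in>I. \<bar>pairing h y\<bar>)"
    using c by (intro mult_mono sum_abs) auto
  also have "\<dots> \<le> (1/2) * (\<Sum>h\<in>I. (1/2) ^ r * (\<Sum>g\<in>A h. \<bar>pairing g y\<bar>) + (\<Sum>g\<in>B h. \<bar>pairing g y\<bar>))"
    by (intro mult_left_mono sum_mono bound) auto
  also have "\<dots> = (1/2) ^ Suc r * (\<Sum>h\<in>I. \<Sum>g\<in>A h. \<bar>pairing g y\<bar>) + (1/2) * (\<Sum>h\<in>I. \<Sum>g\<in>B h. \<bar>pairing g y\<bar>)"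
    by (simp add: sum.distrib sum_distrib_left algebra_simps)
  also have "\<dots> = (1/2) ^ Suc r * (\<Sum>g\<in>(\<Union>h\<in>I. A h). \<bar>pairing g y\<bar>) + (1/2) * (\<Sum>g\<in>(\<Union>h\<in>I. B h). \<bar>pairing g y\<bar>)"
    using disjoint_family_UN(2)[OF I(1), of A "\<lambda>g. \<bar>pairing g y\<bar>"] A
      disjoint_family_UN(2)[OF I(1), of B "\<lambda>g. \<bar>pairing g y\<bar>"] B by simp
  also have "\<dots> \<le> (1/2) ^ Suc r * (\<Sum>g\<in>(\<Union>h\<in>I. A h). \<bar>pairing g y\<bar>) + (\<Sum>g\<in>(\<Union>h\<in>I. B h). \<bar>pairing g y\<bar>)"
    by (simp add: sum_nonneg)
  finally have main: "\<bar>pairing f y\<bar> \<le> (1/2) ^ Suc r * (\<Sum>g\<in>(\<Union>h\<in>I. A h). \<bar>pairing g y\<bar>) +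
      (\<Sum>g\<in>(\<Union>h\<in>I. B h). \<bar>pairing g y\<bar>)" .
  show ?thesis
    unfolding controlled_def
  proof (rule exI[of _ "\<Union>h\<in>I. A h"], rule exI[of _ "\<Union>h\<in>I. B h"], intro conjI)
    show "disjoint_family (\<Union>h\<in>I. A h)" using disjoint_family_UN(1)[OF I(1) A(1,3)] .
    show "disjoint_family (\<Union>h\<in>I. B h)" using disjoint_family_UN(1)[OF I(1) B(1,3)] .
    show "\<forall>g\<in>\<Union>h\<in>I. A h. supp g \<subseteq> supp f" using A(3) supp_f I(2) by blast
    show "\<forall>g\<in>\<Union>h\<in>I. B h. supp g \<subseteq> supp f" using B(3) supp_f I(2) by blast
    show "\<forall>g\<in>\<Union>h\<in>I. B h. \<exists>n. g \<in> weighted n \<and> (j \<le> n \<and> n < i \<or> i' \<le> n)" using Bw by blast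
  qed (rule card_UN A(2) B(2) main; assumption?)+
qed

context
  fixes S j s P i x
  assumes ris: "ris S j s P i x" and j: "2 \<le> j"
begin

lemma ris_P: "strict_mono P"
  using ris unfolding strict_mono_Suc_iff ris_def ris_step_def by blast

lemma ris_i: "strict_mono i"
  using ris unfolding strict_mono_Suc_iff ris_def ris_step_def by blast

lemma ris_x: "x l \<in> S" "1 / 2 \<le> nrm (x l)" "nrm (x l) \<le> 1" "supp (x l) \<subseteq> zone P l"
  "b \<in> supp (x l) \<Longrightarrow> P l ^ s \<le> b"
  using ris unfolding ris_def ris_step_def zone_def by blast+

lemma ris_P_pos: "1 \<le> P l"
  using ris strict_mono_less_eq[OF ris_P, of 0 l] by (simp add: ris_def)

lemma ris_controlled:
  "f \<in> K \<Longrightarrow> \<exists>G\<in>loose (r * k j). Min (supp f) \<in> G \<and> G \<subseteq> {Min (supp f)..} \<and>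
     (\<forall>l. zone P l \<inter> G = {} \<longrightarrow> controlled j (P l) r (i l) (i (Suc l)) (x l) f)"
proof (induction r arbitrary: f)
  case 0
  have "{Min (supp f)} \<in> loose (0 * k j)" using Min_supp_in[OF 0] K_supp[OF 0] by auto
  moreover have "controlled j (P l) 0 (i l) (i (Suc l)) (x l) f" for l
    unfolding controlled_def
    by (rule exI[of _ "{f}"], rule exI[of _ "{}"]) (use 0 in \<open>simp add: disjoint_family_def\<close>)
  ultimately show ?case by (intro bexI[of _ "{Min (supp f)}"]) auto
next
  case (Suc r)
  have small_loose: "G \<in> loose (Suc r * k j)" if "finite G" "card G \<le> 2" "G \<subseteq> {1..}" for G
    using loose_mono[of 0 "Suc r * k j"] that by auto
  from Suc.prems show ?case
  proof (cases rule: K_cases)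
    case (single n)
    have "controlled j (P l) (Suc r) (i l) (i (Suc l)) (x l) f" if "zone P l \<inter> {n} = {}" for l
      using single(2) ris_x(4)[of l] that by (intro controlled_zero pairing_disjoint) blast
    then show ?thesis using single by (intro bexI[of _ "{n}"] small_loose) auto
  next
    case (combined n \<F>)
    note F = disjoint_familyD[OF combined(2)]
    have m0: "2 \<le> m n" using m_ge_2[OF combined(1)] .
    have f0: "1 \<le> Min (supp f)" using Min_supp_in[OF Suc.prems] K_supp[OF Suc.prems] by auto
    show ?thesis
    proof (cases "j < n")
      case True
      have fw: "f \<in> weighted n" using combined(6) True j by simp
      define G where "G = insert (Min (supp f)) {b. Min (supp f) \<le> b \<and> (\<exists>l. b = P (Suc l) \<and> i l \<le> n \<and> n < i (Suc l))}"
      have unique: "l = l'" if "i l \<le> n" "n < i (Suc l)" "i l' \<le> n" "n < i (Suc l')" for l l'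
      proof (rule ccontr)
        assume "l \<noteq> l'"
        then consider "Suc l \<le> l'" | "Suc l' \<le> l" by linarith
        then show False
          by cases (use that strict_mono_less_eq[OF ris_i, of "Suc l" l'] strict_mono_less_eq[OF ris_i, of "Suc l'" l] in auto)
      qed
      have "\<exists>b. G \<subseteq> {Min (supp f), b}"
      proof (cases "\<exists>l. i l \<le> n \<and> n < i (Suc l)")
        case True
        then obtain l where l: "i l \<le> n" "n < i (Suc l)" by blast
        have "G \<subseteq> {Min (supp f), P (Suc l)}" using unique[OF l] by (auto simp: G_def)
        then show ?thesis ..
      qed (auto simp: G_def)
      then obtain b where b: "G \<subseteq> {Min (supp f), b}" ..
      have "finite G" using b by (rule finite_subset) simp
      moreover have "card G \<le> 2"
        using card_mono[OF _ b] card_insert_le_m1[of 2 "{b}" "Min (supp f)"] by fastforce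
      moreover have Gf: "G \<subseteq> {Min (supp f)..}" by (auto simp: G_def)
      moreover have "G \<subseteq> {1..}" using Gf f0 by auto
      ultimately have "G \<in> loose (Suc r * k j)" by (intro small_loose)
      moreover have "controlled j (P l) (Suc r) (i l) (i (Suc l)) (x l) f" if l: "zone P l \<inter> G = {}" for l
      proof (cases "i l \<le> n \<and> n < i (Suc l)")
        case True
        have "P (Suc l) \<in> zone P l" using strict_mono_less[OF ris_P, of l "Suc l"] by (simp add: zone_def)
        then have "P (Suc l) \<notin> G" using l by blast
        then have "P (Suc l) < Min (supp f)" using True by (auto simp: G_def)
        then have "supp f \<inter> supp (x l) = {}"
          using ris_x(4)[of l] Min_supp_le[of _ f] by (fastforce simp: zone_def)
        then show ?thesis by (intro controlled_zero pairing_disjoint)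
      next
        case False
        have "1 \<le> P l ^ Suc r" using ris_P_pos[of l] by (rule one_le_power)
        then show ?thesis
          unfolding controlled_def
          by (intro exI[of _ "{}"] exI[of _ "{f}"])
            (use False True fw Suc.prems in \<open>auto simp: disjoint_family_def not_less intro!: exI[of _ n]\<close>)
      qed
      ultimately show ?thesis using Gf by (intro bexI[of _ G]) (auto simp: G_def)
    next
      case False
      obtain G where G: "\<And>h. h \<in> \<F> \<Longrightarrow> G h \<in> loose (r * k j) \<and> Min (supp h) \<in> G h \<and> G h \<subseteq> {Min (supp h)..} \<and>
         (\<forall>l. zone P l \<inter> G h = {} \<longrightarrow> controlled j (P l) r (i l) (i (Suc l)) (x l) h)"
        using Suc.IH F(2) by metis
      define GG where "GG = (\<Union>h\<in>\<F>. G h)"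
      have "GG \<in> loose (k n + r * k j)"
        unfolding GG_def using G
        by (intro loose_compose[OF combined(4) disjoint_family_Min_inj[OF combined(2)]]) auto
      moreover have "k n + r * k j \<le> Suc r * k j" using k_mono[OF combined(1)] False by simp
      ultimately have GGl: "GG \<in> loose (Suc r * k j)" using loose_mono by blast
      have supp_f: "supp f = (\<Union>h\<in>\<F>. supp h)"
        using supp_Sum[OF combined(2)] m0 by (simp add: combined(5) supp_scaleR)
      then have Min_le: "Min (supp f) \<le> Min (supp h)" if "h \<in> \<F>" for h
        using that Min_supp_in[OF F(2)[OF that]] by (intro Min_supp_le) blast
      have "GG \<subseteq> {Min (supp f)..}"
      proof
        fix b assume "b \<in> GG"
        then obtain h where "h \<in> \<F>" "b \<in> G h" by (auto simp: GG_def)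
        then show "b \<in> {Min (supp f)..}" using G[of h] Min_le[of h] by fastforce
      qed
      moreover have "Min (supp f) \<in> GG"
      proof -
        obtain h where h: "h \<in> \<F>" "Min (supp f) \<in> supp h" using Min_supp_in[OF Suc.prems] supp_f by blast
        have "Min (supp h) = Min (supp f)" using Min_le[OF h(1)] Min_supp_le[OF h(2)] by simp
        then show ?thesis using G[OF h(1)] h(1) by (auto simp: GG_def)
      qed
      moreover have "controlled j (P l) (Suc r) (i l) (i (Suc l)) (x l) f" if l: "zone P l \<inter> GG = {}" for l
      proof (rule controlled_combine[OF combined(2) _ _ combined(5)])
        show "(1 / real (m n)) \<le> 1 / 2" using m0 by (simp add: field_simps)
        fix h assume h: "h \<in> \<F>"
        have lh: "zone P l \<inter> G h = {}" using l h by (auto simp: GG_def)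
        then show "controlled j (P l) r (i l) (i (Suc l)) (x l) h" using G[OF h] by blast
        show "supp h \<subseteq> supp f" using supp_f h by blast
        assume "P l < Min (supp h)"
        moreover have "Min (supp h) \<notin> zone P l" using lh G[OF h] by blast
        ultimately have "P (Suc l) < Min (supp h)" by (simp add: zone_def)
        then have "supp h \<inter> supp (x l) = {}"
          using ris_x(4)[of l] Min_supp_le[of _ h] by (fastforce simp: zone_def)
        then show "pairing h (x l) = 0" by (rule pairing_disjoint)
      qed simp
      ultimately show ?thesis using GGl by blast
    qed
  qed
qed

lemma ris_functional_le:
  assumes "f \<in> K"
  obtains G where "G \<in> loose (s * k j)"
    "\<And>l. zone P l \<inter> G = {} \<Longrightarrow> \<bar>pairing f (x l)\<bar> \<le> 2 * (1/2) ^ s + 5 / m j"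
proof -
  obtain G where G: "G \<in> loose (s * k j)"
    "\<And>l. zone P l \<inter> G = {} \<Longrightarrow> controlled j (P l) s (i l) (i (Suc l)) (x l) f"
    using ris_controlled[OF assms, of s] by blast
  have "\<bar>pairing f (x l)\<bar> \<le> 2 * (1/2) ^ s + 5 / m j" if l: "zone P l \<inter> G = {}" for l
  proof -
    obtain \<A> \<B> where A: "disjoint_family \<A>" "card \<A> \<le> P l ^ s"
      and B: "disjoint_family \<B>" "card \<B> \<le> P l ^ s"
        "\<forall>g\<in>\<B>. \<exists>n. g \<in> weighted n \<and> (j \<le> n \<and> n < i l \<or> i (Suc l) \<le> n)"
      and bound: "\<bar>pairing f (x l)\<bar> \<le> (1/2) ^ s * (\<Sum>g\<in>\<A>. \<bar>pairing g (x l)\<bar>) + (\<Sum>g\<in>\<B>. \<bar>pairing g (x l)\<bar>)"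
      using G(2)[OF l] unfolding controlled_def by blast
    have "(\<Sum>g\<in>\<A>. \<bar>pairing g (x l)\<bar>) \<le> 2 * nrm (x l)"
      using A(2) ris_x(5)[of _ l] by (intro disjoint_family_sum_le[OF A(1)]) (meson order_trans)
    also have "\<dots> \<le> 2" using ris_x(3)[of l] by simp
    finally have Ab: "(1/2) ^ s * (\<Sum>g\<in>\<A>. \<bar>pairing g (x l)\<bar>) \<le> (1/2) ^ s * 2" by (rule mult_left_mono) simp
    define \<B>1 where "\<B>1 = {g \<in> \<B>. \<exists>n. j \<le> n \<and> n < i l \<and> g \<in> weighted n}"
    have B1: "disjoint_family \<B>1" "disjoint_family (\<B> - \<B>1)" "\<B>1 \<subseteq> \<B>"
      using disjoint_family_subset[OF B(1)] by (auto simp: \<B>1_def)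
    have "card \<B>1 \<le> P l ^ s"
      using card_mono[OF disjoint_familyD(1)[OF B(1)] B1(3)] B(2) by linarith
    then have 1: "(\<Sum>g\<in>\<B>1. \<bar>pairing g (x l)\<bar>) \<le> 4 / m j"
      using ris B1(1) unfolding ris_def ris_step_def \<B>1_def by blast
    have "\<forall>g\<in>\<B> - \<B>1. \<exists>n\<ge>i (Suc l). g \<in> weighted n" using B(3) by (auto simp: \<B>1_def)
    then have 2: "(\<Sum>g\<in>\<B> - \<B>1. \<bar>pairing g (x l)\<bar>) \<le> 1 / m j"
      using ris B1(2) unfolding ris_def ris_step_def by blast
    have "(\<Sum>g\<in>\<B>. \<bar>pairing g (x l)\<bar>) = (\<Sum>g\<in>\<B> - \<B>1. \<bar>pairing g (x l)\<bar>) + (\<Sum>g\<in>\<B>1. \<bar>pairing g (x l)\<bar>)"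
      by (rule sum.subset_diff[OF B1(3) disjoint_familyD(1)[OF B(1)]])
    moreover have "4 / m j + 1 / m j = 5 / real (m j)" by (simp add: add_divide_distrib[symmetric])
    ultimately show ?thesis using bound Ab 1 2 by linarith
  qed
  then show ?thesis using that G(1) by blast
qed

lemma ris_average_le:
  assumes avg: "average P (s * k j) \<epsilon> F a"
  shows "nrm (\<Sum>l\<in>F. a l *\<^sub>R x l) \<le> 2 * (1/2) ^ s + 5 / m j + \<epsilon>"
proof (rule nrm_le)
  fix f assume f: "f \<in> K"
  have conv: "finite F" "\<And>l. 0 \<le> a l" "sum a F = 1"
    using avg by (auto simp: average_def convex_on_set_def)
  obtain G where G: "G \<in> loose (s * k j)"
    "\<And>l. zone P l \<inter> G = {} \<Longrightarrow> \<bar>pairing f (x l)\<bar> \<le> 2 * (1/2) ^ s + 5 / m j"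
    using ris_functional_le[OF f] by metis
  define d where "d = 2 * (1/2) ^ s + 5 / m j"
  have d0: "0 \<le> d" by (simp add: d_def)
  have bound: "a l * pairing f (x l) \<le> a l * d + (if zone P l \<inter> G \<noteq> {} then a l else 0)" for l
  proof (cases "zone P l \<inter> G = {}")
    case True
    then have "pairing f (x l) \<le> d" using G(2)[OF True] by (simp add: d_def)
    then show ?thesis using True mult_left_mono[OF _ conv(2)[of l]] by simp
  next
    case False
    have "pairing f (x l) \<le> 1" using pairing_le_nrm[OF f, of "x l"] ris_x(3)[of l] by linarith
    then have "a l * pairing f (x l) \<le> a l" using mult_left_mono[OF _ conv(2)[of l], of _ 1] by simp
    moreover have "0 \<le> a l * d" using d0 conv(2) by simp
    ultimately show ?thesis using False by simp
  qed
  have "pairing f (\<Sum>l\<in>F. a l *\<^sub>R x l) = (\<Sum>l\<in>F. a l * pairing f (x l))"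
    by (simp add: pairing_sum_right pairing_scaleR)
  also have "\<dots> \<le> (\<Sum>l\<in>F. a l * d + (if zone P l \<inter> G \<noteq> {} then a l else 0))"
    by (rule sum_mono) (rule bound)
  also have "\<dots> = d + hit_mass P F a G"
    unfolding sum.distrib sum_distrib_right[symmetric] conv(3) hit_mass_def
      sum.inter_filter[OF conv(1)] by simp
  also have "hit_mass P F a G \<le> \<epsilon>" using avg G(1) by (simp add: average_def)
  finally show "pairing f (\<Sum>l\<in>F. a l *\<^sub>R x l) \<le> 2 * (1/2) ^ s + 5 / m j + \<epsilon>" by (simp add: d_def)
qed

end

section \<open>The distorting norms\<close>

definition wnorm :: "nat \<Rightarrow> (nat \<Rightarrow>\<^sub>0 real) \<Rightarrow> real" where
  "wnorm j x = m j * (SUP g\<in>weighted j. pairing g x)"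

lemma weighted_scaled: "f \<in> K \<Longrightarrow> (1 / real (m j)) *\<^sub>R f \<in> weighted j"
proof -
  assume f: "f \<in> K"
  have "successive_family (k j) {f}"
    using f Min_supp_in[OF f] K_supp[OF f] unfolding successive_family_def
    by (auto intro!: schreier_singleton)
  then show ?thesis unfolding weighted_def by (auto intro!: exI[of _ "{f}"])
qed

lemma weighted_nonempty: "weighted j \<noteq> {}"
  using weighted_scaled K_nonempty by blast

lemma m_real: "1 \<le> j \<Longrightarrow> 2 \<le> real (m j)"
  using m_ge_2[of j] by linarith

lemma wnorm_ge:
  assumes "2 \<le> j" "g \<in> weighted j"
  shows "m j * pairing g x \<le> wnorm j x"
  unfolding wnorm_def
  by (intro mult_left_mono cSUP_upper[OF assms(2)] bdd_above_pairing weighted_subset assms) simp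

lemma wnorm_le:
  assumes "2 \<le> j" "\<And>g. g \<in> weighted j \<Longrightarrow> m j * pairing g x \<le> c"
  shows "wnorm j x \<le> c"
proof -
  have m0: "0 < real (m j)" using m_real[of j] assms(1) by simp
  have "(SUP g\<in>weighted j. pairing g x) \<le> c / m j"
    using assms(2) m0 by (intro cSUP_least weighted_nonempty) (simp add: field_simps)
  then show ?thesis using m0 by (simp add: wnorm_def field_simps)
qed

lemma nrm_le_wnorm: "2 \<le> j \<Longrightarrow> nrm x \<le> wnorm j x"
proof (rule nrm_le)
  fix f assume j: "2 \<le> j" and "f \<in> K"
  then show "pairing f x \<le> wnorm j x"
    using wnorm_ge[OF j weighted_scaled, of f x] m_real[of j] by (simp add: pairing_scaleR_left)
qed

lemma wnorm_le_nrm: "2 \<le> j \<Longrightarrow> wnorm j x \<le> m j * nrm x"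
  using weighted_subset pairing_le_nrm by (intro wnorm_le mult_left_mono) auto

lemma wnorm_triangle: "2 \<le> j \<Longrightarrow> wnorm j (x + y) \<le> wnorm j x + wnorm j y"
  using wnorm_ge by (intro wnorm_le) (auto simp: pairing_add distrib_left intro: add_mono)

lemma weighted_uminus: "g \<in> weighted j \<Longrightarrow> - g \<in> weighted j"
proof -
  assume "g \<in> weighted j"
  then obtain \<F> where F: "successive_family (k j) \<F>" "g = (1 / real (m j)) *\<^sub>R (\<Sum>\<F>)"
    by (auto simp: weighted_def)
  note FD = successive_familyD[OF F(1)]
  have "successive_family (k j) (uminus ` \<F>)"
    unfolding successive_family_def
  proof (intro conjI ballI impI)
    show "finite (uminus ` \<F>)" "uminus ` \<F> \<noteq> {}" using FD(1,2) by auto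
    show "uminus ` \<F> \<subseteq> K" using FD(3) uminus_norming_set by blast
    show "(\<lambda>f. Min (supp f)) ` uminus ` \<F> \<in> schreier (k j)" using FD(4) by (simp add: image_image)
    show "before (supp f) (supp g) \<or> before (supp g) (supp f)"
      if "f \<in> uminus ` \<F>" "g \<in> uminus ` \<F>" "f \<noteq> g" for f g
      using that F(1) unfolding successive_family_def by force
  qed
  moreover have "- g = (1 / real (m j)) *\<^sub>R (\<Sum>(uminus ` \<F>))"
    by (simp add: F(2) sum.reindex sum_negf)
  ultimately show ?thesis unfolding weighted_def by blast
qed

lemma wnorm_scaleR_le: "2 \<le> j \<Longrightarrow> wnorm j (c *\<^sub>R x) \<le> \<bar>c\<bar> * wnorm j x"
proof (rule wnorm_le)
  fix g assume j: "2 \<le> j" and g: "g \<in> weighted j"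
  have "m j * pairing g x \<le> wnorm j x" "- (m j * pairing g x) \<le> wnorm j x"
    using wnorm_ge[OF j g, of x] wnorm_ge[OF j weighted_uminus[OF g], of x] by (simp_all add: pairing_uminus)
  then have "\<bar>c\<bar> * \<bar>m j * pairing g x\<bar> \<le> \<bar>c\<bar> * wnorm j x" by (intro mult_left_mono) auto
  moreover have "c * (m j * pairing g x) \<le> \<bar>c\<bar> * \<bar>m j * pairing g x\<bar>"
    using abs_ge_self[of "c * (m j * pairing g x)"] by (simp only: abs_mult)
  ultimately show "m j * pairing g (c *\<^sub>R x) \<le> \<bar>c\<bar> * wnorm j x"
    by (simp add: pairing_scaleR algebra_simps)
qed

lemma wnorm_ge_sum:
  assumes "2 \<le> j" "successive_family (k j) \<F>"
  shows "(\<Sum>f\<in>\<F>. pairing f x) \<le> wnorm j x"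
proof -
  have "(1 / real (m j)) *\<^sub>R (\<Sum>\<F>) \<in> weighted j" using assms(2) by (auto simp: weighted_def)
  from wnorm_ge[OF assms(1) this, of x] show ?thesis
    using m_real[of j] assms(1) by (simp add: pairing_scaleR_left pairing_sum_left)
qed

lemma small_wnorm_exists:
  assumes rich: "rich S" and j: "2 \<le> j"
  obtains z where "z \<in> S" "1 / 2 \<le> nrm z" "nrm z \<le> 1" "wnorm j z \<le> 3"
proof -
  have m0: "2 \<le> real (m j)" using m_real j by simp
  obtain z where avg: "average_vector S 1 (Suc (k j)) (1 / (2 * m j)) z" and half: "1 / 2 \<le> nrm z"
    using average_vector_exists[OF rich, of "1 / (2 * m j)" 1 "Suc (k j)"] m0 by auto
  note z = average_vectorD[OF avg rich]
  have "wnorm j z \<le> 3"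
  proof (rule wnorm_le[OF j])
    fix g assume g: "g \<in> weighted j"
    have "(\<Sum>g\<in>{g}. \<bar>pairing g z\<bar>) \<le> 2 / m j + 2 * (1 / (2 * m j))"
      using g weighted_subset[OF j]
      by (intro average_vector_weighted_le[OF avg _ _ j]) (auto simp: disjoint_family_def)
    moreover have "2 / m j + 2 * (1 / (2 * m j)) = 3 / real (m j)" using m0 by (simp add: field_simps)
    ultimately have "pairing g z \<le> 3 / m j" by simp
    then show "m j * pairing g z \<le> 3" using m0 by (simp add: field_simps)
  qed
  then show ?thesis using that z half by blast
qed

lemma large_wnorm_exists:
  assumes \<delta>: "0 < \<delta>"
  obtains j where "2 \<le> j"
    "\<And>S. rich S \<Longrightarrow> \<exists>y\<in>S. 0 < nrm y \<and> nrm y \<le> \<delta> \<and> 1 / 4 \<le> wnorm j y"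
proof -
  obtain s where s: "(1/2::real) ^ s < \<delta> / 6" using real_arch_pow_inv[of "\<delta> / 6" "1/2"] \<delta> by auto
  define j0 where "j0 = nat \<lceil>15 / \<delta>\<rceil> + 2"
  have j0: "2 \<le> j0" by (simp add: j0_def)
  have "15 / \<delta> \<le> j0" by (simp add: j0_def) linarith
  also have "\<dots> \<le> m j0" using m_gt[of j0] j0 by simp
  finally have "15 \<le> \<delta> * m j0" using \<delta> by (simp add: field_simps)
  then have 5: "5 / m j0 \<le> \<delta> / 3" using m_real[of j0] j0 by (simp add: field_simps)
  define j where "j = max 2 (Suc (s * k j0))"
  have j: "2 \<le> j" by (simp add: j_def)
  have "\<exists>y\<in>S. 0 < nrm y \<and> nrm y \<le> \<delta> \<and> 1 / 4 \<le> wnorm j y" if rich: "rich S" for S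
  proof -
    obtain P i x where ris: "ris S j0 s P i x" using ris_exists[OF rich j0] .
    note P = ris_P[OF ris j0] and x = ris_x[OF ris j0]
    have e: "0 < \<delta> / 3" using \<delta> by simp
    obtain F a where avg: "average P (s * k j0) (\<delta> / 3) F a" using average_exists[OF P e] .
    have conv: "finite F" "\<And>l. 0 \<le> a l" "sum a F = 1" and sel: "selects P (Suc (s * k j0)) F"
      using avg by (auto simp: average_def convex_on_set_def)
    define y where "y = (\<Sum>l\<in>F. a l *\<^sub>R x l)"
    have yS: "y \<in> S" unfolding y_def using rich x(1) by (intro subspace_sum subspace_scale) (auto simp: rich_def)
    have "nrm y \<le> 2 * (1/2) ^ s + 5 / m j0 + \<delta> / 3" unfolding y_def by (rule ris_average_le[OF ris j0 avg])
    then have upper: "nrm y \<le> \<delta>" using s 5 by linarith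
    have "\<exists>f\<in>K. 1 / 4 < pairing f (x l) \<and> supp f \<subseteq> supp (x l)" for l
      using nrm_norming_restr[of "1/4" "x l"] x(2)[of l] by fastforce
    then obtain f where f: "\<And>l. f l \<in> K" "\<And>l. 1 / 4 < pairing (f l) (x l)" "\<And>l. supp (f l) \<subseteq> supp (x l)"
      by metis
    have f_zone: "supp (f l) \<subseteq> zone P l" for l using f(3) x(4) by blast
    have Min_zone: "Min (supp (f l)) \<in> zone P l" for l using Min_supp_in[OF f(1)] f_zone by blast
    have inj: "inj_on f F" using Min_zone zone_inj[OF P] by (metis inj_onI)
    have "successive_family (k j) (f ` F)"
      unfolding successive_family_def
    proof (intro conjI ballI impI)
      show "finite (f ` F)" using conv(1) by simp
      show "f ` F \<noteq> {}" using conv(3) by auto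
      show "f ` F \<subseteq> K" using f(1) by blast
      have "(\<lambda>l. Min (supp (f l))) ` F \<in> schreier (Suc (s * k j0))"
        using sel Min_zone by (simp add: selects_def)
      moreover have "Suc (s * k j0) \<le> k j" using k_ge[of j] j by (simp add: j_def)
      ultimately show "(\<lambda>f. Min (supp f)) ` f ` F \<in> schreier (k j)"
        using schreier_mono unfolding image_image by blast
      fix g h assume "g \<in> f ` F" "h \<in> f ` F" "g \<noteq> h"
      then obtain l l' where l: "g = f l" "h = f l'" "l \<noteq> l'" by blast
      have "before (supp (f l)) (supp (f l'))" if "l < l'" for l l'
        unfolding before_iff[OF finite_keys finite_keys] using zone_less[OF P _ _ that] f_zone by blast
      then show "before (supp g) (supp h) \<or> before (supp h) (supp g)"
        using l by (metis linorder_neqE)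
    qed
    then have "(\<Sum>g\<in>f ` F. pairing g y) \<le> wnorm j y" by (rule wnorm_ge_sum[OF j])
    moreover have "(\<Sum>g\<in>f ` F. pairing g y) = (\<Sum>l\<in>F. a l * pairing (f l) (x l))"
    proof -
      have "pairing (f l) y = a l * pairing (f l) (x l)" if l: "l \<in> F" for l
      proof -
        have "(\<Sum>l'\<in>F. a l' * pairing (f l) (x l')) = (\<Sum>l'\<in>{l}. a l' * pairing (f l) (x l'))"
        proof (rule sum.mono_neutral_right[OF conv(1)])
          show "\<forall>l'\<in>F - {l}. a l' * pairing (f l) (x l') = 0"
          proof
            fix l' assume "l' \<in> F - {l}"
            then have "supp (f l) \<inter> supp (x l') = {}"
              using f_zone[of l] x(4)[of l'] zone_inj[OF P] by blast
            then show "a l' * pairing (f l) (x l') = 0" by (simp add: pairing_disjoint)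
          qed
        qed (use l in auto)
        then show ?thesis by (simp add: y_def pairing_sum_right pairing_scaleR)
      qed
      then show ?thesis by (simp add: sum.reindex[OF inj])
    qed
    moreover have "(\<Sum>l\<in>F. a l * (1 / 4)) \<le> (\<Sum>l\<in>F. a l * pairing (f l) (x l))"
      using f(2) conv(2) by (intro sum_mono mult_left_mono) (auto intro: less_imp_le)
    moreover have "(\<Sum>l\<in>F. a l * (1 / 4)) = 1 / 4"
      by (simp only: sum_distrib_right[symmetric] conv(3) mult_1_left)
    ultimately have lower: "1 / 4 \<le> wnorm j y" by linarith
    have "0 < nrm y"
    proof (rule ccontr)
      assume "\<not> 0 < nrm y"
      then have "m j * nrm y \<le> 0" by (simp add: mult_le_0_iff)
      then show False using wnorm_le_nrm[OF j, of y] lower by linarith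
    qed
    then show ?thesis using yS upper lower by blast
  qed
  then show ?thesis using that j by blast
qed

end

section \<open>Subspaces of the completion\<close>

lemma subspace_closure:
  fixes S :: "'a::real_normed_vector set"
  assumes "subspace S"
  shows "subspace (closure S)"
proof (rule subspaceI)
  show "0 \<in> closure S" using subspace_0[OF assms] closure_subset by blast
  fix x y assume "x \<in> closure S" "y \<in> closure S"
  then obtain u v where "\<And>n. u n \<in> S" "u \<longlonglongrightarrow> x" "\<And>n. v n \<in> S" "v \<longlonglongrightarrow> y"
    unfolding closure_sequential by metis
  then have "\<And>n. u n + v n \<in> S" "(\<lambda>n. u n + v n) \<longlonglongrightarrow> x + y"
    by (auto intro: tendsto_add subspace_add[OF assms])
  then show "x + y \<in> closure S" unfolding closure_sequential by (intro exI conjI allI)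
next
  fix c x assume "x \<in> closure S"
  then obtain u where "\<And>n. u n \<in> S" "u \<longlonglongrightarrow> x" unfolding closure_sequential by metis
  then have "\<And>n. c *\<^sub>R u n \<in> S" "(\<lambda>n. c *\<^sub>R u n) \<longlonglongrightarrow> c *\<^sub>R x"
    by (auto intro: tendsto_scaleR subspace_scale[OF assms])
  then show "c *\<^sub>R x \<in> closure S" unfolding closure_sequential by (intro exI conjI allI)
qed

lemma infinite_dimensional_codim_one:
  assumes V: "subspace V" "infinite_dimensional V" and W: "subspace W"
    and e: "\<And>v. v \<in> V \<Longrightarrow> \<exists>c. v - c *\<^sub>R e \<in> W"
  shows "infinite_dimensional (V \<inter> W)"
  unfolding infinite_dimensional_def
proof
  assume "\<exists>B. finite B \<and> V \<inter> W \<subseteq> span B"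
  then obtain B where B: "finite B" "V \<inter> W \<subseteq> span B" by blast
  obtain c where c: "\<And>v. v \<in> V \<Longrightarrow> v - c v *\<^sub>R e \<in> W" using e by metis
  have "\<exists>B. finite B \<and> V \<subseteq> span B"
  proof (cases "\<exists>v\<in>V. c v \<noteq> 0")
    case False
    then have "V \<subseteq> V \<inter> W" using c by fastforce
    then show ?thesis using B by blast
  next
    case True
    then obtain v0 where v0: "v0 \<in> V" "c v0 \<noteq> 0" by blast
    have "v \<in> span (insert v0 B)" if v: "v \<in> V" for v
    proof -
      define w where "w = v - (c v / c v0) *\<^sub>R v0"
      have "w \<in> V" unfolding w_def using V(1) v v0(1) by (simp add: subspace_diff subspace_scale)
      moreover have "w = (v - c v *\<^sub>R e) - (c v / c v0) *\<^sub>R (v0 - c v0 *\<^sub>R e)"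
        using v0(2) by (simp add: w_def scaleR_diff_right)
      then have "w \<in> W" using c[OF v] c[OF v0(1)] W by (simp add: subspace_diff subspace_scale)
      ultimately have "w \<in> span (insert v0 B)" using B(2) span_mono[of B "insert v0 B"] by blast
      moreover have "v = w + (c v / c v0) *\<^sub>R v0" by (simp add: w_def)
      ultimately show ?thesis by (metis span_add span_scale span_base insertI1)
    qed
    then show ?thesis using B(1) by (intro exI[of _ "insert v0 B"]) auto
  qed
  then show False using V(2) by (simp add: infinite_dimensional_def)
qed

locale mixed_tsirelson_completion = mixed_tsirelson +
  fixes J :: "(nat \<Rightarrow>\<^sub>0 real) \<Rightarrow> 'a::banach" and X :: "'a set"
  assumes completion: "is_completion (mixed_norm m k) J X"
begin

lemma J_add: "x \<in> c00 \<Longrightarrow> y \<in> c00 \<Longrightarrow> J (x + y) = J x + J y"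
  and J_scaleR: "x \<in> c00 \<Longrightarrow> J (c *\<^sub>R x) = c *\<^sub>R J x"
  and norm_J: "x \<in> c00 \<Longrightarrow> norm (J x) = nrm x"
  and X_eq: "X = closure (J ` c00)"
  using completion by (auto simp: is_completion_def)

lemma zero_c00: "0 \<in> c00"
  by (rule subspace_0[OF subspace_c00])

lemma J_0: "J 0 = 0"
  using J_scaleR[OF zero_c00, of 0] by simp

lemma J_diff: "x \<in> c00 \<Longrightarrow> y \<in> c00 \<Longrightarrow> J (x - y) = J x - J y"
  using J_add[of x "(-1) *\<^sub>R y"] J_scaleR[of y "-1"] subspace_scale[OF subspace_c00, of y "-1"] by simp

lemma J_sum: "(\<And>i. i \<in> I \<Longrightarrow> x i \<in> c00) \<Longrightarrow> J (\<Sum>i\<in>I. x i) = (\<Sum>i\<in>I. J (x i))"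
proof (induction I rule: infinite_finite_induct)
  case (insert i I)
  then show ?case by (simp add: J_add subspace_sum[OF subspace_c00])
qed (simp_all add: J_0)

text \<open>The infimal convolution agrees with \<open>wnorm j\<close> on \<open>c00\<close> because \<open>m j\<close> is a Lipschitz constant of it.\<close>

definition ext_norm :: "nat \<Rightarrow> 'a \<Rightarrow> real" where
  "ext_norm j x = (INF u\<in>c00. wnorm j u + m j * norm (x - J u))"

context
  fixes j :: nat
  assumes j: "2 \<le> j"
begin

lemma norm_le_ext_aux: "u \<in> c00 \<Longrightarrow> norm x \<le> wnorm j u + m j * norm (x - J u)"
proof -
  assume u: "u \<in> c00"
  have "norm x \<le> norm (J u) + norm (x - J u)" using norm_triangle_ineq[of "J u" "x - J u"] by simp
  moreover have "norm (J u) \<le> wnorm j u" using norm_J[OF u] nrm_le_wnorm[OF j] by simp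
  moreover have "1 * norm (x - J u) \<le> m j * norm (x - J u)"
    using m_real[of j] j by (intro mult_right_mono) auto
  ultimately show ?thesis by linarith
qed

lemma ext_norm_le: "u \<in> c00 \<Longrightarrow> ext_norm j x \<le> wnorm j u + m j * norm (x - J u)"
  unfolding ext_norm_def by (rule cINF_lower) (auto intro!: bdd_belowI2[of _ "norm x"] norm_le_ext_aux)

lemma ext_norm_ge: "(\<And>u. u \<in> c00 \<Longrightarrow> c \<le> wnorm j u + m j * norm (x - J u)) \<Longrightarrow> c \<le> ext_norm j x"
  unfolding ext_norm_def using zero_c00 by (intro cINF_greatest) auto

lemma norm_le_ext_norm: "norm x \<le> ext_norm j x"
  by (intro ext_norm_ge norm_le_ext_aux)

lemma ext_norm_le_norm: "ext_norm j x \<le> m j * norm x"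
proof -
  have "wnorm j 0 \<le> 0" using wnorm_scaleR_le[OF j, of 0 0] by simp
  then show ?thesis using ext_norm_le[OF zero_c00, of x] by (simp add: J_0)
qed

lemma ext_norm_J: 
  assumes "u \<in> c00"
  shows "ext_norm j (J u) = wnorm j u"
proof (rule antisym)
  show "ext_norm j (J u) \<le> wnorm j u" using ext_norm_le[OF assms, of "J u"] by simp
  show "wnorm j u \<le> ext_norm j (J u)"
  proof (rule ext_norm_ge)
    fix v assume v: "v \<in> c00"
    have "wnorm j u \<le> wnorm j v + wnorm j (u - v)" using wnorm_triangle[OF j, of v "u - v"] by simp
    also have "wnorm j (u - v) \<le> m j * nrm (u - v)" by (rule wnorm_le_nrm[OF j])
    also have "nrm (u - v) = norm (J u - J v)"
      using norm_J[of "u - v"] J_diff[OF assms v] subspace_diff[OF subspace_c00 assms v] by simp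
    finally show "wnorm j u \<le> wnorm j v + m j * norm (J u - J v)" by simp
  qed
qed

lemma ext_norm_scaleR_le: "c \<noteq> 0 \<Longrightarrow> ext_norm j (c *\<^sub>R x) \<le> \<bar>c\<bar> * ext_norm j x"
proof -
  assume c: "c \<noteq> 0"
  have "ext_norm j (c *\<^sub>R x) / \<bar>c\<bar> \<le> ext_norm j x"
  proof (rule ext_norm_ge)
    fix u assume u: "u \<in> c00"
    have "ext_norm j (c *\<^sub>R x) \<le> wnorm j (c *\<^sub>R u) + m j * norm (c *\<^sub>R x - J (c *\<^sub>R u))"
      by (rule ext_norm_le[OF subspace_scale[OF subspace_c00 u]])
    also have "norm (c *\<^sub>R x - J (c *\<^sub>R u)) = \<bar>c\<bar> * norm (x - J u)"
      using J_scaleR[OF u, of c] by (simp add: scaleR_diff_right[symmetric])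
    also have "wnorm j (c *\<^sub>R u) \<le> \<bar>c\<bar> * wnorm j u" by (rule wnorm_scaleR_le[OF j])
    finally have "ext_norm j (c *\<^sub>R x) \<le> \<bar>c\<bar> * (wnorm j u + m j * norm (x - J u))"
      by (simp add: algebra_simps)
    then show "ext_norm j (c *\<^sub>R x) / \<bar>c\<bar> \<le> wnorm j u + m j * norm (x - J u)"
      using c by (simp add: field_simps)
  qed
  then show ?thesis using c by (simp add: field_simps)
qed

lemma ext_norm_scaleR: "ext_norm j (c *\<^sub>R x) = \<bar>c\<bar> * ext_norm j x"
proof (cases "c = 0")
  case True
  then show ?thesis using norm_le_ext_norm[of "0::'a"] ext_norm_le_norm[of "0::'a"] by simp
next
  case False
  have "ext_norm j x \<le> \<bar>inverse c\<bar> * ext_norm j (c *\<^sub>R x)"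
    using ext_norm_scaleR_le[of "inverse c" "c *\<^sub>R x"] False by simp
  then have "\<bar>c\<bar> * ext_norm j x \<le> ext_norm j (c *\<^sub>R x)" using False by (simp add: field_simps)
  then show ?thesis using ext_norm_scaleR_le[OF False, of x] by simp
qed

lemma ext_norm_triangle: "ext_norm j (x + y) \<le> ext_norm j x + ext_norm j y"
proof -
  have "ext_norm j (x + y) - ext_norm j x \<le> ext_norm j y"
  proof (rule ext_norm_ge)
    fix v assume v: "v \<in> c00"
    have "ext_norm j (x + y) - (wnorm j v + m j * norm (y - J v)) \<le> ext_norm j x"
    proof (rule ext_norm_ge)
      fix u assume u: "u \<in> c00"
      have "ext_norm j (x + y) \<le> wnorm j (u + v) + m j * norm (x + y - J (u + v))"
        by (rule ext_norm_le[OF subspace_add[OF subspace_c00 u v]])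
      also have "wnorm j (u + v) \<le> wnorm j u + wnorm j v" by (rule wnorm_triangle[OF j])
      also have "m j * norm (x + y - J (u + v)) \<le> m j * (norm (x - J u) + norm (y - J v))"
        using norm_triangle_ineq[of "x - J u" "y - J v"] J_add[OF u v]
        by (intro mult_left_mono) (simp_all add: algebra_simps)
      finally show "ext_norm j (x + y) - (wnorm j v + m j * norm (y - J v)) \<le> wnorm j u + m j * norm (x - J u)"
        by (simp add: algebra_simps)
    qed
    then show "ext_norm j (x + y) - ext_norm j x \<le> wnorm j v + m j * norm (y - J v)" by simp
  qed
  then show ?thesis by simp
qed

lemma ext_norm_close: "ext_norm j x \<le> ext_norm j y + m j * norm (x - y)"
  using ext_norm_triangle[of y "x - y"] ext_norm_le_norm[of "x - y"] by simp

lemma ext_norm_equivalent: "equivalent_norm_on X (ext_norm j)"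
  unfolding equivalent_norm_on_def
proof (intro conjI ballI allI)
  fix x
  show "ext_norm j x = 0 \<longleftrightarrow> x = 0"
    using norm_le_ext_norm[of x] ext_norm_scaleR[of 0 x] by auto
next
  show "\<exists>c>0. \<exists>C>0. \<forall>x\<in>X. c * norm x \<le> ext_norm j x \<and> ext_norm j x \<le> C * norm x"
    using norm_le_ext_norm ext_norm_le_norm m_real[of j] j
    by (intro exI[of _ "1::real"] conjI exI[of _ "real (m j)"]) auto
qed (rule ext_norm_scaleR ext_norm_triangle)+

end

definition tail :: "nat \<Rightarrow> 'a set" where
  "tail N = closure (J ` {u. supp u \<subseteq> {N<..}})"

lemma tail_c00: "supp u \<subseteq> {N<..} \<Longrightarrow> u \<in> c00"
  by (auto simp: c00_def)

lemma subspace_tail: "subspace (tail N)"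
  unfolding tail_def
proof (rule subspace_closure)
  show "subspace (J ` {u. supp u \<subseteq> {N<..}})"
  proof (rule subspaceI)
    show "0 \<in> J ` {u. supp u \<subseteq> {N<..}}" using J_0 by (auto intro!: image_eqI[of _ _ 0])
    fix x y assume "x \<in> J ` {u. supp u \<subseteq> {N<..}}" "y \<in> J ` {u. supp u \<subseteq> {N<..}}"
    then obtain u v where uv: "x = J u" "y = J v" "supp u \<subseteq> {N<..}" "supp v \<subseteq> {N<..}" by blast
    then have "supp (u + v) \<subseteq> {N<..}" using keys_add[of u v] by blast
    moreover have "x + y = J (u + v)" using uv J_add tail_c00 by simp
    ultimately show "x + y \<in> J ` {u. supp u \<subseteq> {N<..}}" by blast
  next
    fix c x assume "x \<in> J ` {u. supp u \<subseteq> {N<..}}"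
    then obtain u where u: "x = J u" "supp u \<subseteq> {N<..}" by blast
    then have "supp (c *\<^sub>R u) \<subseteq> {N<..}" by (simp add: supp_scaleR)
    moreover have "c *\<^sub>R x = J (c *\<^sub>R u)" using u J_scaleR tail_c00 by simp
    ultimately show "c *\<^sub>R x \<in> J ` {u. supp u \<subseteq> {N<..}}" by blast
  qed
qed

lemma tail_remove_coordinate:
  assumes "x \<in> tail N"
  shows "\<exists>c. x - c *\<^sub>R J (Poly_Mapping.single (Suc N) 1) \<in> tail (Suc N)"
proof -
  define e where "e = Poly_Mapping.single (Suc N) (1::real)"
  have e: "e \<in> c00" by (simp add: e_def c00_def)
  obtain w where w: "\<And>n. w n \<in> J ` {u. supp u \<subseteq> {N<..}}" "w \<longlonglongrightarrow> x"
    using assms unfolding tail_def closure_sequential by blast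
  have "\<exists>u. w n = J u \<and> supp u \<subseteq> {N<..}" for n using w(1)[of n] by blast
  then obtain u where u: "\<And>n. w n = J (u n)" "\<And>n. supp (u n) \<subseteq> {N<..}" by metis
  have uc: "u n \<in> c00" for n using tail_c00[OF u(2)] .
  define c where "c n = Poly_Mapping.lookup (u n) (Suc N)" for n
  have "dist (c n) (c n') \<le> dist (w n) (w n')" for n n'
    using lookup_le_nrm[of "Suc N" "u n - u n'"] norm_J[OF subspace_diff[OF subspace_c00 uc uc], of n n']
      J_diff[OF uc uc, of n n'] u(1) by (simp add: c_def dist_norm lookup_minus)
  then have "Cauchy c"
    using LIMSEQ_imp_Cauchy[OF w(2)] unfolding Cauchy_def by (meson le_less_trans)
  then obtain c' where c': "c \<longlonglongrightarrow> c'" using Cauchy_convergent convergent_def by blast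
  have lim: "(\<lambda>n. w n - c n *\<^sub>R J e) \<longlonglongrightarrow> x - c' *\<^sub>R J e"
    by (intro tendsto_diff tendsto_scaleR w(2) c' tendsto_const)
  have "w n - c n *\<^sub>R J e \<in> J ` {u. supp u \<subseteq> {Suc N<..}}" for n
  proof (rule image_eqI)
    show "w n - c n *\<^sub>R J e = J (u n - c n *\<^sub>R e)"
      using J_diff[OF uc subspace_scale[OF subspace_c00 e]] J_scaleR[OF e] u(1) by simp
    have "Poly_Mapping.lookup (u n - c n *\<^sub>R e) b = 0" if "b \<le> Suc N" for b
    proof (cases "b = Suc N")
      case False
      then have "b \<notin> supp (u n)" using that u(2)[of n] by auto
      then show ?thesis using False by (simp add: lookup_minus e_def lookup_single in_keys_iff)
    qed (simp add: lookup_minus e_def lookup_single c_def)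
    then show "u n - c n *\<^sub>R e \<in> {u. supp u \<subseteq> {Suc N<..}}"
      by (auto simp: in_keys_iff not_le[symmetric])
  qed
  then have "x - c' *\<^sub>R J e \<in> tail (Suc N)"
    unfolding tail_def closure_sequential using lim by (intro exI conjI allI)
  then show ?thesis unfolding e_def by blast
qed

lemma infinite_dimensional_tail:
  assumes Y: "subspace Y" "Y \<subseteq> X" "infinite_dimensional Y"
  shows "infinite_dimensional (Y \<inter> tail N)"
proof (induction N)
  case 0
  have "c00 = {u. supp u \<subseteq> {0<..}}" by (auto simp: c00_def)
  then have "Y \<inter> tail 0 = Y" using Y(2) X_eq by (auto simp: tail_def)
  then show ?case using Y(3) by simp
next
  case (Suc N)
  have *: "tail (Suc N) \<subseteq> tail N"
    unfolding tail_def by (intro closure_mono image_mono) auto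
  have "infinite_dimensional (Y \<inter> tail N \<inter> tail (Suc N))"
  proof (rule infinite_dimensional_codim_one[OF _ Suc subspace_tail])
    show "subspace (Y \<inter> tail N)" by (rule subspace_inter[OF Y(1) subspace_tail])
    show "\<exists>c. v - c *\<^sub>R J (Poly_Mapping.single (Suc N) 1) \<in> tail (Suc N)" if "v \<in> Y \<inter> tail N" for v
      using tail_remove_coordinate that by blast
  qed
  moreover have "Y \<inter> tail N \<inter> tail (Suc N) = Y \<inter> tail (Suc N)" using * by blast
  ultimately show ?case by simp
qed

lemma near_vector_exists:
  assumes Y: "subspace Y" "Y \<subseteq> X" "infinite_dimensional Y" and \<eta>: "0 < \<eta>"
  shows "\<exists>w y. supp w \<subseteq> {N<..} \<and> nrm w = 1 \<and> y \<in> Y \<and> norm (J w - y) \<le> \<eta>"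
proof -
  have "\<exists>y\<in>Y \<inter> tail N. y \<noteq> 0"
  proof (rule ccontr)
    assume "\<not> ?thesis"
    then have "Y \<inter> tail N \<subseteq> span {}" by auto
    then show False using infinite_dimensional_tail[OF Y, of N] unfolding infinite_dimensional_def by blast
  qed
  then obtain v where v: "v \<in> Y" "v \<in> tail N" "v \<noteq> 0" by blast
  define y where "y = (1 / norm v) *\<^sub>R v"
  have y: "y \<in> Y" "y \<in> tail N" "norm y = 1"
    unfolding y_def using v Y(1) subspace_tail by (auto simp: subspace_scale)
  define \<delta> where "\<delta> = min (1/2) (\<eta> / 2)"
  have \<delta>: "0 < \<delta>" "\<delta> \<le> 1/2" "2 * \<delta> \<le> \<eta>" using \<eta> by (auto simp: \<delta>_def)
  obtain u where u: "supp u \<subseteq> {N<..}" "dist (J u) y < \<delta>"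
    using y(2) \<delta>(1) unfolding tail_def closure_approachable by blast
  have uc: "u \<in> c00" using tail_c00[OF u(1)] .
  have near: "norm (J u - y) < \<delta>" using u(2) by (simp add: dist_norm)
  have "norm y \<le> norm (J u) + norm (J u - y)" using norm_triangle_ineq4[of "J u" "J u - y"] by simp
  then have big: "1 / 2 \<le> nrm u" using near \<delta> y(3) norm_J[OF uc] by linarith
  define w where "w = (1 / nrm u) *\<^sub>R u"
  have "supp w \<subseteq> {N<..}" using u(1) by (simp add: w_def supp_scaleR)
  moreover have "nrm w = 1" using big by (simp add: w_def nrm_scaleR)
  moreover have "(1 / nrm u) *\<^sub>R y \<in> Y" using y(1) Y(1) by (simp add: subspace_scale)
  moreover have "norm (J w - (1 / nrm u) *\<^sub>R y) \<le> \<eta>"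
  proof -
    have "J w - (1 / nrm u) *\<^sub>R y = (1 / nrm u) *\<^sub>R (J u - y)"
      using J_scaleR[OF uc] by (simp add: w_def scaleR_diff_right)
    then have "norm (J w - (1 / nrm u) *\<^sub>R y) = norm (J u - y) / nrm u" using big by simp
    also have "\<dots> \<le> \<delta> / (1 / 2)" using near big \<delta> by (intro frac_le) auto
    finally show ?thesis using \<delta> by simp
  qed
  ultimately show ?thesis by blast
qed

lemma coefficient_le:
  assumes w: "\<And>a. a \<in> T \<Longrightarrow> nrm a = 1" and T: "finite T"
    and disj: "\<And>a b. a \<in> T \<Longrightarrow> b \<in> T \<Longrightarrow> a \<noteq> b \<Longrightarrow> supp a \<inter> supp b = {}" and b: "b \<in> T"
  shows "\<bar>r b\<bar> \<le> 2 * nrm (\<Sum>a\<in>T. r a *\<^sub>R a)"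
proof -
  obtain f where f: "f \<in> K" "1 / 2 < pairing f b" "supp f \<subseteq> supp b"
    using nrm_norming_restr[of "1/2" b] w[OF b] by auto
  have "(\<Sum>a\<in>T. r a * pairing f a) = (\<Sum>a\<in>{b}. r a * pairing f a)"
  proof (rule sum.mono_neutral_right[OF T])
    show "\<forall>a\<in>T - {b}. r a * pairing f a = 0"
    proof
      fix a assume "a \<in> T - {b}"
      then have "supp f \<inter> supp a = {}" using disj[of b a] b f(3) by blast
      then show "r a * pairing f a = 0" by (simp add: pairing_disjoint)
    qed
  qed (use b in auto)
  then have "\<bar>r b * pairing f b\<bar> \<le> nrm (\<Sum>a\<in>T. r a *\<^sub>R a)"
    using abs_pairing_le_nrm[OF f(1), of "\<Sum>a\<in>T. r a *\<^sub>R a"] by (simp add: pairing_sum_right pairing_scaleR)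
  moreover have "\<bar>r b\<bar> * (1 / 2) \<le> \<bar>r b\<bar> * pairing f b" using f(2) by (intro mult_left_mono) auto
  ultimately show ?thesis using f(2) by (simp add: abs_mult)
qed

lemma near_rich_subspace:
  assumes Y: "subspace Y" "Y \<subseteq> X" "infinite_dimensional Y" and \<theta>: "0 < \<theta>"
  obtains S where "rich S" "\<And>u. u \<in> S \<Longrightarrow> \<exists>y\<in>Y. norm (J u - y) \<le> \<theta> * nrm u"
proof -
  have "\<forall>N l. \<exists>w y. supp w \<subseteq> {N<..} \<and> nrm w = 1 \<and> y \<in> Y \<and> norm (J w - y) \<le> \<theta> / 4 * (1/2) ^ l"
    by (intro allI near_vector_exists[OF Y]) (use \<theta> in simp)
  then obtain ww yy where wy: "\<And>N l. supp (ww N l) \<subseteq> {N<..} \<and> nrm (ww N l) = 1 \<and> yy N l \<in> Y \<and>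
      norm (J (ww N l) - yy N l) \<le> \<theta> / 4 * (1/2) ^ l"
    by metis
  define P where "P = rec_nat 0 (\<lambda>l p. Max (supp (ww p l)))"
  define w where "w l = ww (P l) l" for l
  define y where "y l = yy (P l) l" for l
  have PSuc: "P (Suc l) = Max (supp (w l))" for l by (simp add: P_def w_def)
  have w: "supp (w l) \<subseteq> {P l<..}" "nrm (w l) = 1" "y l \<in> Y" "norm (J (w l) - y l) \<le> \<theta> / 4 * (1/2) ^ l" for l
    using wy[of "P l" l] by (auto simp: w_def y_def)
  have w0: "w l \<noteq> 0" for l using w(2)[of l] nrm_scaleR[of 0 "w l"] by auto
  have "P l < P (Suc l)" for l
  proof -
    have "Max (supp (w l)) \<in> supp (w l)" using w0[of l] by (intro Max_in) auto
    then show ?thesis using w(1)[of l] by (auto simp: PSuc)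
  qed
  then have P: "strict_mono P" by (simp add: strict_mono_Suc_iff)
  have wz: "supp (w l) \<subseteq> zone P l" for l using w(1)[of l] by (auto simp: zone_def PSuc)
  have wc: "w l \<in> c00" for l using tail_c00[OF w(1)] .
  have disj: "supp (w l) \<inter> supp (w l') = {}" if "w l \<noteq> w l'" for l l'
    using wz[of l] wz[of l'] zone_inj[OF P] that by blast
  define S where "S = span (range w)"
  have "rich S"
    unfolding rich_def
  proof (intro conjI allI)
    show "subspace S" by (simp add: S_def)
    show "S \<subseteq> c00" unfolding S_def by (rule span_minimal[OF _ subspace_c00]) (use wc in auto)
    fix N
    have "supp (w N) \<subseteq> {N<..}" using w(1)[of N] strict_mono_imp_increasing[OF P, of N] by auto
    then show "\<exists>u\<in>S. u \<noteq> 0 \<and> supp u \<subseteq> {N<..}" using w0[of N] unfolding S_def by (meson rangeI span_base)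
  qed
  moreover have "\<exists>y\<in>Y. norm (J u - y) \<le> \<theta> * nrm u" if uS: "u \<in> S" for u
  proof -
    obtain T r where T: "finite T" "T \<subseteq> range w" and u: "u = (\<Sum>a\<in>T. r a *\<^sub>R a)"
      using uS unfolding S_def span_explicit by blast
    have "\<forall>a\<in>T. \<exists>l. a = w l" using T(2) by blast
    then obtain g where g: "\<And>a. a \<in> T \<Longrightarrow> a = w (g a)" by metis
    have Tdisj: "supp a \<inter> supp b = {}" if "a \<in> T" "b \<in> T" "a \<noteq> b" for a b
      using disj[of "g a" "g b"] g[OF that(1), symmetric] g[OF that(2), symmetric] that(3) by simp
    have Tnrm: "nrm a = 1" if "a \<in> T" for a using w(2) g[OF that] by metis
    have inj: "inj_on g T"
    proof (rule inj_onI)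
      fix a b assume ab: "a \<in> T" "b \<in> T" "g a = g b"
      show "a = b" using trans[OF g[OF ab(1)]] g[OF ab(2)] ab(3) by simp
    qed
    define v where "v = (\<Sum>a\<in>T. r a *\<^sub>R y (g a))"
    have vY: "v \<in> Y" unfolding v_def by (intro subspace_sum[OF Y(1)] subspace_scale[OF Y(1)] w(3))
    have Tc: "a \<in> c00" if "a \<in> T" for a using wc g[OF that] by metis
    have "J u = (\<Sum>a\<in>T. J (r a *\<^sub>R a))"
      unfolding u using Tc by (intro J_sum subspace_scale[OF subspace_c00])
    also have "\<dots> = (\<Sum>a\<in>T. r a *\<^sub>R J a)" by (intro sum.cong refl J_scaleR Tc)
    finally have "J u - v = (\<Sum>a\<in>T. r a *\<^sub>R (J a - y (g a)))"
      by (simp add: v_def sum_subtractf scaleR_diff_right)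
    then have "norm (J u - v) \<le> (\<Sum>a\<in>T. norm (r a *\<^sub>R (J a - y (g a))))"
      by (simp only: norm_sum)
    also have "\<dots> \<le> (\<Sum>a\<in>T. (\<theta> / 2 * nrm u) * (1/2) ^ g a)"
    proof (rule sum_mono)
      fix a assume a: "a \<in> T"
      have "norm (J a - y (g a)) \<le> \<theta> / 4 * (1/2) ^ g a" using w(4)[of "g a"] g[OF a] by simp
      moreover have "\<bar>r a\<bar> \<le> 2 * nrm u" unfolding u by (rule coefficient_le[OF Tnrm T(1) Tdisj a])
      ultimately have "\<bar>r a\<bar> * norm (J a - y (g a)) \<le> (2 * nrm u) * (\<theta> / 4 * (1/2) ^ g a)"
        using nrm_nonneg by (intro mult_mono) auto
      then show "norm (r a *\<^sub>R (J a - y (g a))) \<le> (\<theta> / 2 * nrm u) * (1/2) ^ g a" by simp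
    qed
    also have "\<dots> = (\<theta> / 2 * nrm u) * (\<Sum>l\<in>g ` T. (1/2) ^ l)"
      by (simp add: sum_distrib_left sum.reindex[OF inj])
    also have "\<dots> \<le> (\<theta> / 2 * nrm u) * 2"
    proof (rule mult_left_mono)
      have "(\<Sum>l\<in>g ` T. (1/2::real) ^ l) \<le> suminf (\<lambda>l. (1/2) ^ l)"
        using T(1) by (intro sum_le_suminf summable_geometric) auto
      then show "(\<Sum>l\<in>g ` T. (1/2::real) ^ l) \<le> 2" by (simp add: suminf_geometric)
    qed (use \<theta> nrm_nonneg in simp)
    finally show ?thesis using vY by (intro bexI[of _ v]) auto
  qed
  ultimately show ?thesis using that by blast
qed

lemma distortable_X:
  assumes lam: "1 < lam"
  shows "distortable lam X"
proof -
  obtain j where j: "2 \<le> j"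
    and large: "\<And>S. rich S \<Longrightarrow> \<exists>y\<in>S. 0 < nrm y \<and> nrm y \<le> 1 / (400 * lam) \<and> 1 / 4 \<le> wnorm j y"
    using large_wnorm_exists[of "1 / (400 * lam)"] lam by auto
  have m0: "2 \<le> real (m j)" using m_real j by simp
  note p_ge = norm_le_ext_norm[OF j] and p_le = ext_norm_le_norm[OF j] and p_close = ext_norm_close[OF j]
    and p_scale = ext_norm_scaleR[OF j] and p_J = ext_norm_J[OF j]
  have "lam \<le> Sup {ext_norm j y / ext_norm j z | y z. y \<in> Y \<and> z \<in> Y \<and> norm y = 1 \<and> norm z = 1}"
    (is "_ \<le> Sup ?A") if Y: "subspace Y" "Y \<subseteq> X" "infinite_dimensional Y" for Y
  proof -
    define \<theta> where "\<theta> = 1 / (2 * m j)"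
    have \<theta>: "0 < \<theta>" "\<theta> \<le> 1 / 4" "m j * \<theta> = 1 / 2" using m0 by (auto simp: \<theta>_def field_simps)
    obtain S where S: "rich S" and near: "\<And>u. u \<in> S \<Longrightarrow> \<exists>y\<in>Y. norm (J u - y) \<le> \<theta> * nrm u"
      using near_rich_subspace[OF Y \<theta>(1)] by blast
    have Sc: "u \<in> c00" if "u \<in> S" for u using S that by (auto simp: rich_def)
    have normalize: "(1 / norm v) *\<^sub>R v \<in> Y" "norm ((1 / norm v) *\<^sub>R v) = 1"
      "ext_norm j ((1 / norm v) *\<^sub>R v) = ext_norm j v / norm v" if "v \<in> Y" "0 < norm v" for v
      using that Y(1) p_scale by (auto simp: subspace_scale)
    obtain y0 where y0: "y0 \<in> S" "0 < nrm y0" "nrm y0 \<le> 1 / (400 * lam)" "1 / 4 \<le> wnorm j y0"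
      using large[OF S] by blast
    define y where "y = (1 / nrm y0) *\<^sub>R y0"
    have y: "y \<in> S" "nrm y = 1" using y0 S by (auto simp: y_def rich_def subspace_scale nrm_scaleR)
    have "wnorm j y0 \<le> nrm y0 * wnorm j y"
      using wnorm_scaleR_le[OF j, of "nrm y0" y] y0(2) by (simp add: y_def)
    then have "1 / 4 \<le> nrm y0 * wnorm j y" using y0(4) by linarith
    also have "\<dots> \<le> 1 / (400 * lam) * wnorm j y"
      using y0(3) nrm_le_wnorm[OF j, of y] y(2) by (intro mult_right_mono) auto
    finally have wy: "100 * lam \<le> wnorm j y" using lam by (simp add: field_simps)
    obtain y' where y': "y' \<in> Y" "norm (J y - y') \<le> \<theta>" using near[OF y(1)] y(2) by auto
    have ny: "norm y' \<le> 2" "0 < norm y'"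
      using y'(2) \<theta>(2) norm_J[OF Sc[OF y(1)]] y(2) norm_triangle_ineq2[of "J y" y'] norm_triangle_ineq3[of "J y" y']
      by linarith+
    have "m j * norm (J y - y') \<le> m j * \<theta>" using y'(2) by (intro mult_left_mono) auto
    then have py: "99 * lam \<le> ext_norm j y'"
      using p_close[of "J y" y'] p_J[OF Sc[OF y(1)]] wy \<theta>(3) lam by linarith
    obtain z where z: "z \<in> S" "1 / 2 \<le> nrm z" "nrm z \<le> 1" "wnorm j z \<le> 3"
      using small_wnorm_exists[OF S j] by blast
    obtain z' where z': "z' \<in> Y" "norm (J z - z') \<le> \<theta> * nrm z" using near[OF z(1)] by blast
    have nz0: "norm (z' - J z) \<le> \<theta>"
      using z'(2) mult_left_mono[OF z(3) less_imp_le[OF \<theta>(1)]]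
      unfolding norm_minus_commute[of z'] by linarith
    have nz: "1 / 4 \<le> norm z'"
      using nz0 \<theta>(2) norm_J[OF Sc[OF z(1)]] z(2) norm_triangle_ineq3[of z' "J z"] by linarith
    have "m j * norm (z' - J z) \<le> m j * \<theta>" using nz0 by (intro mult_left_mono) auto
    then have pz: "ext_norm j z' \<le> 4"
      using p_close[of z' "J z"] p_J[OF Sc[OF z(1)]] z(4) \<theta>(3) by linarith
    define y1 where "y1 = (1 / norm y') *\<^sub>R y'"
    define z1 where "z1 = (1 / norm z') *\<^sub>R z'"
    have z0: "0 < norm z'" using nz by linarith
    note y1 = normalize[OF y'(1) ny(2), folded y1_def] and z1 = normalize[OF z'(1) z0, folded z1_def]
    have "99 * lam / 2 \<le> ext_norm j y' / norm y'" using py ny lam by (intro frac_le) auto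
    then have py1: "16 * lam \<le> ext_norm j y1" using y1(3) lam by linarith
    have "ext_norm j z' / norm z' \<le> 4 / (1 / 4)" using pz nz by (intro frac_le) auto
    then have pz1: "ext_norm j z1 \<le> 16" using z1(3) by simp
    have pz0: "0 < ext_norm j z1" using p_ge[of z1] z1(2) by linarith
    have "lam * ext_norm j z1 \<le> lam * 16" using pz1 lam by (intro mult_left_mono) auto
    then have "lam \<le> ext_norm j y1 / ext_norm j z1" using py1 pz0 by (simp add: field_simps)
    also have "\<dots> \<le> Sup ?A"
    proof (rule cSup_upper)
      show "ext_norm j y1 / ext_norm j z1 \<in> ?A" using y1 z1 by blast
      show "bdd_above ?A"
      proof (rule bdd_aboveI)
        fix a assume "a \<in> ?A"
        then obtain u v where uv: "a = ext_norm j u / ext_norm j v" "norm u = 1" "norm v = 1" by blast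
        have "ext_norm j u / ext_norm j v \<le> real (m j) / 1"
          using p_ge[of v] p_le[of u] uv m0 by (intro frac_le) auto
        then show "a \<le> m j" using uv by simp
      qed
    qed
    finally show ?thesis .
  qed
  then show ?thesis
    unfolding distortable_def using ext_norm_equivalent[OF j] by blast
qed

end

theorem theorem2p18:
  fixes m t k :: "nat \<Rightarrow> nat"
    and J :: "(nat \<Rightarrow>\<^sub>0 real) \<Rightarrow> 'a::banach"
    and X :: "'a set"
  assumes "m 1 = 2"
    and "\<And>j. 2 \<le> j \<Longrightarrow> m j > m (j - 1) ^ m (j - 1)"
    and "k 1 = 1"
    and "\<And>n. 2 \<le> n \<Longrightarrow> 0 < t n \<and> 2 ^ t n \<ge> (m n)\<^sup>2"
    and "\<And>n. 2 \<le> n \<Longrightarrow> k n = t n * (k (n - 1) + 1) + 1"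
    and "is_completion (mixed_norm m k) J X"
  shows "arbitrarily_distortable X"
proof -
  interpret mixed_tsirelson_completion m t k J X
    by unfold_locales (rule assms; assumption)+
  show ?thesis by (simp add: arbitrarily_distortable_def distortable_X)
qed

end
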